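(* Let $\mathbb{T}^2=\mathbb{S}^1\times\mathbb{S}^1(1/\sqrt2)$ be the flat torus and let $\varphi:\mathbb{T}^2\to\mathbb{S}^5\subset\mathbb{C}^3=\mathbb{R}^6$ be the proper biharmonic Legendre embedding given by $$\varphi(\gamma,\vartheta)=\frac{1}{\sqrt2}\left(e^{\mathrm{i}\gamma},\ \mathrm{i}e^{-\mathrm{i}\gamma}\sin(\sqrt2\,\vartheta),\ \mathrm{i}e^{-\mathrm{i}\gamma}\cos(\sqrt2\,\vartheta)\right).$$ Then $$\mathrm{Index}(\varphi)=11\qquad\text{and}\qquad \mathrm{Nullity}(\varphi)=18.$$
   Context: $\mathbb{S}^1(r)$ is the circle of radius $r$, $\mathbb{S}^1=\mathbb{S}^1(1)$; the metric on $\mathbb{T}^2$ is $d\gamma^2+d\vartheta^2$ with $\gamma$ taken modulo $2\pi$ and $\vartheta$ modulo $\sqrt2\,\pi$. $\mathbb{S}^5$ is the unit sphere. (An isometric immersion into $\mathbb{S}^5\subset\mathbb{C}^3$ of a surface is Legendre if its tangent planes are orthogonal to the vector field $\xi_z=-\mathrm{i}z$.) For a smooth map $\varphi:M\to N$ of Riemannian manifolds, $M$ compact, the tension field is $\tau(\varphi)=\mathrm{trace}\,\nabla d\varphi$, and the bienergy is $E_2(\varphi)=\frac12\int_M|\tau(\varphi)|^2\,dv_M$. Biharmonic maps are the critical points of $E_2$; a biharmonic map is proper if it is not harmonic, i.e. $\tau(\varphi)\not\equiv0$. For a biharmonic map $\varphi$ and a two-parameter smooth variation $\varphi_{t,s}$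 with $\varphi_{0,0}=\varphi$, $V=\frac{d}{dt}|_{t=0}\varphi_{t,0}$, $W=\frac{d}{ds}|_{s=0}\varphi_{0,s}$, the Hessian is $H(E_2)_\varphi(V,W)=\frac{\partial^2}{\partial t\partial s}|_{(0,0)}E_2(\varphi_{t,s})=\int_M\langle I_2(V),W\rangle\,dv_M$, where the second variation operator $I_2$ acts on the space $\mathcal{C}(\varphi^{-1}TN)$ of smooth sections of the pull-back bundle $\varphi^{-1}TN$. When $N=\mathbb{S}^n$ is the unit sphere, with $\{e_i\}$ a local orthonormal frame of $M$, $\nabla^\varphi$ the induced connection on $\varphi^{-1}TN$ and $\overline{\Delta}=-\sum_i(\nabla^\varphi_{e_i}\nabla^\varphi_{e_i}-\nabla^\varphi_{\nabla^M_{e_i}e_i})$, it is $$\begin{aligned}I_2(V)=\ &\overline{\Delta}^2V+\overline{\Delta}\big(T(V)-|d\varphi|^2V\big)+2\langle d\tau(\varphi),d\varphi\rangle V+|\tau(\varphi)|^2V-2\sum_i\langle V,\nabla^\varphi_{e_i}\tau(\varphi)\rangle d\varphi(e_i)\\&-2\sum_i\langle\tau(\varphi),\nabla^\varphi_{e_i}V\rangle d\varphi(e_i)-\langle\tau(\varphi),V\rangle\tau(\varphi)+T(\overline{\Delta}V)+T(T(V))-2|d\varphi|^2T(V)\\&+2\langle dV,d\varphi\rangle\tau(\varphi)-|d\varphi|^2\overline{\Delta}V+|d\varphi|^4V,\end{aligned}$$ where $T(V)=\sum_i\langle V,d\varphi(e_i)\rangle d\varphi(e_i)$, $\langle d\tau(\varphi),d\varphi\rangle=\sum_i\langle\nabla^\varphi_{e_i}\tau(\varphi),d\varphi(e_i)\rangle$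 and $\langle dV,d\varphi\rangle=\sum_i\langle\nabla^\varphi_{e_i}V,d\varphi(e_i)\rangle$. Since $M$ is compact, $I_2$ has discrete spectrum $\lambda_1<\lambda_2<\cdots\to+\infty$ with finite-dimensional eigenspaces $\mathcal{V}_i$. Then $\mathrm{Index}(\varphi)=\sum_{\lambda_i<0}\dim\mathcal{V}_i$ and $\mathrm{Nullity}(\varphi)=\dim\{V\in\mathcal{C}(\varphi^{-1}TN): I_2(V)=0\}$. *)

theory Defs
  imports "HOL-Analysis.Analysis" "HOL-Library.Function_Algebras"
begin

section \<open>Maps and vector fields on the flat torus\<close>

text \<open>
  Maps on the flat torus (first coordinate modulo \<open>2 * pi\<close>, second coordinate modulo
  \<open>sqrt 2 * pi\<close>, metric induced by the Euclidean one) are represented by doubly periodic maps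
  on the plane \<^typ>\<open>real \<times> real\<close>.  The two coordinate fields are then a global orthonormal frame
  with \<open>\<nabla>\<^sup>M\<^bsub>e\<^esub> e' = 0\<close>; as constant vectors they are the elements of \<open>Basis\<close>.
\<close>

definition torus_periodic :: "(real \<times> real \<Rightarrow> 'a) \<Rightarrow> bool" where
  "torus_periodic V \<longleftrightarrow>
     (\<forall>x y. V (x + 2 * pi, y) = V (x, y) \<and> V (x, y + sqrt 2 * pi) = V (x, y))"

definition dirD :: "real \<times> real \<Rightarrow> (real \<times> real \<Rightarrow> 'a::real_normed_vector) \<Rightarrow> real \<times> real \<Rightarrow> 'a" where
  "dirD e V p = frechet_derivative V (at p) e"

primrec Ck_map :: "nat \<Rightarrow> (real \<times> real \<Rightarrow> 'a::real_normed_vector) \<Rightarrow> bool" where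
  "Ck_map 0 V \<longleftrightarrow> continuous_on UNIV V"
| "Ck_map (Suc k) V \<longleftrightarrow> (\<forall>p. V differentiable (at p)) \<and> (\<forall>e. Ck_map k (dirD e V))"

definition smooth_map :: "(real \<times> real \<Rightarrow> 'a::real_normed_vector) \<Rightarrow> bool" where
  "smooth_map V \<longleftrightarrow> (\<forall>k. Ck_map k V)"

section \<open>The second variation operator of a map into the unit sphere\<close>

text \<open>
  In this section \<open>\<phi>\<close> is a map from the torus to the unit sphere of a Euclidean space \<^typ>\<open>'a\<close>.
  Since the tangent space of the sphere at \<open>\<phi> p\<close> is the orthogonal complement of \<open>\<phi> p\<close>, sections
  of the pull-back bundle are maps \<open>V\<close> into \<^typ>\<open>'a\<close> with \<open>V p \<bullet> \<phi> p = 0\<close>, and the induced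
  connection is the tangential part of the derivative in \<^typ>\<open>'a\<close>.
\<close>

definition pullback_sections ::
    "(real \<times> real \<Rightarrow> 'a::euclidean_space) \<Rightarrow> (real \<times> real \<Rightarrow> 'a) set" where
  "pullback_sections \<phi> = {V. smooth_map V \<and> torus_periodic V \<and> (\<forall>p. V p \<bullet> \<phi> p = 0)}"

definition nabla ::
    "(real \<times> real \<Rightarrow> 'a::euclidean_space) \<Rightarrow> real \<times> real \<Rightarrow> (real \<times> real \<Rightarrow> 'a) \<Rightarrow> real \<times> real \<Rightarrow> 'a" where
  "nabla \<phi> e V p = dirD e V p - (dirD e V p \<bullet> \<phi> p) *\<^sub>R \<phi> p"

definition tension ::
    "(real \<times> real \<Rightarrow> 'a::euclidean_space) \<Rightarrow> real \<times> real \<Rightarrow> 'a" where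
  "tension \<phi> p = (\<Sum>e\<in>Basis. nabla \<phi> e (dirD e \<phi>) p)"

definition rough_laplacian ::
    "(real \<times> real \<Rightarrow> 'a::euclidean_space) \<Rightarrow> (real \<times> real \<Rightarrow> 'a) \<Rightarrow> real \<times> real \<Rightarrow> 'a" where
  "rough_laplacian \<phi> V p = - (\<Sum>e\<in>Basis. nabla \<phi> e (nabla \<phi> e V) p)"

definition dnorm_sq :: "(real \<times> real \<Rightarrow> 'a::euclidean_space) \<Rightarrow> real \<times> real \<Rightarrow> real" where
  "dnorm_sq \<phi> p = (\<Sum>e\<in>Basis. (norm (dirD e \<phi> p))\<^sup>2)"

definition T_op ::
    "(real \<times> real \<Rightarrow> 'a::euclidean_space) \<Rightarrow> (real \<times> real \<Rightarrow> 'a) \<Rightarrow> real \<times> real \<Rightarrow> 'a" where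
  "T_op \<phi> V p = (\<Sum>e\<in>Basis. (V p \<bullet> dirD e \<phi> p) *\<^sub>R dirD e \<phi> p)"

definition d_inner ::
    "(real \<times> real \<Rightarrow> 'a::euclidean_space) \<Rightarrow> (real \<times> real \<Rightarrow> 'a) \<Rightarrow> real \<times> real \<Rightarrow> real" where
  "d_inner \<phi> V p = (\<Sum>e\<in>Basis. nabla \<phi> e V p \<bullet> dirD e \<phi> p)"

definition I2 ::
    "(real \<times> real \<Rightarrow> 'a::euclidean_space) \<Rightarrow> (real \<times> real \<Rightarrow> 'a) \<Rightarrow> real \<times> real \<Rightarrow> 'a" where
  "I2 \<phi> V p =
     rough_laplacian \<phi> (rough_laplacian \<phi> V) p
   + rough_laplacian \<phi> (\<lambda>q. T_op \<phi> V q - dnorm_sq \<phi> q *\<^sub>R V q) p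
   + (2 * d_inner \<phi> (tension \<phi>) p) *\<^sub>R V p
   + (norm (tension \<phi> p))\<^sup>2 *\<^sub>R V p
   - 2 *\<^sub>R (\<Sum>e\<in>Basis. (V p \<bullet> nabla \<phi> e (tension \<phi>) p) *\<^sub>R dirD e \<phi> p)
   - 2 *\<^sub>R (\<Sum>e\<in>Basis. (tension \<phi> p \<bullet> nabla \<phi> e V p) *\<^sub>R dirD e \<phi> p)
   - (tension \<phi> p \<bullet> V p) *\<^sub>R tension \<phi> p
   + T_op \<phi> (rough_laplacian \<phi> V) p
   + T_op \<phi> (T_op \<phi> V) p
   - (2 * dnorm_sq \<phi> p) *\<^sub>R T_op \<phi> V p
   + (2 * d_inner \<phi> V p) *\<^sub>R tension \<phi> p
   - dnorm_sq \<phi> p *\<^sub>R rough_laplacian \<phi> V p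
   + (dnorm_sq \<phi> p)\<^sup>2 *\<^sub>R V p"

section \<open>Index and nullity\<close>

interpretation fun_space:
  vector_space "\<lambda>(c::real) (V :: 'b \<Rightarrow> 'a::real_vector) p. c *\<^sub>R V p"
  by unfold_locales (auto simp: fun_eq_iff scaleR_add_right scaleR_add_left)

text \<open>
  The library's \<open>dim\<close> is \<open>0\<close> on spaces without a finite basis, so the dimension of a linear
  subspace is taken as an extended natural number.
\<close>

definition edim :: "('b \<Rightarrow> 'a::real_vector) set \<Rightarrow> enat" where
  "edim S = (if \<exists>B. finite B \<and> S \<subseteq> fun_space.span B then enat (fun_space.dim S) else \<infinity>)"

definition eigenspace ::
    "(real \<times> real \<Rightarrow> 'a::euclidean_space) \<Rightarrow> real \<Rightarrow> (real \<times> real \<Rightarrow> 'a) set" where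
  "eigenspace \<phi> \<mu> = {V \<in> pullback_sections \<phi>. \<forall>p. I2 \<phi> V p = \<mu> *\<^sub>R V p}"

text \<open>
  The sum ranges over all negative reals, those that are not eigenvalues contributing \<open>0\<close>.
  In \<^typ>\<open>enat\<close> every such sum exists, and it is infinite whenever there are infinitely many
  negative eigenvalues.
\<close>

definition Index :: "(real \<times> real \<Rightarrow> 'a::euclidean_space) \<Rightarrow> enat" where
  "Index \<phi> = (\<Sum>\<^sub>\<infinity>\<mu>\<in>{..<0}. edim (eigenspace \<phi> \<mu>))"

definition Nullity :: "(real \<times> real \<Rightarrow> 'a::euclidean_space) \<Rightarrow> enat" where
  "Nullity \<phi> = edim {V \<in> pullback_sections \<phi>. \<forall>p. I2 \<phi> V p = 0}"

section \<open>The Legendre embedding\<close>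

text \<open>
  The inner product of \<^typ>\<open>complex ^ 3\<close> is the real one, so this is Euclidean 6-space.
\<close>

definition phi :: "real \<times> real \<Rightarrow> complex ^ 3" where
  "phi = (\<lambda>(\<gamma>, \<theta>). (1 / sqrt 2) *\<^sub>R
     vector [cis \<gamma>,
             \<i> * cis (- \<gamma>) * of_real (sin (sqrt 2 * \<theta>)),
             \<i> * cis (- \<gamma>) * of_real (cos (sqrt 2 * \<theta>))])"

lemma torus_periodic_phi: "torus_periodic phi"
proof -
  have s: "sqrt 2 * (y + sqrt 2 * pi) = sqrt 2 * y + 2 * pi" for y
    by (simp add: algebra_simps)
  have c: "cis (x + 2 * pi) = cis x" "cis (- x - 2 * pi) = cis (- x)" for x
    using cis_mult[of x "2 * pi"] cis_mult[of "- x" "- 2 * pi"]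
    by (auto simp: complex_eq_iff cos_diff sin_diff)
  show ?thesis
    unfolding torus_periodic_def phi_def prod.case s by (simp add: c)
qed

lemma norm_phi: "norm (phi p) = 1"
proof (cases p)
  case (Pair x y)
  have "1 / 2 + (sin (sqrt 2 * y))\<^sup>2 / 2 + (cos (sqrt 2 * y))\<^sup>2 / 2 = 1"
    unfolding sin_squared_eq by (simp add: field_simps)
  then show ?thesis
    unfolding Pair phi_def norm_vec_def L2_set_def prod.case sum_3
    by (simp add: norm_mult power_mult_distrib power_divide)
qed

text \<open>
  The following facts show that \<open>phi\<close> is a proper biharmonic Legendre embedding; the first one
  is injectivity modulo the period lattice.
\<close>

lemma phi_inj:
  assumes "phi (x, y) = phi (x', y')"
  shows "\<exists>m n :: int. x' = x + 2 * pi * m \<and> y' = y + sqrt 2 * pi * n"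
proof -
  have c: "cis x = cis x'"
    and *: "cis (- x) * of_real (sin (sqrt 2 * y)) = cis (- x') * of_real (sin (sqrt 2 * y'))"
           "cis (- x) * of_real (cos (sqrt 2 * y)) = cis (- x') * of_real (cos (sqrt 2 * y'))"
    using assms by (auto simp: phi_def vec_eq_iff forall_3)
  have "cis (- x) = cis (- x')"
    using c by (simp flip: cis_cnj)
  with * have "complex_of_real (sin (sqrt 2 * y)) = of_real (sin (sqrt 2 * y'))"
    "complex_of_real (cos (sqrt 2 * y)) = of_real (cos (sqrt 2 * y'))"
    by simp_all
  then have "sin (sqrt 2 * y') = sin (sqrt 2 * y) \<and> cos (sqrt 2 * y') = cos (sqrt 2 * y)"
    unfolding of_real_eq_iff by simp
  moreover have "sin x' = sin x \<and> cos x' = cos x"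
    using c by (simp add: complex_eq_iff)
  ultimately obtain m n :: int
    where m: "x' = x + 2 * pi * m" and n: "sqrt 2 * y' = sqrt 2 * y + 2 * pi * n"
    unfolding sin_cos_eq_iff by auto
  have "sqrt 2 * y' = sqrt 2 * (y + sqrt 2 * pi * n)"
    unfolding n by (simp add: algebra_simps)
  then have "y' = y + sqrt 2 * pi * n"
    by (metis mult_left_cancel real_sqrt_eq_zero_cancel_iff zero_neq_numeral)
  then show ?thesis
    using m by auto
qed

text \<open>A family of maps that contains \<open>phi\<close> and is closed under differentiation.\<close>

definition gen :: "complex \<Rightarrow> complex \<Rightarrow> complex \<Rightarrow> complex \<Rightarrow> complex \<Rightarrow> real \<times> real \<Rightarrow> complex ^ 3" where
  "gen c p q r s = (\<lambda>(x, y). vector [c * cis x,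
     cis (- x) * (p * of_real (sin (sqrt 2 * y)) + q * of_real (cos (sqrt 2 * y))),
     cis (- x) * (r * of_real (sin (sqrt 2 * y)) + s * of_real (cos (sqrt 2 * y)))])"

lemma phi_gen: "phi = gen (1 / sqrt 2) (\<i> / sqrt 2) 0 0 (\<i> / sqrt 2)"
  by (auto simp: phi_def gen_def fun_eq_iff vec_eq_iff forall_3 scaleR_conv_of_real[where 'a = complex])

lemma has_derivative_gen:
  fixes c p q r s :: complex
  shows "(gen c p q r s has_derivative (\<lambda>(a :: real, b :: real).
     gen (\<i> * a * c) (- \<i> * a * p - sqrt 2 * b * q) (- \<i> * a * q + sqrt 2 * b * p)
         (- \<i> * a * r - sqrt 2 * b * s) (- \<i> * a * s + sqrt 2 * b * r) z)) (at z)"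
proof -
  have vec: "vector [u, v, w] = (axis 1 u + axis 2 v + axis 3 w :: complex ^ 3)" for u v w :: complex
    by (auto simp: vec_eq_iff forall_3 axis_def)
  have bl: "bounded_linear (axis i :: complex \<Rightarrow> complex ^ 3)" for i
    by (intro linear_conv_bounded_linear[THEN iffD1] linearI) (auto simp: vec_eq_iff axis_def)
  show ?thesis
    unfolding gen_def case_prod_beta vec
    apply (rule has_derivative_eq_rhs)
     apply (rule derivative_eq_intros bounded_linear.has_derivative[OF bl] refl)+
    apply (cases z)
    apply (auto simp: fun_eq_iff vec_eq_iff forall_3 axis_def scaleR_conv_of_real algebra_simps)
    done
qed

lemma dirD_gen:
  fixes c p q r s :: complex
  shows "dirD (a, b) (gen c p q r s) =
     gen (\<i> * a * c) (- \<i> * a * p - sqrt 2 * b * q) (- \<i> * a * q + sqrt 2 * b * p)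
         (- \<i> * a * r - sqrt 2 * b * s) (- \<i> * a * s + sqrt 2 * b * r)"
  by (simp add: fun_eq_iff dirD_def frechet_derivative_at[OF has_derivative_gen, symmetric])

lemma inner_gen:
  fixes c p q r s c' p' q' r' s' :: complex
  shows "gen c p q r s (x, y) \<bullet> gen c' p' q' r' s' (x, y) = c \<bullet> c'
     + (p * sin (sqrt 2 * y) + q * cos (sqrt 2 * y)) \<bullet> (p' * sin (sqrt 2 * y) + q' * cos (sqrt 2 * y))
     + (r * sin (sqrt 2 * y) + s * cos (sqrt 2 * y)) \<bullet> (r' * sin (sqrt 2 * y) + s' * cos (sqrt 2 * y))"
proof -
  have "(u * cis t) \<bullet> (v * cis t) = u \<bullet> v" for u v t
  proof -
    have "(u * cis t) \<bullet> (v * cis t) = (u \<bullet> v) * ((cos t)\<^sup>2 + (sin t)\<^sup>2)"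
      unfolding inner_complex_def times_complex.sel cis.sel by algebra
    then show ?thesis by simp
  qed
  from this this[unfolded mult.commute[of _ "cis _"]] show ?thesis
    by (simp add: gen_def inner_vec_def sum_3)
qed

lemma phi_isometric: "dirD u phi p \<bullet> dirD v phi p = u \<bullet> v"
proof -
  obtain x y a b a' b' where *: "p = (x, y)" "u = (a, b)" "v = (a', b')"
    by (cases p; cases u; cases v)
  have 1: "(sin (sqrt 2 * y))\<^sup>2 + (cos (sqrt 2 * y))\<^sup>2 = 1" by simp
  show ?thesis
    unfolding * phi_gen dirD_gen inner_gen
    by (simp add: inner_complex_def) (use 1 in algebra)
qed

lemma phi_legendre: "dirD u phi p \<bullet> (- \<i> *s phi p) = 0"
proof -
  obtain x y a b where *: "p = (x, y)" "u = (a, b)"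
    by (cases p; cases u)
  have 1: "(sin (sqrt 2 * y))\<^sup>2 + (cos (sqrt 2 * y))\<^sup>2 = 1" by simp
  have i: "- \<i> *s gen c p q r s z = gen (- \<i> * c) (- \<i> * p) (- \<i> * q) (- \<i> * r) (- \<i> * s) z"
    for c p q r s z
    by (auto simp: gen_def vec_eq_iff forall_3 algebra_simps split: prod.split)
  show ?thesis
    unfolding * phi_gen dirD_gen i inner_gen
    by (simp add: inner_complex_def) (use 1 in algebra)
qed

lemma sin_cos_sq: "sin t * sin t + cos t * cos t = (1::real)"
  by (simp flip: power2_eq_square)

lemma csqrt2_sq:
  "complex_of_real (sqrt 2) * complex_of_real (sqrt 2) = 2"
  "complex_of_real (sqrt 2) * (complex_of_real (sqrt 2) * w) = 2 * w"
  by (simp_all flip: of_real_mult mult.assoc)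

lemma tension_phi:
  "tension phi = gen (1 / sqrt 2) (- \<i> / sqrt 2) 0 0 (- \<i> / sqrt 2)"
proof
  fix z :: "real \<times> real"
  obtain x y where z: "z = (x, y)" by (cases z)
  have h: "- (sin (sqrt 2 * y) * sin (sqrt 2 * y)) - cos (sqrt 2 * y) * cos (sqrt 2 * y) = - 1"
    "- (1 / 2) - sin (sqrt 2 * y) * sin (sqrt 2 * y) / 2 - cos (sqrt 2 * y) * cos (sqrt 2 * y) / 2 = - 1"
    using sin_cos_sq[of "sqrt 2 * y"] by linarith+
  show "tension phi z = gen (1 / sqrt 2) (- \<i> / sqrt 2) 0 0 (- \<i> / sqrt 2) z"
    apply (simp add: z tension_def nabla_def phi_gen Basis_prod_def dirD_gen inner_gen)
    apply (simp add: inner_complex_def h)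
    apply (simp add: gen_def vec_eq_iff forall_3 scaleR_conv_of_real[where 'a = complex] csqrt2_sq field_simps)
    done
qed

text \<open>
  The second fact below is the Euler-Lagrange equation of the bienergy for maps into the unit
  sphere.
\<close>

lemma norm_tension_phi: "norm (tension phi p) = 1"
proof -
  obtain x y where p: "p = (x, y)" by (cases p)
  have 1: "(sin (sqrt 2 * y))\<^sup>2 + (cos (sqrt 2 * y))\<^sup>2 = 1" by simp
  have "tension phi p \<bullet> tension phi p = 1"
    unfolding p tension_phi inner_gen
    by (simp add: inner_complex_def) (use 1 in algebra)
  then show ?thesis
    by (simp add: norm_eq_sqrt_inner)
qed

lemma nabla_tension_phi:
  "nabla phi (1, 0) (tension phi) = gen (\<i> / sqrt 2) (- 1 / sqrt 2) 0 0 (- 1 / sqrt 2)"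
  "nabla phi (0, 1) (tension phi) = gen 0 0 (- \<i>) \<i> 0"
  unfolding tension_phi
  by (auto simp: fun_eq_iff nabla_def phi_gen dirD_gen inner_gen)
     (auto simp: inner_complex_def)

lemma phi_biharmonic_equation:
  "rough_laplacian phi (tension phi) p + T_op phi (tension phi) p = dnorm_sq phi p *\<^sub>R tension phi p"
proof -
  obtain x y where p: "p = (x, y)" by (cases p)
  have h: "sin (sqrt 2 * y) * sin (sqrt 2 * y) / 2 - 1 / 2 + cos (sqrt 2 * y) * cos (sqrt 2 * y) / 2 = 0"
    using sin_cos_sq[of "sqrt 2 * y"] by linarith
  show ?thesis
    apply (simp add: rough_laplacian_def T_op_def dnorm_sq_def Basis_prod_def nabla_tension_phi
        power2_norm_eq_inner phi_isometric)
    apply (simp add: tension_phi)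
    apply (simp add: nabla_def phi_gen dirD_gen inner_gen p)
    apply (simp add: inner_complex_def h sin_cos_sq)
    apply (simp add: gen_def vec_eq_iff forall_3 scaleR_conv_of_real[where 'a = complex] csqrt2_sq field_simps)
    done
qed

lemma Ck_map_gen: "Ck_map k (gen c p q r s)"
proof (induction k arbitrary: c p q r s)
  case 0
  show ?case
    using has_derivative_gen has_derivative_continuous
    by (fastforce simp: continuous_on_eq_continuous_within)
next
  case (Suc k)
  show ?case
    using Suc has_derivative_gen by (fastforce simp: differentiable_def dirD_gen)
qed

lemma smooth_map_phi: "smooth_map phi"
  by (simp add: smooth_map_def phi_gen Ck_map_gen)

end

theory Submission
  imports Defs
begin

text \<open>
  The embedding is an orbit of a two-parameter group of unitary maps, a diagonal rotation in
  \<open>\<gamma>\<close> and a real rotation of the last two coordinates in \<open>\<theta>\<close>.  The orthonormal frame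
  \<open>\<phi>\<^sub>\<gamma>\<close>, \<open>\<phi>\<^sub>\<theta>\<close>, \<open>i \<phi>\<^sub>\<gamma>\<close>, \<open>i \<phi>\<^sub>\<theta>\<close>, \<open>i \<phi>\<close> of the pull-back bundle is moved along by this
  group, so it is doubly periodic and the induced connection has constant coefficients in it.  A
  section thus becomes a doubly periodic map \<open>F\<close> into \<open>\<real>\<^sup>5\<close>, and the second variation operator
  becomes an operator with constant coefficients.  It has the form \<open>J\<^sup>2 - N\<close>, where
  \<open>J = \<Delta> - 2 + T\<close> is the Jacobi operator of the energy and \<open>N\<close> has order one
  (\<open>I2_frame_section\<close>).

  Constant coefficients call for Fourier series.  The waves \<open>cas (m \<gamma>) cas (n \<surd>2 \<theta>)\<close> with
  \<open>cas = cos + sin\<close>, for integers \<open>m\<close> and \<open>n\<close>, form an orthogonal system of real functions, and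
  differentiating one of them only reflects its index.  If the reflected indices are distributed
  suitably over the five components, \<open>I2\<close> acts on the amplitudes with index \<open>(m, n)\<close> by one real
  \<open>5 \<times> 5\<close> matrix, and different indices decouple.  Since the waves are complete, by the
  Stone-Weierstrass theorem, the dimension of an eigenspace of \<open>I2\<close> is the sum over all
  \<open>(m, n)\<close> of the dimensions of the eigenspaces of these matrices (\<open>edim_eigenspace_phi\<close>).

  It remains to find the eigenvalues \<open>\<mu> \<le> 0\<close> of the matrices.  The Jacobi part is bounded below
  by \<open>(\<bar>m\<bar> - 1)\<^sup>2 + 2 (\<bar>n\<bar> - 1)\<^sup>2 - 2\<close>, where a square is read as \<open>0\<close> if its index vanishes, and
  \<open>N\<close> grows only linearly in \<open>m\<close> and \<open>n\<close>; so all but finitely many matrices are positive definite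
  (\<open>mode_eigenspace_high\<close>).  The others are explicit integer matrices, for which

    \<^item> \<open>(0, 0)\<close> has the eigenvalue \<open>-4\<close> once and \<open>0\<close> four times,
    \<^item> \<open>(\<plusminus>1, 0)\<close> has \<open>-1\<close> and \<open>3 - 2 \<surd>6\<close> once each,
    \<^item> \<open>(\<plusminus>2, 0)\<close> has the negative root of a cubic and \<open>0\<close> once each,
    \<^item> \<open>(\<plusminus>1, \<plusminus>1)\<close> has the negative root of a quintic once,
    \<^item> \<open>(0, \<plusminus>1)\<close> has \<open>0\<close> three times, \<open>(0, \<plusminus>2)\<close> and \<open>(\<plusminus>2, \<plusminus>1)\<close> have \<open>0\<close> once,

  and no further eigenvalue is \<open>\<le> 0\<close>.  The negative ones contribute \<open>1 + 4 + 2 + 4 = 11\<close>, the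
  zeros \<open>4 + 2 + 6 + 2 + 4 = 18\<close>.
\<close>

section \<open>Smooth maps on the torus\<close>

lemma has_derivative_dirD: "f differentiable (at p) \<Longrightarrow> (f has_derivative (\<lambda>e. dirD e f p)) (at p)"
  by (simp add: dirD_def frechet_derivative_works)

lemma dirD_eqI: "(f has_derivative f') (at p) \<Longrightarrow> dirD e f p = f' e"
  by (simp add: dirD_def frechet_derivative_at[symmetric])

lemma smooth_mapD:
  assumes "smooth_map f"
  shows "f differentiable (at p)" "smooth_map (dirD e f)" "continuous_on UNIV f"
proof -
  have *: "Ck_map (Suc k) f" for k
    using assms unfolding smooth_map_def by blast
  from *[of 0] show "f differentiable (at p)" by (simp del: split_paired_All)
  from * show "smooth_map (dirD e f)" by (simp add: smooth_map_def del: split_paired_All)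
  show "continuous_on UNIV f"
    using assms unfolding smooth_map_def by (metis Ck_map.simps(1))
qed

lemma Ck_map_Suc_imp: "Ck_map (Suc k) f \<Longrightarrow> Ck_map k f"
proof (induction k arbitrary: f)
  case 0
  then show ?case
    by (simp add: continuous_at_imp_continuous_on differentiable_imp_continuous_within)
next
  case (Suc k)
  then show ?case by (metis Ck_map.simps(2))
qed

lemma Ck_map_add:
  "Ck_map k f \<Longrightarrow> Ck_map k g \<Longrightarrow> Ck_map k (\<lambda>p. f p + g p)"
proof (induction k arbitrary: f g)
  case (Suc k)
  have "dirD e (\<lambda>p. f p + g p) = (\<lambda>p. dirD e f p + dirD e g p)" for e
    using Suc.prems by (auto simp: fun_eq_iff intro!: dirD_eqI has_derivative_add has_derivative_dirD)
  then show ?case using Suc by simp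
qed (simp add: continuous_on_add)

text \<open>
  The product rule gives the induction step.  Inner products and scalar multiples are the
  instances that matter: they pass between a section and its components in the moving frame.
\<close>

lemma Ck_map_bilinear:
  assumes "bounded_bilinear bop"
  shows "Ck_map k f \<Longrightarrow> Ck_map k g \<Longrightarrow> Ck_map k (\<lambda>p. bop (f p) (g p))"
proof (induction k arbitrary: f g)
  case 0
  then show ?case by (simp add: bounded_bilinear.continuous_on[OF assms])
next
  case (Suc k)
  have d: "((\<lambda>p. bop (f p) (g p)) has_derivative
      (\<lambda>e. bop (f p) (dirD e g p) + bop (dirD e f p) (g p))) (at p)" for p
    using Suc.prems by (intro bounded_bilinear.FDERIV[OF assms] has_derivative_dirD) (auto simp del: split_paired_All)
  have "dirD e (\<lambda>p. bop (f p) (g p)) = (\<lambda>p. bop (f p) (dirD e g p) + bop (dirD e f p) (g p))" for e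
    by (auto simp: fun_eq_iff intro!: dirD_eqI[OF d])
  moreover have "Ck_map k f" "Ck_map k g" using Suc.prems Ck_map_Suc_imp by blast+
  ultimately show ?case
    using Suc d by (auto simp: differentiable_def simp del: split_paired_All intro!: Ck_map_add exI)
qed

lemma dirD_linear:
  assumes "bounded_linear h" "f differentiable (at p)"
  shows "dirD e (\<lambda>p. h (f p)) p = h (dirD e f p)"
  by (rule dirD_eqI[OF bounded_linear.has_derivative[OF assms(1) has_derivative_dirD[OF assms(2)]]])

lemma Ck_map_linear:
  assumes h: "bounded_linear h"
  shows "Ck_map k f \<Longrightarrow> Ck_map k (\<lambda>p. h (f p))"
proof (induction k arbitrary: f)
  case 0
  then show ?case by (simp add: bounded_linear.continuous_on[OF h])
next
  case (Suc k)
  then have "dirD e (\<lambda>p. h (f p)) = (\<lambda>p. h (dirD e f p))" for e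
    using dirD_linear[OF h] by (simp add: fun_eq_iff)
  then show ?case
    using Suc h by (auto intro: bounded_linear_imp_differentiable differentiable_compose)
qed

lemma dirD_Pair:
  "f differentiable (at p) \<Longrightarrow> g differentiable (at p) \<Longrightarrow>
     dirD e (\<lambda>p. (f p, g p)) p = (dirD e f p, dirD e g p)"
  by (rule dirD_eqI[OF has_derivative_Pair[OF has_derivative_dirD has_derivative_dirD]])

lemma differentiable_Pair:
  "f differentiable (at p) \<Longrightarrow> g differentiable (at p) \<Longrightarrow> (\<lambda>p. (f p, g p)) differentiable (at p)"
  unfolding differentiable_def by (blast intro: has_derivative_Pair)

lemma Ck_map_Pair:
  "Ck_map k f \<Longrightarrow> Ck_map k g \<Longrightarrow> Ck_map k (\<lambda>p. (f p, g p))"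
proof (induction k arbitrary: f g)
  case (Suc k)
  then have "dirD e (\<lambda>p. (f p, g p)) = (\<lambda>p. (dirD e f p, dirD e g p))" for e
    by (simp add: fun_eq_iff dirD_Pair)
  then show ?case using Suc by (simp add: differentiable_Pair)
qed (simp add: continuous_on_Pair)

lemma smooth_map_add: "smooth_map f \<Longrightarrow> smooth_map g \<Longrightarrow> smooth_map (\<lambda>p. f p + g p)"
  by (simp add: smooth_map_def Ck_map_add)

lemma smooth_map_linear: "bounded_linear h \<Longrightarrow> smooth_map f \<Longrightarrow> smooth_map (\<lambda>p. h (f p))"
  by (simp add: smooth_map_def Ck_map_linear)

lemma smooth_map_bilinear:
  "bounded_bilinear bop \<Longrightarrow> smooth_map f \<Longrightarrow> smooth_map g \<Longrightarrow> smooth_map (\<lambda>p. bop (f p) (g p))"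
  by (simp add: smooth_map_def Ck_map_bilinear)

lemma smooth_map_gen: "smooth_map (gen c p q r s)"
  by (simp add: smooth_map_def Ck_map_gen)

text \<open>
  Differentiation commutes with translations.
\<close>

lemma torus_periodic_dirD:
  assumes diff: "\<And>p. f differentiable (at p)" and per: "torus_periodic f"
  shows "torus_periodic (dirD e f)"
proof -
  have "dirD e f (p + c) = dirD e f p" if c: "\<And>p. f (p + c) = f p" for c p
  proof -
    have "((\<lambda>p. f (p + c)) has_derivative (\<lambda>e. dirD e f (p + c))) (at p)"
      by (rule has_derivative_compose[OF _ has_derivative_dirD[OF diff]])
         (auto intro!: derivative_eq_intros)
    then show ?thesis by (simp add: c dirD_eqI)
  qed
  note shift = this
  have "f (p + (2 * pi, 0)) = f p" "f (p + (0, sqrt 2 * pi)) = f p" for p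
    using per by (cases p; simp add: torus_periodic_def)+
  from shift[OF this(1), of "(_, _)"] shift[OF this(2), of "(_, _)"] show ?thesis
    by (simp add: torus_periodic_def)
qed

section \<open>Hartley waves and Hartley coefficients\<close>

text \<open>
  Hartley's kernel.  With \<open>cas\<close> in place of complex exponentials all amplitudes of real
  sections stay real, and no reality condition between the indices \<open>k\<close> and \<open>- k\<close> has to be carried
  along when real dimensions are counted.
\<close>

definition cas :: "real \<Rightarrow> real" where
  "cas t = cos t + sin t"

text \<open>
  The factor \<open>sqrt 2\<close> matches the period \<open>sqrt 2 * pi\<close> of the second coordinate.
\<close>

definition hartley :: "int \<Rightarrow> int \<Rightarrow> real \<times> real \<Rightarrow> real" where
  "hartley m n p = cas (of_int m * fst p) * cas (of_int n * (sqrt 2 * snd p))"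

abbreviation period_box :: "(real \<times> real) set" where
  "period_box \<equiv> cbox (0, 0) (2 * pi, sqrt 2 * pi)"

definition hartley_coef :: "int \<Rightarrow> int \<Rightarrow> (real \<times> real \<Rightarrow> real) \<Rightarrow> real" where
  "hartley_coef m n f = integral period_box (\<lambda>p. f p * hartley m n p)"

lemma cas_add_int_period: "cas (of_int m * x + of_int m * (2 * pi)) = cas (of_int m * x)"
proof -
  have "cos (of_int m * x + of_int m * (2 * pi)) = cos (of_int m * x)"
    "sin (of_int m * x + of_int m * (2 * pi)) = sin (of_int m * x)"
    unfolding cos_add sin_add
    using cos_int_2pin[of m] sin_int_2pin[of m] by (simp_all add: ac_simps)
  then show ?thesis by (simp add: cas_def)
qed

lemma torus_periodic_hartley: "torus_periodic (hartley m n)"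
proof -
  have e: "of_int m * (x + 2 * pi) = of_int m * x + of_int m * (2 * pi)"
    "of_int n * (sqrt 2 * (y + sqrt 2 * pi)) = of_int n * (sqrt 2 * y) + of_int n * (2 * pi)"
    for x y by (simp_all add: algebra_simps)
  show ?thesis
    unfolding torus_periodic_def hartley_def fst_conv snd_conv e by (simp add: cas_add_int_period)
qed

lemma has_derivative_hartley:
  "(hartley m n has_derivative (\<lambda>(a, b). a * of_int m * hartley (- m) n p
      + b * sqrt 2 * of_int n * hartley m (- n) p)) (at p)"
  unfolding hartley_def cas_def
  apply (rule has_derivative_eq_rhs)
   apply (rule derivative_eq_intros refl)+
  apply (auto simp: fun_eq_iff algebra_simps)
  done

text \<open>
  Since \<open>cas' t = cas (- t)\<close>, a derivative reflects one of the two indices.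
\<close>

lemma dirD_hartley:
  "dirD (a, b) (hartley m n) =
     (\<lambda>p. a * of_int m * hartley (- m) n p + b * sqrt 2 * of_int n * hartley m (- n) p)"
  by (simp add: fun_eq_iff dirD_def frechet_derivative_at[OF has_derivative_hartley, symmetric])

lemma differentiable_hartley: "hartley m n differentiable (at p)"
  using has_derivative_hartley differentiable_def by blast

lemma continuous_on_hartley [continuous_intros]: "continuous_on S (hartley m n)"
  unfolding hartley_def cas_def by (intro continuous_intros)

lemma dirD_mult:
  fixes f g :: "real \<times> real \<Rightarrow> real"
  assumes "f differentiable (at p)" "g differentiable (at p)"
  shows "dirD e (\<lambda>p. f p * g p) p = f p * dirD e g p + dirD e f p * g p"
  by (rule dirD_eqI[OF has_derivative_mult[OF assms[THEN has_derivative_dirD]]])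

text \<open>
  By Fubini one may integrate first along the circles in direction \<open>e\<close>, and along each of
  them the fundamental theorem of calculus gives \<open>0\<close>.
\<close>

lemma integral_dirD_periodic:
  fixes g :: "real \<times> real \<Rightarrow> real"
  assumes diff: "\<And>p. g differentiable (at p)" and per: "torus_periodic g"
    and cont: "\<And>e. continuous_on UNIV (dirD e g)" and e: "e \<in> Basis"
  shows "integral period_box (dirD e g) = 0"
proof -
  have c: "continuous_on A (\<lambda>(x, y). dirD e g (x, y))" for A e
    using continuous_on_subset[OF cont] by simp
  have line: "((\<lambda>t. g (p + t *\<^sub>R e)) has_vector_derivative dirD e g (p + t *\<^sub>R e)) (at t within S)" for p e t S
  proof -
    have "((\<lambda>t. g (p + t *\<^sub>R e)) has_derivative (\<lambda>s. dirD (s *\<^sub>R e) g (p + t *\<^sub>R e))) (at t within S)"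
      by (rule has_derivative_compose[OF _ has_derivative_dirD[OF diff]])
         (auto intro!: derivative_eq_intros)
    moreover have "dirD (s *\<^sub>R e) g (p + t *\<^sub>R e) = s *\<^sub>R dirD e g (p + t *\<^sub>R e)" for s
      by (rule linear_cmul[OF has_derivative_linear[OF has_derivative_dirD[OF diff]]])
    ultimately show ?thesis by (simp add: has_vector_derivative_def)
  qed
  have x: "integral (cbox 0 (2 * pi)) (\<lambda>x. dirD (1, 0) g (x, y)) = 0" for y
  proof -
    have "((\<lambda>x. dirD (1, 0) g (x, y)) has_integral g (2 * pi, y) - g (0, y)) {0..2 * pi}"
      by (rule fundamental_theorem_of_calculus) (use line[of "(0, y)" "(1, 0)"] in auto)
    moreover have "g (2 * pi, y) = g (0, y)"
      using per[unfolded torus_periodic_def, rule_format, of 0 y] by simp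
    ultimately show ?thesis by (simp add: integral_unique)
  qed
  have y: "integral (cbox 0 (sqrt 2 * pi)) (\<lambda>y. dirD (0, 1) g (x, y)) = 0" for x
  proof -
    have "((\<lambda>y. dirD (0, 1) g (x, y)) has_integral g (x, sqrt 2 * pi) - g (x, 0)) {0..sqrt 2 * pi}"
      by (rule fundamental_theorem_of_calculus) (use line[of "(x, 0)" "(0, 1)"] in auto)
    moreover have "g (x, sqrt 2 * pi) = g (x, 0)"
      using per[unfolded torus_periodic_def, rule_format, of x 0] by simp
    ultimately show ?thesis by (simp add: integral_unique)
  qed
  from e consider "e = (1, 0)" | "e = (0, 1)" by (auto simp: Basis_prod_def)
  then show ?thesis
  proof cases
    case 1
    then show ?thesis
      using integral_prod_continuous[OF c, of 0 0 "2 * pi" "sqrt 2 * pi" "(1, 0)"]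
        integral_swap_continuous[OF c, of 0 "2 * pi" 0 "sqrt 2 * pi" "(1, 0)"] x
      by simp
  next
    case 2
    then show ?thesis
      using integral_prod_continuous[OF c, of 0 0 "2 * pi" "sqrt 2 * pi" "(0, 1)"] y by simp
  qed
qed

lemma torus_periodic_mult:
  fixes f g :: "real \<times> real \<Rightarrow> real"
  shows "torus_periodic f \<Longrightarrow> torus_periodic g \<Longrightarrow> torus_periodic (\<lambda>p. f p * g p)"
  by (simp add: torus_periodic_def)

lemma integrable_period_box:
  fixes f :: "real \<times> real \<Rightarrow> real"
  shows "continuous_on UNIV f \<Longrightarrow> f integrable_on period_box"
  by (meson continuous_on_subset integrable_continuous subset_UNIV)

text \<open>
  Integration by parts: the integral of the derivative of \<open>f p * hartley m n p\<close> vanishes.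
\<close>

lemma hartley_coef_dirD:
  fixes f :: "real \<times> real \<Rightarrow> real"
  assumes diff: "\<And>p. f differentiable (at p)" and per: "torus_periodic f"
    and cont: "\<And>e. continuous_on UNIV (dirD e f)"
  shows "hartley_coef m n (dirD (1, 0) f) = - of_int m * hartley_coef (- m) n f"
    and "hartley_coef m n (dirD (0, 1) f) = - (sqrt 2 * of_int n) * hartley_coef m (- n) f"
proof -
  have cf: "continuous_on UNIV f"
    using diff by (simp add: continuous_at_imp_continuous_on differentiable_imp_continuous_within)
  have d: "dirD e (\<lambda>p. f p * hartley m n p) = (\<lambda>p. f p * dirD e (hartley m n) p + dirD e f p * hartley m n p)" for e
    by (simp add: fun_eq_iff dirD_mult diff differentiable_hartley)
  have "integral period_box (\<lambda>p. f p * dirD e (hartley m n) p + dirD e f p * hartley m n p) = 0"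
    if "e \<in> Basis" for e
  proof -
    have "continuous_on UNIV (dirD e' (\<lambda>p. f p * hartley m n p))" for e'
      unfolding d by (cases e') (auto simp: dirD_hartley intro!: continuous_intros cf cont)
    from integral_dirD_periodic[OF _ torus_periodic_mult[OF per torus_periodic_hartley] this that]
    show ?thesis unfolding d by (simp add: diff differentiable_hartley)
  qed
  note * = this
  have "(\<lambda>p. f p * dirD e (hartley m n) p) integrable_on period_box"
    "(\<lambda>p. dirD e f p * hartley m n p) integrable_on period_box" for e
    by (cases e, auto simp: dirD_hartley intro!: integrable_period_box continuous_intros cf cont)+
  then have **: "integral period_box (\<lambda>p. f p * dirD e (hartley m n) p) + hartley_coef m n (dirD e f) = 0"
    if "e \<in> Basis" for e
    using *[OF that] by (simp add: integral_add hartley_coef_def)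
  have i: "integral period_box (\<lambda>p. f p * (c * hartley m n p)) = c * hartley_coef m n f" for c m n
  proof -
    have "(\<lambda>p. f p * (c * hartley m n p)) = (\<lambda>p. c * (f p * hartley m n p))"
      by (simp add: fun_eq_iff)
    then show ?thesis by (simp add: hartley_coef_def)
  qed
  show "hartley_coef m n (dirD (1, 0) f) = - of_int m * hartley_coef (- m) n f"
    using **[of "(1, 0)"] by (simp add: Basis_prod_def dirD_hartley i)
  show "hartley_coef m n (dirD (0, 1) f) = - (sqrt 2 * of_int n) * hartley_coef m (- n) f"
    using **[of "(0, 1)"] by (simp add: Basis_prod_def dirD_hartley i)
qed

lemma hartley_coef_add:
  assumes "continuous_on UNIV f" "continuous_on UNIV g"
  shows "hartley_coef m n (\<lambda>p. f p + g p) = hartley_coef m n f + hartley_coef m n g"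
  unfolding hartley_coef_def distrib_right
  by (intro integral_add integrable_period_box continuous_intros assms)

lemma hartley_coef_cmul: "hartley_coef m n (\<lambda>p. c * f p) = c * hartley_coef m n f"
  by (simp add: hartley_coef_def mult.assoc)

text \<open>
  Multiples of waves are closed under differentiation up to sums, which is what the induction
  on the order of differentiability uses.
\<close>

lemma smooth_map_hartley: "smooth_map (hartley m n)"
proof -
  have "Ck_map k (\<lambda>p. c * hartley m n p)" for k c m n
  proof (induction k arbitrary: m n c)
    case 0
    then show ?case by (auto intro!: continuous_intros)
  next
    case (Suc k)
    have d: "((\<lambda>p. c * hartley m n p) has_derivative (\<lambda>e. c * dirD e (hartley m n) p)) (at p)" for p
      by (intro has_derivative_mult_right has_derivative_dirD differentiable_hartley)
    have "dirD e (\<lambda>p. c * hartley m n p) = (\<lambda>p. (c * fst e * of_int m) * hartley (- m) n p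
        + (c * snd e * sqrt 2 * of_int n) * hartley m (- n) p)" for e
      by (cases e) (simp add: fun_eq_iff dirD_eqI[OF d] dirD_hartley algebra_simps)
    then show ?case using Suc d by (auto simp: differentiable_def simp del: split_paired_All intro!: Ck_map_add exI)
  qed
  from this[of _ 1] show ?thesis by (simp add: smooth_map_def)
qed

definition torus_smooth :: "(real \<times> real \<Rightarrow> 'a::real_normed_vector) \<Rightarrow> bool" where
  "torus_smooth f \<longleftrightarrow> smooth_map f \<and> torus_periodic f"

lemma torus_smooth_dirD: "torus_smooth f \<Longrightarrow> torus_smooth (dirD e f)"
  unfolding torus_smooth_def using smooth_mapD torus_periodic_dirD by blast

lemma torus_smooth_add: "torus_smooth f \<Longrightarrow> torus_smooth g \<Longrightarrow> torus_smooth (\<lambda>p. f p + g p)"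
  by (simp add: torus_smooth_def smooth_map_add torus_periodic_def)

lemma torus_smooth_linear: "bounded_linear h \<Longrightarrow> torus_smooth f \<Longrightarrow> torus_smooth (\<lambda>p. h (f p))"
  by (simp add: torus_smooth_def smooth_map_linear torus_periodic_def)

lemma torus_smooth_cmul: "torus_smooth f \<Longrightarrow> torus_smooth (\<lambda>p. c * f p :: real)"
  by (rule torus_smooth_linear[OF bounded_linear_mult_right])

lemma torus_smooth_minus: "torus_smooth f \<Longrightarrow> torus_smooth (\<lambda>p. - f p)"
  by (rule torus_smooth_linear[OF bounded_linear_minus[OF bounded_linear_ident]])

lemma torus_smooth_diff: "torus_smooth f \<Longrightarrow> torus_smooth g \<Longrightarrow> torus_smooth (\<lambda>p. f p - g p)"
  using torus_smooth_add[OF _ torus_smooth_minus, of f g] by simp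

lemma torus_smooth_Pair: "torus_smooth f \<Longrightarrow> torus_smooth g \<Longrightarrow> torus_smooth (\<lambda>p. (f p, g p))"
  by (simp add: torus_smooth_def smooth_map_def Ck_map_Pair torus_periodic_def)

lemma torus_smooth_hartley: "torus_smooth (hartley m n)"
  by (simp add: torus_smooth_def smooth_map_hartley torus_periodic_hartley)

lemmas torus_smooth_intros = torus_smooth_dirD torus_smooth_add torus_smooth_diff torus_smooth_cmul torus_smooth_minus
  torus_smooth_hartley torus_smooth_Pair

lemma torus_smooth_differentiable: "torus_smooth f \<Longrightarrow> f differentiable (at p)"
  by (simp add: torus_smooth_def smooth_mapD)

lemma dirD_sum_rules:
  fixes f g :: "real \<times> real \<Rightarrow> real"
  shows "torus_smooth f \<Longrightarrow> torus_smooth g \<Longrightarrow> dirD e (\<lambda>p. f p + g p) = (\<lambda>p. dirD e f p + dirD e g p)"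
    "torus_smooth f \<Longrightarrow> torus_smooth g \<Longrightarrow> dirD e (\<lambda>p. f p - g p) = (\<lambda>p. dirD e f p - dirD e g p)"
  by (auto simp: fun_eq_iff intro!: dirD_eqI has_derivative_add has_derivative_diff has_derivative_dirD torus_smooth_differentiable)

lemma torus_smooth_bilinear:
  "bounded_bilinear bop \<Longrightarrow> torus_smooth f \<Longrightarrow> torus_smooth g \<Longrightarrow> torus_smooth (\<lambda>p. bop (f p) (g p))"
  by (simp add: torus_smooth_def smooth_map_bilinear torus_periodic_def)

lemma hartley_coef_torus_smooth:
  assumes f: "torus_smooth f"
  shows "hartley_coef m n (dirD (1, 0) f) = - of_int m * hartley_coef (- m) n f"
    and "hartley_coef m n (dirD (0, 1) f) = - (sqrt 2 * of_int n) * hartley_coef m (- n) f"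
  using f unfolding torus_smooth_def by (blast intro: hartley_coef_dirD smooth_mapD)+

lemma hartley_coef_sum_rules:
  assumes f: "torus_smooth f" "torus_smooth g"
  shows "hartley_coef m n (\<lambda>p. f p + g p) = hartley_coef m n f + hartley_coef m n g"
    "hartley_coef m n (\<lambda>p. f p - g p) = hartley_coef m n f - hartley_coef m n g"
proof -
  have add: "hartley_coef m n (\<lambda>p. f p + g p) = hartley_coef m n f + hartley_coef m n g"
    if "torus_smooth f" "torus_smooth g" for f g
    using that by (auto simp: torus_smooth_def intro!: hartley_coef_add smooth_mapD)
  from add[OF f] show "hartley_coef m n (\<lambda>p. f p + g p) = hartley_coef m n f + hartley_coef m n g" .
  show "hartley_coef m n (\<lambda>p. f p - g p) = hartley_coef m n f - hartley_coef m n g"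
    using add[OF f(1) torus_smooth_minus[OF f(2)]] hartley_coef_cmul[of m n "- 1" g] by simp
qed

section \<open>Orthogonality of the waves\<close>

lemma integral_cos_int: "integral {0..2 * pi} (\<lambda>t. cos (of_int k * t)) = (if k = 0 then 2 * pi else 0)"
proof (cases "k = 0")
  case False
  have "((\<lambda>t. cos (of_int k * t)) has_integral sin (of_int k * (2 * pi)) / of_int k - sin (of_int k * 0) / of_int k) {0..2 * pi}"
    by (rule fundamental_theorem_of_calculus)
       (use False in \<open>auto intro!: derivative_eq_intros simp: has_real_derivative_iff_has_vector_derivative[symmetric]\<close>)
  then show ?thesis using False sin_int_2pin[of k] by (simp add: integral_unique mult.commute)
qed simp

lemma integral_sin_int: "integral {0..2 * pi} (\<lambda>t. sin (of_int k * t)) = 0"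
proof (cases "k = 0")
  case False
  have "((\<lambda>t. sin (of_int k * t)) has_integral - cos (of_int k * (2 * pi)) / of_int k - - cos (of_int k * 0) / of_int k) {0..2 * pi}"
    by (rule fundamental_theorem_of_calculus)
       (use False in \<open>auto intro!: derivative_eq_intros simp: has_real_derivative_iff_has_vector_derivative[symmetric]\<close>)
  then show ?thesis using False cos_int_2pin[of k] by (simp add: integral_unique mult.commute)
qed simp

lemma integral_cas_cas:
  "integral {0..2 * pi} (\<lambda>t. cas (of_int k * t) * cas (of_int l * t)) = (if k = l then 2 * pi else 0)"
proof -
  have "(\<lambda>t. cas (of_int k * t) * cas (of_int l * t)) =
    (\<lambda>t. cos (of_int (k - l) * t) + sin (of_int (k + l) * t))"
    by (simp add: cas_def fun_eq_iff algebra_simps cos_diff sin_add)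
  moreover have "(\<lambda>t. cos (of_int k * t)) integrable_on {0..2*pi}" "(\<lambda>t. sin (of_int k * t)) integrable_on {0..2*pi}" for k
    by (intro integrable_continuous_interval continuous_intros)+
  ultimately show ?thesis
    by (simp only: integral_add integral_cos_int integral_sin_int) simp
qed

lemma hartley_coef_hartley:
  "hartley_coef m n (hartley k l) = (if k = m \<and> l = n then 2 * sqrt 2 * pi\<^sup>2 else 0)"
proof -
  have y: "integral (cbox 0 (sqrt 2 * pi)) (\<lambda>y. cas (of_int l * (sqrt 2 * y)) * cas (of_int n * (sqrt 2 * y)))
     = (if l = n then sqrt 2 * pi else 0)" (is "integral _ ?g = _")
  proof -
    have "(\<lambda>t. cas (of_int l * t) * cas (of_int n * t)) integrable_on {0..2 * pi}"
      unfolding cas_def by (intro integrable_continuous_interval continuous_intros)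
    then have "((\<lambda>t. cas (of_int l * t) * cas (of_int n * t)) has_integral (if l = n then 2 * pi else 0)) (cbox 0 (2 * pi))"
      using integral_cas_cas[of l n] by (simp add: has_integral_iff)
    from has_integral_affinity[OF this, of "sqrt 2" 0]
    have "(?g has_integral (if l = n then 2 * pi else 0) / sqrt 2) ((\<lambda>x. x / sqrt 2) ` {0..2 * pi})"
      by (simp add: divide_inverse mult.commute)
    moreover have area: "2 * pi / sqrt 2 = sqrt 2 * pi"
      using real_div_sqrt[of 2] by (metis times_divide_eq_left zero_le_numeral)
    moreover have "(\<lambda>x. x / sqrt 2) ` {0..2 * pi} = {0..sqrt 2 * pi}"
      using area by simp
    ultimately show ?thesis by (simp add: integral_unique split: if_splits)
  qed
  have "hartley_coef m n (hartley k l) = integral period_box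
     (\<lambda>(x, y). cas (of_int k * x) * cas (of_int m * x) * (cas (of_int l * (sqrt 2 * y)) * cas (of_int n * (sqrt 2 * y))))"
    unfolding hartley_coef_def hartley_def by (rule arg_cong[where f="integral period_box"]) (auto simp: fun_eq_iff)
  also have "\<dots> = integral (cbox 0 (2*pi)) (\<lambda>x. integral (cbox 0 (sqrt 2 * pi))
     (\<lambda>y. cas (of_int k * x) * cas (of_int m * x) * (cas (of_int l * (sqrt 2 * y)) * cas (of_int n * (sqrt 2 * y)))))"
    by (subst integral_prod_continuous) (auto simp: cas_def case_prod_beta intro!: continuous_intros)
  also have "\<dots> = (if k = m then 2 * pi else 0) * (if l = n then sqrt 2 * pi else 0)"
    unfolding integral_mult_right y integral_mult_left
    using integral_cas_cas[of k m] by simp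
  finally show ?thesis by (simp add: power2_eq_square)
qed

section \<open>Completeness of the waves\<close>

text \<open>
  Multiplication by the trigonometric functions of frequency one stays within combinations of
  waves; hence functions with vanishing coefficients form a module over the trigonometric
  polynomials.
\<close>

lemma hartley_mult_cos_sin:
  "hartley m n p * cos (fst p) = (hartley (m + 1) n p + hartley (m - 1) n p) / 2"
  "hartley m n p * sin (fst p) = (hartley (1 - m) n p - hartley (- m - 1) n p) / 2"
  "hartley m n p * cos (sqrt 2 * snd p) = (hartley m (n + 1) p + hartley m (n - 1) p) / 2"
  "hartley m n p * sin (sqrt 2 * snd p) = (hartley m (1 - n) p - hartley m (- n - 1) p) / 2"
proof -
  have c: "cas (of_int k * t) * cos t = (cas (of_int (k + 1) * t) + cas (of_int (k - 1) * t)) / 2"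
    "cas (of_int k * t) * sin t = (cas (of_int (1 - k) * t) - cas (of_int (- k - 1) * t)) / 2"
    for k :: int and t
  proof -
    have 1: "of_int (k + 1) * t = of_int k * t + t" "of_int (k - 1) * t = of_int k * t - t"
      "of_int (1 - k) * t = t - of_int k * t" "of_int (- k - 1) * t = - (of_int k * t + t)"
      by (simp_all add: algebra_simps)
    show "cas (of_int k * t) * cos t = (cas (of_int (k + 1) * t) + cas (of_int (k - 1) * t)) / 2"
    "cas (of_int k * t) * sin t = (cas (of_int (1 - k) * t) - cas (of_int (- k - 1) * t)) / 2"
      unfolding 1 by (simp_all add: cas_def cos_add sin_add cos_diff sin_diff algebra_simps)
  qed
  show "hartley m n p * cos (fst p) = (hartley (m + 1) n p + hartley (m - 1) n p) / 2"
    using c(1)[of m "fst p"] unfolding hartley_def by algebra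
  show "hartley m n p * sin (fst p) = (hartley (1 - m) n p - hartley (- m - 1) n p) / 2"
    using c(2)[of m "fst p"] unfolding hartley_def by algebra
  show "hartley m n p * cos (sqrt 2 * snd p) = (hartley m (n + 1) p + hartley m (n - 1) p) / 2"
    using c(1)[of n "sqrt 2 * snd p"] unfolding hartley_def by algebra
  show "hartley m n p * sin (sqrt 2 * snd p) = (hartley m (1 - n) p - hartley m (- n - 1) p) / 2"
    using c(2)[of n "sqrt 2 * snd p"] unfolding hartley_def by algebra
qed

definition hartley_null :: "(real \<times> real \<Rightarrow> real) \<Rightarrow> bool" where
  "hartley_null f \<longleftrightarrow> continuous_on UNIV f \<and> (\<forall>m n. hartley_coef m n f = 0)"

lemma hartley_null_add: "hartley_null f \<Longrightarrow> hartley_null g \<Longrightarrow> hartley_null (\<lambda>p. f p + g p)"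
  by (auto simp: hartley_null_def hartley_coef_add intro!: continuous_intros)

lemma hartley_null_cmul: "hartley_null f \<Longrightarrow> hartley_null (\<lambda>p. c * f p)"
  by (auto simp: hartley_null_def hartley_coef_cmul intro!: continuous_intros)

lemma hartley_null_mult_wave:
  assumes f: "hartley_null f" and g: "continuous_on UNIV g"
    and *: "\<And>m n. \<exists>a k l b k' l'. \<forall>p. hartley m n p * g p = a * hartley k l p + b * hartley k' l' p"
  shows "hartley_null (\<lambda>p. f p * g p)"
proof -
  have cf: "continuous_on UNIV f" using f by (simp add: hartley_null_def)
  have "hartley_coef m n (\<lambda>p. f p * g p) = 0" for m n
  proof -
    obtain a k l b k' l' where e: "\<And>p. hartley m n p * g p = a * hartley k l p + b * hartley k' l' p"
      using * by meson
    have "(\<lambda>p. f p * g p * hartley m n p) = (\<lambda>p. a * (f p * hartley k l p) + b * (f p * hartley k' l' p))"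
    proof
      fix p show "f p * g p * hartley m n p = a * (f p * hartley k l p) + b * (f p * hartley k' l' p)"
        using e[of p] by algebra
    qed
    then have "hartley_coef m n (\<lambda>p. f p * g p) = integral period_box (\<lambda>p. a * (f p * hartley k l p) + b * (f p * hartley k' l' p))"
      by (simp add: hartley_coef_def)
    also have "\<dots> = integral period_box (\<lambda>p. a * (f p * hartley k l p)) + integral period_box (\<lambda>p. b * (f p * hartley k' l' p))"
      by (intro integral_add integrable_period_box continuous_intros cf)
    also have "\<dots> = a * hartley_coef k l f + b * hartley_coef k' l' f"
      by (simp add: hartley_coef_def)
    finally show ?thesis using f by (simp add: hartley_null_def)
  qed
  then show ?thesis using cf g by (auto simp: hartley_null_def intro!: continuous_intros)
qed

lemma hartley_null_mult_cos_sin: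
  assumes f: "hartley_null f"
  shows "hartley_null (\<lambda>p. f p * cos (fst p))" "hartley_null (\<lambda>p. f p * sin (fst p))"
    "hartley_null (\<lambda>p. f p * cos (sqrt 2 * snd p))" "hartley_null (\<lambda>p. f p * sin (sqrt 2 * snd p))"
proof -
  have s: "(x + y) / 2 = 1 / 2 * x + 1 / 2 * y" "(x - y) / 2 = 1 / 2 * x + (- 1 / 2) * y" for x y :: real
    by simp_all
  show "hartley_null (\<lambda>p. f p * cos (fst p))" "hartley_null (\<lambda>p. f p * sin (fst p))"
    "hartley_null (\<lambda>p. f p * cos (sqrt 2 * snd p))" "hartley_null (\<lambda>p. f p * sin (sqrt 2 * snd p))"
    using hartley_mult_cos_sin[unfolded s]
    by (intro hartley_null_mult_wave[OF f] continuous_intros; blast)+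
qed

text \<open>
  The six real coordinates of \<open>phi\<close> are, up to the factor \<open>1 / sqrt 2\<close>, products of
  \<open>cos\<close> or \<open>sin\<close> of \<open>\<gamma>\<close> with \<open>1\<close>, \<open>cos (sqrt 2 * \<theta>)\<close> or \<open>sin (sqrt 2 * \<theta>)\<close>.
\<close>

lemma hartley_null_mult_linear:
  assumes f: "hartley_null f" and g: "bounded_linear (g :: complex ^ 3 \<Rightarrow> real)"
  shows "hartley_null (\<lambda>p. f p * g (phi p))"
proof -
  interpret g: bounded_linear g by fact
  let ?a = "g (axis 1 (1 / sqrt 2))" and ?b = "g (axis 1 (\<i> / sqrt 2))" and ?c = "g (axis 2 (1 / sqrt 2))"
  and ?d = "g (axis 2 (\<i> / sqrt 2))" and ?e = "g (axis 3 (1 / sqrt 2))" and ?f = "g (axis 3 (\<i> / sqrt 2))"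
  have "phi p = cos (fst p) *\<^sub>R axis 1 (1 / sqrt 2) + sin (fst p) *\<^sub>R axis 1 (\<i> / sqrt 2)
     + (sin (fst p) * sin (sqrt 2 * snd p)) *\<^sub>R axis 2 (1 / sqrt 2)
     + (cos (fst p) * sin (sqrt 2 * snd p)) *\<^sub>R axis 2 (\<i> / sqrt 2)
     + (sin (fst p) * cos (sqrt 2 * snd p)) *\<^sub>R axis 3 (1 / sqrt 2)
     + (cos (fst p) * cos (sqrt 2 * snd p)) *\<^sub>R axis 3 (\<i> / sqrt 2)" for p
    by (cases p) (simp add: phi_def vec_eq_iff forall_3 axis_def complex_eq_iff)
  then have e: "f p * g (phi p) = ?a * (f p * cos (fst p)) + ?b * (f p * sin (fst p))
     + ?c * (f p * sin (fst p) * sin (sqrt 2 * snd p))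
     + ?d * (f p * cos (fst p) * sin (sqrt 2 * snd p))
     + ?e * (f p * sin (fst p) * cos (sqrt 2 * snd p))
     + ?f * (f p * cos (fst p) * cos (sqrt 2 * snd p))" for p
    by (simp add: g.add g.scaleR algebra_simps)
  show ?thesis
    unfolding e by (intro hartley_null_add hartley_null_cmul hartley_null_mult_cos_sin f)
qed

text \<open>
  Iterating the linear case.  The factor \<open>g \<circ> phi\<close> will be an approximation of \<open>f\<close> itself.
\<close>

lemma hartley_null_mult_polynomial:
  assumes "real_polynomial_function (g :: complex ^ 3 \<Rightarrow> real)" "hartley_null f"
  shows "hartley_null (\<lambda>p. f p * g (phi p))"
  using assms
proof (induction g arbitrary: f rule: real_polynomial_function.induct)
  case (linear g)
  then show ?case by (simp add: hartley_null_mult_linear)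
next
  case (const c)
  then show ?case using hartley_null_cmul[of f c] by (simp add: mult.commute)
next
  case (add g h)
  then show ?case by (simp add: distrib_left hartley_null_add)
next
  case (mult g h)
  then show ?case by (simp flip: mult.assoc)
qed

lemma torus_periodic_int:
  assumes "torus_periodic f"
  shows "f (x + 2 * pi * of_int m, y + sqrt 2 * pi * of_int n) = f (x, y)"
proof -
  note p = assms[unfolded torus_periodic_def, rule_format]
  have nat: "f (x + 2 * pi * of_nat m, y + sqrt 2 * pi * of_nat n) = f (x, y)" for m n :: nat and x y
  proof -
    have "f (x + 2 * pi * of_nat m, y) = f (x, y)" for x y
    proof (induction m)
      case (Suc m)
      then show ?case
        using p[of "x + 2 * pi * of_nat m" y] by (simp add: algebra_simps)
    qed simp
    moreover have "f (x, y + sqrt 2 * pi * of_nat n) = f (x, y)" for x y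
    proof (induction n)
      case (Suc n)
      then show ?case
        using p[of x "y + sqrt 2 * pi * of_nat n"] by (simp add: algebra_simps)
    qed simp
    ultimately show ?thesis by simp
  qed
  obtain a b where m: "m = int a - int b" by (rule int_diff_cases)
  obtain c d where n: "n = int c - int d" by (rule int_diff_cases)
  show ?thesis
    using nat[of "x + 2 * pi * of_int m" b "y + sqrt 2 * pi * of_int n" d] nat[of x a y c]
    by (simp add: m n algebra_simps)
qed

text \<open>
  \<open>phi\<close> separates the points of the torus, so \<open>f\<close> is a function of \<open>phi\<close>; it is a continuous one
  because a continuous map on a compact set is a quotient map onto its image.
\<close>

lemma periodic_factor_phi:
  fixes f :: "real \<times> real \<Rightarrow> real"
  assumes f: "continuous_on UNIV f" "torus_periodic f"
  obtains g where "continuous_on (phi ` period_box) g" "\<And>p. p \<in> period_box \<Longrightarrow> g (phi p) = f p"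
proof -
  have inj: "f p = f q" if eq: "phi p = phi q" for p q
  proof -
    obtain x y x' y' where pq: "p = (x, y)" "q = (x', y')" by (cases p; cases q)
    have "cis x = cis x'"
      using eq by (auto simp: pq phi_def vec_eq_iff forall_3)
    then have "sin x' = sin x \<and> cos x' = cos x"
      by (simp add: complex_eq_iff)
    then obtain m :: int where "x' = x + 2 * pi * of_int m"
      unfolding sin_cos_eq_iff by auto
    moreover obtain n :: int where "y' = y + sqrt 2 * pi * of_int n"
      using phi_inj[of x y x' y'] eq unfolding pq by blast
    ultimately show ?thesis
      by (simp add: pq torus_periodic_int[OF f(2)])
  qed
  define g where "g z = f (SOME p. p \<in> period_box \<and> phi p = z)" for z
  have g: "g (phi p) = f p" if "p \<in> period_box" for p
    unfolding g_def
    by (rule someI2[where a = p]) (use that in simp, blast intro: inj)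
  have phi: "continuous_on period_box phi"
    using Ck_map_gen[of 0] by (metis Ck_map.simps(1) continuous_on_subset phi_gen subset_UNIV)
  have "continuous_on (phi ` period_box) g"
  proof (subst continuous_on_open_gen[where T = UNIV])
    show "\<forall>U. openin (top_of_set UNIV) U \<longrightarrow> openin (top_of_set (phi ` period_box)) (phi ` period_box \<inter> g -` U)"
    proof (intro allI impI)
      fix U :: "real set" assume U: "openin (top_of_set UNIV) U"
      have "period_box \<inter> phi -` (phi ` period_box \<inter> g -` U) = period_box \<inter> f -` U"
      proof -
        have "phi p \<in> phi ` period_box \<inter> g -` U \<longleftrightarrow> f p \<in> U" if "p \<in> period_box" for p
          unfolding Int_iff vimage_eq g[OF that] using that by blast
        then show ?thesis by blast
      qed
      moreover have "openin (top_of_set period_box) (period_box \<inter> f -` U)"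
        using U continuous_on_subset[OF f(1)] continuous_openin_preimage_gen by (metis open_openin subset_UNIV subtopology_UNIV)
      ultimately show "openin (top_of_set (phi ` period_box)) (phi ` period_box \<inter> g -` U)"
        using Abstract_Topology_2.continuous_imp_quotient_map[OF phi refl compact_cbox] by (metis inf_le1)
    qed
  qed auto
  then show ?thesis using that g by blast
qed

text \<open>
  The torus is embedded by \<open>phi\<close> as a compact subset of a Euclidean space, so \<open>f\<close> is a uniform
  limit of maps \<open>q \<circ> phi\<close> with polynomials \<open>q\<close>.  Each of these is orthogonal to \<open>f\<close>, hence
  \<open>f\<close> is orthogonal to itself.
\<close>

theorem hartley_uniqueness:
  fixes f :: "real \<times> real \<Rightarrow> real"
  assumes cont: "continuous_on UNIV f" and per: "torus_periodic f" and 0: "\<And>m n. hartley_coef m n f = 0"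
  shows "f p = 0"
proof -
  obtain g where g: "continuous_on (phi ` period_box) g" "\<And>p. p \<in> period_box \<Longrightarrow> g (phi p) = f p"
    by (rule periodic_factor_phi[OF cont per]) (rule that)
  have phi: "continuous_on UNIV phi"
    using Ck_map_gen[of 0] by (simp add: phi_gen)
  have null: "hartley_null f" using cont 0 by (simp add: hartley_null_def)
  have I: "(\<lambda>p. f p * f p) integrable_on period_box" "(\<lambda>p. \<bar>f p\<bar>) integrable_on period_box"
    by (intro integrable_period_box continuous_intros cont)+
  define C where "C = integral period_box (\<lambda>p. \<bar>f p\<bar>)"
  have C: "C \<ge> 0" unfolding C_def by (intro integral_nonneg I) auto
  have bound: "integral period_box (\<lambda>p. f p * f p) \<le> e * C" if e: "e > 0" for e
  proof -
    have "compact (phi ` period_box)"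
      using phi by (intro compact_continuous_image) (auto intro: continuous_on_subset)
    then obtain q where q: "real_polynomial_function q" "\<And>z. z \<in> phi ` period_box \<Longrightarrow> \<bar>g z - q z\<bar> < e"
      using Stone_Weierstrass_real_polynomial_function[OF _ g(1) e] by metis
    have n: "hartley_null (\<lambda>p. f p * q (phi p))"
      by (rule hartley_null_mult_polynomial[OF q(1) null])
    then have J: "(\<lambda>p. f p * q (phi p)) integrable_on period_box"
      by (intro integrable_period_box) (simp add: hartley_null_def)
    have "hartley_coef 0 0 (\<lambda>p. f p * q (phi p)) = 0"
      using n by (simp add: hartley_null_def)
    then have "integral period_box (\<lambda>p. f p * q (phi p)) = 0"
      by (simp add: hartley_coef_def hartley_def cas_def)
    then have "integral period_box (\<lambda>p. f p * f p) = integral period_box (\<lambda>p. f p * f p - f p * q (phi p))"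
      using I(1) J by (simp add: integral_diff)
    also have "\<dots> \<le> integral period_box (\<lambda>p. e * \<bar>f p\<bar>)"
    proof (rule integral_le)
      fix p assume "p \<in> period_box"
      then have "\<bar>f p - q (phi p)\<bar> \<le> e" using q(2)[of "phi p"] g(2)[of p] by simp
      then have "\<bar>f p * (f p - q (phi p))\<bar> \<le> \<bar>f p\<bar> * e"
        unfolding abs_mult by (intro mult_left_mono) auto
      then show "f p * f p - f p * q (phi p) \<le> e * \<bar>f p\<bar>"
        by (simp add: right_diff_distrib mult.commute)
    qed (intro integrable_diff I J integrable_on_mult_right)+
    finally show ?thesis by (simp add: C_def)
  qed
  have "integral period_box (\<lambda>p. f p * f p) \<le> 0 + d" if "d > 0" for d
  proof -
    have "d / (C + 1) * C \<le> d"
      using that C by (simp add: field_simps)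
    then show ?thesis
      using bound[of "d / (C + 1)"] that C by simp
  qed
  then have "integral period_box (\<lambda>p. f p * f p) \<le> 0"
    using field_le_epsilon by blast
  moreover have "integral period_box (\<lambda>p. f p * f p) \<ge> 0"
    by (intro integral_nonneg I) auto
  ultimately have "integral period_box (\<lambda>p. f p * f p) = 0" by simp
  then have box: "\<forall>p \<in> period_box. f p * f p = 0"
  proof (subst (asm) integral_cbox_eq_0_iff)
    show "box (0, 0) (2 * pi, sqrt 2 * pi) \<noteq> {}"
      by (auto simp: box_ne_empty Basis_prod_def)
  qed (auto intro!: continuous_intros continuous_on_subset[OF cont])
  \<comment> \<open>From the period box to the whole plane.\<close>
  obtain x y where p: "p = (x, y)" by (cases p)
  define m n where "m = \<lfloor>x / (2 * pi)\<rfloor>" and "n = \<lfloor>y / (sqrt 2 * pi)\<rfloor>"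
  have red: "0 \<le> t + T * of_int (- \<lfloor>t / T\<rfloor>) \<and> t + T * of_int (- \<lfloor>t / T\<rfloor>) \<le> T" if "T > 0" for t T :: real
    using that floor_divide_lower[of T t] floor_divide_upper[of T t] by (simp add: algebra_simps)
  have "(x + 2 * pi * of_int (- m), y + sqrt 2 * pi * of_int (- n)) \<in> period_box"
    using red[of "2 * pi" x] red[of "sqrt 2 * pi" y] by (simp add: m_def n_def)
  then show ?thesis
    using box torus_periodic_int[OF per, of x "- m" y "- n"] p by fastforce
qed

section \<open>The moving frame\<close>

text \<open>
  Components with respect to the moving frame.
\<close>

type_synonym r5 = "real \<times> real \<times> real \<times> real \<times> real"

text \<open>
  The coefficients are those of
  \<open>a \<phi>\<^sub>\<gamma> + b \<phi>\<^sub>\<theta> + c (i \<phi>\<^sub>\<gamma>) + d (i \<phi>\<^sub>\<theta>) + e (i \<phi>)\<close> in the family \<open>gen\<close>.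
\<close>

fun frame :: "r5 \<Rightarrow> real \<times> real \<Rightarrow> complex ^ 3" where
  "frame (a, b, c, d, e) =
     gen ((\<i> * (a + e) - c) / sqrt 2) ((a - e + \<i> * c) / sqrt 2) (\<i> * b - d) (d - \<i> * b)
       ((a - e + \<i> * c) / sqrt 2)"

definition frame_section :: "(real \<times> real \<Rightarrow> r5) \<Rightarrow> real \<times> real \<Rightarrow> complex ^ 3" where
  "frame_section F p = frame (F p) p"

lemma gen_add: "gen c p q r s z + gen c' p' q' r' s' z = gen (c + c') (p + p') (q + q') (r + r') (s + s') z"
  by (cases z) (simp add: gen_def vec_eq_iff forall_3 algebra_simps)

lemma gen_diff: "gen c p q r s z - gen c' p' q' r' s' z = gen (c - c') (p - p') (q - q') (r - r') (s - s') z"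
  by (cases z) (simp add: gen_def vec_eq_iff forall_3 algebra_simps)

lemma gen_scaleR: "t *\<^sub>R gen c p q r s z = gen (t * c) (t * p) (t * q) (t * r) (t * s) z"
  by (cases z) (simp add: gen_def vec_eq_iff forall_3 scaleR_conv_of_real[where 'a = complex] algebra_simps)

lemma frame_add: "frame (v + w) p = frame v p + frame w p"
  by (cases v; cases w) (simp add: gen_add, simp add: algebra_simps add_divide_distrib diff_divide_distrib)

lemma frame_scaleR: "frame (t *\<^sub>R v) p = t *\<^sub>R frame v p"
  by (cases v) (simp add: gen_scaleR, simp add: algebra_simps add_divide_distrib diff_divide_distrib)

lemma linear_frame: "linear (\<lambda>v. frame v p)"
  by (rule linearI) (rule frame_add frame_scaleR)+

lemma frame_inner: "frame v p \<bullet> frame w p = v \<bullet> w"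
proof -
  obtain a b c d e a' b' c' d' e' x y where *: "v = (a, b, c, d, e)" "w = (a', b', c', d', e')" "p = (x, y)"
    by (metis prod.collapse)
  have 1: "(sin (sqrt 2 * y))\<^sup>2 + (cos (sqrt 2 * y))\<^sup>2 = 1" by simp
  have 2: "1 / sqrt 2 * (1 / sqrt 2) = 1 / 2" by simp
  obtain h where h: "h = 1 / sqrt 2" by simp
  have d: "z / complex_of_real (sqrt 2) = complex_of_real h * z" for z
    by (simp add: h)
  show ?thesis
    unfolding * frame.simps inner_gen d
    by (simp add: inner_complex_def) (use 1 2[folded h] in algebra)
qed

lemma frame_inner_phi: "frame v p \<bullet> phi p = 0"
proof -
  obtain a b c d e x y where *: "v = (a, b, c, d, e)" "p = (x, y)"
    by (metis prod.collapse)
  have 1: "(sin (sqrt 2 * y))\<^sup>2 + (cos (sqrt 2 * y))\<^sup>2 = 1" by simp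
  obtain h where h: "h = 1 / sqrt 2" by simp
  have d: "z / complex_of_real (sqrt 2) = complex_of_real h * z" for z
    by (simp add: h)
  have phi: "phi = gen (of_real h) (\<i> * of_real h) 0 0 (\<i> * of_real h)"
    by (simp add: phi_gen h)
  show ?thesis
    unfolding * frame.simps phi inner_gen d
    by (simp add: inner_complex_def) (use 1 in algebra)
qed

lemma frame_eq_iff: "frame v p = frame w p \<longleftrightarrow> v = w"
proof
  assume "frame v p = frame w p"
  then have "frame (v - w) p = 0"
    using linear_diff[OF linear_frame] by simp
  then have "(v - w) \<bullet> (v - w) = 0"
    by (metis frame_inner inner_zero_left)
  then show "v = w" by simp
qed simp

text \<open>
  At a given point every vector of \<open>\<complex>\<^sup>3\<close> is a value of \<open>gen\<close> with coefficients of the form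
  \<open>u\<close>, \<open>P\<close>, \<open>Q\<close>, \<open>- Q\<close>, \<open>P\<close>; these are obtained by undoing the rotations.  Orthogonality to \<open>phi\<close>
  then reads \<open>Re u = - Im P\<close>, which leaves five real parameters.
\<close>

lemma frame_surj:
  assumes "z \<bullet> phi p = 0"
  obtains v where "z = frame v p"
proof -
  obtain x y where p: "p = (x, y)" by (cases p)
  define S C where "S = complex_of_real (sin (sqrt 2 * y))" and "C = complex_of_real (cos (sqrt 2 * y))"
  have SC: "S * S + C * C = 1"
    unfolding S_def C_def by (simp flip: of_real_mult of_real_add add: sin_cos_sq)
  have cis: "cis (- x) * cis x = 1" by (simp add: cis_mult)
  define u where "u = cis (- x) * z $ 1"
  define P where "P = cis x * (S * z $ 2 + C * z $ 3)"
  define Q where "Q = cis x * (C * z $ 2 - S * z $ 3)"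
  have z: "z = gen u P Q (- Q) P p"
  proof -
    have "cis (- x) * (P * S + Q * C) = (cis (- x) * cis x) * ((S * S + C * C) * z $ 2)"
      unfolding P_def Q_def by algebra
    moreover have "cis (- x) * (P * C - Q * S) = (cis (- x) * cis x) * ((S * S + C * C) * z $ 3)"
      unfolding P_def Q_def by algebra
    moreover have "u * cis x = (cis (- x) * cis x) * z $ 1"
      unfolding u_def by algebra
    ultimately show ?thesis
      unfolding cis SC by (simp add: p gen_def vec_eq_iff forall_3 flip: S_def C_def)
  qed
  have 1: "(sin (sqrt 2 * y))\<^sup>2 + (cos (sqrt 2 * y))\<^sup>2 = 1" by simp
  obtain h where h: "h = 1 / sqrt 2" "h > 0" by simp
  have d: "z / complex_of_real (sqrt 2) = complex_of_real h * z" for z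
    by (simp add: h)
  have phi: "phi = gen (of_real h) (\<i> * of_real h) 0 0 (\<i> * of_real h)"
    by (simp add: phi_gen h)
  have "z \<bullet> phi p = h * (Re u + Im P)"
    unfolding z p phi inner_gen d
    by (simp add: inner_complex_def) (use 1 in algebra)
  then have u: "Re u = - Im P" using assms h by simp
  have hh: "2 * h * h = 1" by (simp add: h)
  let ?v = "(h * (Im u + Re P), Im Q, 2 * h * Im P, - Re Q, h * (Im u - Re P))"
  have "z = frame ?v p"
    unfolding z frame.simps d
    by (rule arg_cong[where f = "\<lambda>(u, P, Q, R, S). gen u P Q R S p", of "(_, _, _, _, _)" "(_, _, _, _, _)", unfolded prod.case])
       (simp add: complex_eq_iff u, use hh in algebra)
  then show ?thesis by (rule that)
qed

text \<open>
  The connection matrices of the moving frame, in direction \<open>(s, t)\<close>.  They do not depend on the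
  point, because the frame is moved by a group.
\<close>

definition connection :: "real \<times> real \<Rightarrow> r5 \<Rightarrow> r5" where
  "connection = (\<lambda>(s, t) (a, b, c, d, e). (t * d, s * d + t * c, s * e - t * b, - s * b - t * a + t * e, - s * c - t * d))"

lemma connection_simp [simp]:
  "connection (s, t) (a, b, c, d, e) = (t * d, s * d + t * c, s * e - t * b, - s * b - t * a + t * e, - s * c - t * d)"
  by (simp add: connection_def)

text \<open>
  The last term is normal to the sphere.  Since \<open>frame v\<close> stays orthogonal to \<open>phi\<close>, its
  coefficient is minus the inner product of \<open>frame v\<close> with the derivative of \<open>phi\<close> along \<open>e\<close>.
\<close>

lemma dirD_frame:
  "dirD e (frame v) p = frame (connection e v) p - (fst e * fst v + snd e * fst (snd v)) *\<^sub>R phi p"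
proof -
  obtain a b c d f s t where *: "v = (a, b, c, d, f)" "e = (s, t)"
    by (metis prod.collapse)
  have h: "complex_of_real (sqrt 2) * complex_of_real (sqrt 2) = 2" by (rule csqrt2_sq)
  show ?thesis
    unfolding * frame.simps connection_simp dirD_gen phi_gen fst_conv snd_conv gen_scaleR gen_diff
    by (rule arg_cong[where f = "\<lambda>(u, P, Q, R, S). gen u P Q R S p", of "(_, _, _, _, _)" "(_, _, _, _, _)", unfolded prod.case])
       (auto simp: field_simps h)
qed

section \<open>The second variation operator in the moving frame\<close>

lemma frame_expand:
  "frame v q = fst v *\<^sub>R frame (1, 0, 0, 0, 0) q + fst (snd v) *\<^sub>R frame (0, 1, 0, 0, 0) q
     + fst (snd (snd v)) *\<^sub>R frame (0, 0, 1, 0, 0) q + fst (snd (snd (snd v))) *\<^sub>R frame (0, 0, 0, 1, 0) q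
     + snd (snd (snd (snd v))) *\<^sub>R frame (0, 0, 0, 0, 1) q"
  by (cases v) (simp del: frame.simps flip: frame_scaleR frame_add)

lemma has_derivative_frame_section:
  assumes "F differentiable (at p)"
  shows "(frame_section F has_derivative (\<lambda>e. frame (dirD e F p) p + dirD e (frame (F p)) p)) (at p)"
proof -
  note ex = frame_expand
  have dE: "frame v differentiable (at q)" for v q
    by (cases v) (simp add: differentiable_def, rule exI, rule has_derivative_gen)
  have d: "((\<lambda>q. h (F q)) has_derivative (\<lambda>e. h (dirD e F p))) (at p)" if "bounded_linear h" for h
    by (rule bounded_linear.has_derivative[OF that has_derivative_dirD[OF assms]])
  note d' = d[OF bounded_linear_fst]
    d[OF bounded_linear_compose[OF bounded_linear_fst bounded_linear_snd]]
    d[OF bounded_linear_compose[OF bounded_linear_fst bounded_linear_compose[OF bounded_linear_snd bounded_linear_snd]]]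
    d[OF bounded_linear_compose[OF bounded_linear_fst bounded_linear_compose[OF bounded_linear_snd bounded_linear_compose[OF bounded_linear_snd bounded_linear_snd]]]]
    d[OF bounded_linear_compose[OF bounded_linear_snd bounded_linear_compose[OF bounded_linear_snd bounded_linear_compose[OF bounded_linear_snd bounded_linear_snd]]]]
  define c where "c = F p"
  have exf: "frame c = (\<lambda>q. fst c *\<^sub>R frame (1, 0, 0, 0, 0) q + fst (snd c) *\<^sub>R frame (0, 1, 0, 0, 0) q
     + fst (snd (snd c)) *\<^sub>R frame (0, 0, 1, 0, 0) q + fst (snd (snd (snd c))) *\<^sub>R frame (0, 0, 0, 1, 0) q
     + snd (snd (snd (snd c))) *\<^sub>R frame (0, 0, 0, 0, 1) q)"
    by (rule ext) (rule ex)
  have dc: "dirD e (frame c) p = fst c *\<^sub>R dirD e (frame (1, 0, 0, 0, 0)) p + fst (snd c) *\<^sub>R dirD e (frame (0, 1, 0, 0, 0)) p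
     + fst (snd (snd c)) *\<^sub>R dirD e (frame (0, 0, 1, 0, 0)) p + fst (snd (snd (snd c))) *\<^sub>R dirD e (frame (0, 0, 0, 1, 0)) p
     + snd (snd (snd (snd c))) *\<^sub>R dirD e (frame (0, 0, 0, 0, 1)) p" for e
    by (rule dirD_eqI, subst exf, intro has_derivative_add has_derivative_scaleR_right has_derivative_dirD dE)
  show ?thesis
    unfolding frame_section_def[abs_def] c_def[symmetric] dc
    apply (subst (1) ex)
    apply (rule has_derivative_eq_rhs)
     apply (rule has_derivative_add has_derivative_scaleR d' has_derivative_dirD dE)+
    apply (rule ext)
    apply (subst (11) ex)
    apply (simp add: c_def del: frame.simps)
    done
qed

definition frame_nabla :: "real \<times> real \<Rightarrow> (real \<times> real \<Rightarrow> r5) \<Rightarrow> real \<times> real \<Rightarrow> r5" where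
  "frame_nabla e F p = dirD e F p + connection e (F p)"

lemma nabla_frame_section:
  assumes "\<And>p. F differentiable (at p)"
  shows "nabla phi e (frame_section F) = frame_section (frame_nabla e F)"
proof
  fix p
  have n: "phi p \<bullet> phi p = 1" using norm_phi[of p] by (simp add: norm_eq_1)
  define k where "k = fst e * fst (F p) + snd e * fst (snd (F p))"
  have "dirD e (frame_section F) p = frame_section (frame_nabla e F) p - k *\<^sub>R phi p"
    unfolding k_def using dirD_eqI[OF has_derivative_frame_section[OF assms]] by (simp add: dirD_frame frame_section_def frame_nabla_def frame_add)
  then show "nabla phi e (frame_section F) p = frame_section (frame_nabla e F) p"
    by (simp add: nabla_def frame_section_def inner_diff_left frame_inner_phi n)
qed

definition frame_laplacian :: "(real \<times> real \<Rightarrow> r5) \<Rightarrow> real \<times> real \<Rightarrow> r5" where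
  "frame_laplacian F p = - (frame_nabla (1, 0) (frame_nabla (1, 0) F) p + frame_nabla (0, 1) (frame_nabla (0, 1) F) p)"

definition tangent_part :: "r5 \<Rightarrow> r5" where
  "tangent_part = (\<lambda>(a, b, c, d, e). (a, b, 0, 0, 0))"

text \<open>
  The Jacobi operator \<open>\<Delta> + T - \<bar>d\<phi>\<bar>\<^sup>2\<close> of the energy, with \<open>\<bar>d\<phi>\<bar>\<^sup>2 = 2\<close>; up to sign it is the
  linearisation of the tension field.
\<close>

definition jacobi :: "(real \<times> real \<Rightarrow> r5) \<Rightarrow> real \<times> real \<Rightarrow> r5" where
  "jacobi F p = frame_laplacian F p + (tangent_part (F p) - 2 *\<^sub>R F p)"

text \<open>
  In components this is \<open>f + 3 f\<^sub>3 e\<^sub>3 - 2 grad f\<^sub>3 + 2 div (f\<^sub>1, f\<^sub>2) e\<^sub>3\<close>, with the tension field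
  \<open>- e\<^sub>3\<close> as the source of the distinguished third direction.
\<close>

definition jacobi_defect :: "(real \<times> real \<Rightarrow> r5) \<Rightarrow> real \<times> real \<Rightarrow> r5" where
  "jacobi_defect F p = (case F p of (a, b, c, d, e) \<Rightarrow>
     (a - 2 * fst (snd (snd (dirD (1, 0) F p))), b - 2 * fst (snd (snd (dirD (0, 1) F p))),
      4 * c + 2 * fst (dirD (1, 0) F p) + 2 * fst (snd (dirD (0, 1) F p)), d, e))"

lemma linear_connection: "linear (connection e)"
  by (rule linearI; cases e) (auto simp: algebra_simps)

lemma smooth_map_frame_nabla: "smooth_map F \<Longrightarrow> smooth_map (frame_nabla e F)"
  unfolding frame_nabla_def[abs_def]
  by (intro smooth_map_add smooth_mapD smooth_map_linear[OF linear_conv_bounded_linear[THEN iffD1, OF linear_connection]])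

lemma frame_nabla_add:
  "smooth_map F \<Longrightarrow> smooth_map G \<Longrightarrow> frame_nabla e (\<lambda>p. F p + G p) = (\<lambda>p. frame_nabla e F p + frame_nabla e G p)"
  by (auto simp: fun_eq_iff frame_nabla_def linear_add[OF linear_connection]
      intro!: dirD_eqI[OF has_derivative_add[OF has_derivative_dirD has_derivative_dirD]] smooth_mapD)

lemma frame_laplacian_add:
  "smooth_map F \<Longrightarrow> smooth_map G \<Longrightarrow> frame_laplacian (\<lambda>p. F p + G p) = (\<lambda>p. frame_laplacian F p + frame_laplacian G p)"
  by (simp add: fun_eq_iff frame_laplacian_def frame_nabla_add smooth_map_frame_nabla)

lemma smooth_map_uminus: "smooth_map F \<Longrightarrow> smooth_map (\<lambda>p. - F p)"
  using smooth_map_linear[OF bounded_linear_minus[OF bounded_linear_ident]] .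

lemma smooth_map_frame_laplacian: "smooth_map F \<Longrightarrow> smooth_map (frame_laplacian F)"
  unfolding frame_laplacian_def[abs_def] by (intro smooth_map_uminus smooth_map_add smooth_map_frame_nabla)

lemma smooth_map_tangent_part: "smooth_map F \<Longrightarrow> smooth_map (\<lambda>p. tangent_part (F p) - 2 *\<^sub>R F p)"
proof -
  have "linear (\<lambda>v. tangent_part v - 2 *\<^sub>R v)"
    by (rule linearI) (auto simp: tangent_part_def algebra_simps)
  then show "smooth_map F \<Longrightarrow> smooth_map (\<lambda>p. tangent_part (F p) - 2 *\<^sub>R F p)"
    using smooth_map_linear linear_conv_bounded_linear by blast
qed

lemma rough_laplacian_frame_section:
  assumes "smooth_map F"
  shows "rough_laplacian phi (frame_section F) = frame_section (frame_laplacian F)"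
proof -
  note d = smooth_mapD(1)[OF assms] smooth_mapD(1)[OF smooth_map_frame_nabla[OF assms]]
  show ?thesis
    by (simp add: fun_eq_iff rough_laplacian_def Basis_prod_def nabla_frame_section d frame_section_def frame_laplacian_def
        linear_neg[OF linear_frame] linear_diff[OF linear_frame] del: frame.simps)
qed

lemma dirD_phi: "dirD e phi p = frame (fst e, snd e, 0, 0, 0) p"
  by (cases e) (simp add: phi_gen dirD_gen algebra_simps flip: of_real_mult,
    rule arg_cong[where f = "\<lambda>(u, P, Q, R, S). gen u P Q R S p", of "(_, _, _, _, _)" "(_, _, _, _, _)", unfolded prod.case],
    simp)

text \<open>
  Indeed \<open>\<phi>\<^sub>\<gamma>\<^sub>\<gamma> = - \<phi>\<close> and \<open>\<phi>\<^sub>\<theta>\<^sub>\<theta> = - \<phi> - i \<phi>\<^sub>\<gamma>\<close>.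
\<close>

lemma tension_frame_section: "tension phi = frame_section (\<lambda>_. (0, 0, - 1, 0, 0))"
  by (simp add: fun_eq_iff frame_section_def tension_phi)

lemma T_op_frame_section: "T_op phi (frame_section F) = frame_section (\<lambda>p. tangent_part (F p))"
proof
  fix p
  obtain a b c d e where F: "F p = (a, b, c, d, e)" by (rule prod_cases5)
  show "T_op phi (frame_section F) p = frame_section (\<lambda>p. tangent_part (F p)) p"
    by (simp add: T_op_def dirD_phi frame_section_def frame_inner F tangent_part_def Basis_prod_def
        del: frame.simps flip: frame_scaleR frame_add)
qed

lemma dnorm_sq_phi: "dnorm_sq phi p = 2"
  by (simp add: dnorm_sq_def Basis_prod_def power2_norm_eq_inner dirD_phi frame_inner del: frame.simps)

lemma dirD_const: "dirD e (\<lambda>_. c) p = 0"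
  by (rule dirD_eqI[OF has_derivative_const])

text \<open>
  Here \<open>T\<^sup>2 = T\<close> since \<open>phi\<close> is isometric, so squaring \<open>\<Delta> + (T - 2)\<close> reproduces exactly the terms of
  \<open>I2\<close> without the tension field.  The terms with the tension field are of order
  at most one and are collected in \<open>jacobi_defect\<close>.
\<close>

lemma I2_frame_section:
  assumes F: "smooth_map F"
  shows "I2 phi (frame_section F) p = frame (jacobi (jacobi F) p - jacobi_defect F p) p"
proof -
  obtain a b c d e where Fp: "F p = (a, b, c, d, e)" by (rule prod_cases5)
  obtain a1 b1 c1 d1 e1 where F1: "dirD (1, 0) F p = (a1, b1, c1, d1, e1)" by (rule prod_cases5)
  obtain a2 b2 c2 d2 e2 where F2: "dirD (0, 1) F p = (a2, b2, c2, d2, e2)" by (rule prod_cases5)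
  let ?G = "\<lambda>q. tangent_part (F q) - 2 *\<^sub>R F q"
  have G: "(\<lambda>q. T_op phi (frame_section F) q - dnorm_sq phi q *\<^sub>R frame_section F q) = frame_section ?G"
    using linear_diff[OF linear_frame] by (simp add: fun_eq_iff T_op_frame_section dnorm_sq_phi frame_section_def frame_scaleR del: frame.simps)
  have tau: "nabla phi e (tension phi) = frame_section (\<lambda>_. connection e (0, 0, - 1, 0, 0))" for e
    unfolding tension_frame_section by (subst nabla_frame_section) (simp_all add: frame_nabla_def[abs_def] dirD_const)
  have "jacobi F = (\<lambda>p. frame_laplacian F p + ?G p)" by (simp add: fun_eq_iff jacobi_def)
  then have "frame_laplacian (jacobi F) = (\<lambda>p. frame_laplacian (frame_laplacian F) p + frame_laplacian ?G p)"
    by (simp add: frame_laplacian_add smooth_map_frame_laplacian smooth_map_tangent_part F)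
  then have jj: "jacobi (jacobi F) p = frame_laplacian (frame_laplacian F) p + frame_laplacian ?G p + (tangent_part (jacobi F p) - 2 *\<^sub>R jacobi F p)"
    by (simp add: jacobi_def[of "jacobi F"])
  have sub: "u - frame v p = u + frame (- v) p" for u v
    using linear_neg[OF linear_frame] by simp
  have ta: "tension phi p = frame (0, 0, - 1, 0, 0) p"
    by (simp add: tension_frame_section frame_section_def del: frame.simps)
  obtain l1 l2 l3 l4 l5 where L: "frame_laplacian F p = (l1, l2, l3, l4, l5)" by (rule prod_cases5)
  obtain m1 m2 m3 m4 m5 where LL: "frame_laplacian (frame_laplacian F) p = (m1, m2, m3, m4, m5)" by (rule prod_cases5)
  obtain g1 g2 g3 g4 g5 where LG: "frame_laplacian ?G p = (g1, g2, g3, g4, g5)" by (rule prod_cases5)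
  have RG: "rough_laplacian phi (\<lambda>q. T_op phi (frame_section F) q - dnorm_sq phi q *\<^sub>R frame_section F q) p = frame (g1, g2, g3, g4, g5) p"
  proof -
    have "rough_laplacian phi (frame_section ?G) p = frame (frame_laplacian ?G p) p"
      by (simp only: rough_laplacian_frame_section[OF smooth_map_tangent_part[OF F]] frame_section_def)
    then show ?thesis unfolding G LG .
  qed
  have s: "frame_section F p = frame (F p) p" for F p by (simp add: frame_section_def)
  note simps = rough_laplacian_frame_section[OF F] rough_laplacian_frame_section[OF smooth_map_frame_laplacian[OF F]]
    dnorm_sq_phi d_inner_def T_op_frame_section tau
    nabla_frame_section[OF smooth_mapD(1)[OF F]] s dirD_phi frame_inner ta frame_nabla_def Fp F1 F2
    L LL Basis_prod_def tangent_part_def power2_norm_eq_inner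
  have "I2 phi (frame_section F) p = frame (jacobi (jacobi F) p - jacobi_defect F p) p"
    unfolding I2_def RG jj LG
    apply (simp add: simps jacobi_defect_def jacobi_def del: frame.simps flip: frame_scaleR frame_add)
    apply (simp add: sub frame_eq_iff del: frame.simps flip: frame_scaleR frame_add)
    done
  then show ?thesis .
qed

section \<open>Amplitudes of a section\<close>

lemma frame_nabla_components:
  assumes "torus_smooth f1" "torus_smooth f2" "torus_smooth f3" "torus_smooth f4" "torus_smooth f5"
  shows "frame_nabla (1, 0) (\<lambda>p. (f1 p, f2 p, f3 p, f4 p, f5 p)) = (\<lambda>p. (dirD (1, 0) f1 p,
      dirD (1, 0) f2 p + f4 p, dirD (1, 0) f3 p + f5 p, dirD (1, 0) f4 p - f2 p, dirD (1, 0) f5 p - f3 p))"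
    "frame_nabla (0, 1) (\<lambda>p. (f1 p, f2 p, f3 p, f4 p, f5 p)) = (\<lambda>p. (dirD (0, 1) f1 p + f4 p,
      dirD (0, 1) f2 p + f3 p, dirD (0, 1) f3 p - f2 p, dirD (0, 1) f4 p - (f1 p - f5 p), dirD (0, 1) f5 p - f4 p))"
  using assms
  by (simp_all add: fun_eq_iff frame_nabla_def dirD_Pair torus_smooth_differentiable differentiable_Pair)

abbreviation flat_laplacian :: "(real \<times> real \<Rightarrow> real) \<Rightarrow> real \<times> real \<Rightarrow> real" where
  "flat_laplacian f \<equiv> \<lambda>p. - (dirD (1, 0) (dirD (1, 0) f) p + dirD (0, 1) (dirD (0, 1) f) p)"

text \<open>
  The scalar form of the operator.  Each first-order term couples two components in the
  pattern that the reflections of the torus prescribe: under \<open>\<gamma> \<mapsto> - \<gamma>\<close> the components \<open>1, 4, 5\<close> have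
  one parity and \<open>2, 3\<close> the other, under \<open>\<theta> \<mapsto> - \<theta>\<close> the components \<open>2, 4\<close> have one parity and
  \<open>1, 3, 5\<close> the other.
\<close>

lemma jacobi_components:
  assumes "torus_smooth f1" "torus_smooth f2" "torus_smooth f3" "torus_smooth f4" "torus_smooth f5"
  shows "jacobi (\<lambda>p. (f1 p, f2 p, f3 p, f4 p, f5 p)) = (\<lambda>p.
     (flat_laplacian f1 p - 2 * dirD (0, 1) f4 p - f5 p,
      flat_laplacian f2 p - 2 * dirD (1, 0) f4 p - 2 * dirD (0, 1) f3 p + f2 p,
      flat_laplacian f3 p - 2 * dirD (1, 0) f5 p + 2 * dirD (0, 1) f2 p,
      flat_laplacian f4 p + 2 * dirD (1, 0) f2 p + 2 * dirD (0, 1) f1 p - 2 * dirD (0, 1) f5 p + f4 p,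
      flat_laplacian f5 p + 2 * dirD (1, 0) f3 p + 2 * dirD (0, 1) f4 p - f1 p))"
  using assms
  by (simp add: fun_eq_iff jacobi_def frame_laplacian_def tangent_part_def frame_nabla_components torus_smooth_intros dirD_sum_rules
      flip: minus_add_distrib)

lemma defect_components:
  assumes "torus_smooth f1" "torus_smooth f2" "torus_smooth f3" "torus_smooth f4" "torus_smooth f5"
  shows "jacobi_defect (\<lambda>p. (f1 p, f2 p, f3 p, f4 p, f5 p)) = (\<lambda>p.
     (f1 p - 2 * dirD (1, 0) f3 p, f2 p - 2 * dirD (0, 1) f3 p,
      4 * f3 p + 2 * dirD (1, 0) f1 p + 2 * dirD (0, 1) f2 p, f4 p, f5 p))"
  using assms by (simp add: fun_eq_iff jacobi_defect_def dirD_Pair torus_smooth_differentiable differentiable_Pair)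

text \<open>
  The signs of the indices follow the parities of the components under the two reflections of
  the torus.  As a derivative flips one sign, exactly the five integrals collected here are coupled
  to each other by the operator.  Dividing the second and the fourth by \<open>sqrt 2\<close> turns the
  frequency \<open>sqrt 2 * n\<close> into integer matrix entries.
\<close>

definition amplitude :: "int \<Rightarrow> int \<Rightarrow> (real \<times> real \<Rightarrow> r5) \<Rightarrow> r5" where
  "amplitude m n F = (hartley_coef (- m) n (\<lambda>p. fst (F p)), hartley_coef m (- n) (\<lambda>p. fst (snd (F p))) / sqrt 2,
     hartley_coef m n (\<lambda>p. fst (snd (snd (F p)))), hartley_coef (- m) (- n) (\<lambda>p. fst (snd (snd (snd (F p))))) / sqrt 2,
     hartley_coef (- m) n (\<lambda>p. snd (snd (snd (snd (F p))))))"

text \<open>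
  The Jacobi operator on the amplitudes with index \<open>(m, n)\<close>; the flat Laplacian contributes
  the square \<open>m\<^sup>2 + 2 n\<^sup>2\<close> of the frequency.  The arguments are real so that estimates can be made
  without conversions.
\<close>

fun mode_jacobi :: "real \<Rightarrow> real \<Rightarrow> r5 \<Rightarrow> r5" where
  "mode_jacobi m n (a, b, c, d, e) =
     ((m\<^sup>2 + 2 * n\<^sup>2) * a + 4 * n * d - e,
      (m\<^sup>2 + 2 * n\<^sup>2 + 1) * b + 2 * m * d - 2 * n * c,
      (m\<^sup>2 + 2 * n\<^sup>2) * c + 2 * m * e - 4 * n * b,
      (m\<^sup>2 + 2 * n\<^sup>2 + 1) * d + 2 * m * b + 2 * n * a - 2 * n * e,
      (m\<^sup>2 + 2 * n\<^sup>2) * e + 2 * m * c - 4 * n * d - a)"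

fun mode_defect :: "real \<Rightarrow> real \<Rightarrow> r5 \<Rightarrow> r5" where
  "mode_defect m n (a, b, c, d, e) =
     (a - 2 * m * c, b - 2 * n * c, 4 * c - 2 * m * a - 4 * n * b, d, e)"

lemma torus_smooth_components:
  assumes "torus_smooth F"
  obtains f1 f2 f3 f4 f5 where "F = (\<lambda>p. (f1 p, f2 p, f3 p, f4 p, f5 p))"
    "torus_smooth f1" "torus_smooth f2" "torus_smooth f3" "torus_smooth f4" "torus_smooth (f5 :: _ \<Rightarrow> real)"
proof
  show "F = (\<lambda>p. (fst (F p), fst (snd (F p)), fst (snd (snd (F p))), fst (snd (snd (snd (F p)))), snd (snd (snd (snd (F p))))))"
    by simp
qed (intro torus_smooth_linear[OF _ assms] bounded_linear_intros bounded_linear_ident)+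

lemma sqrt2_cancel: "sqrt 2 * (sqrt 2 * t) = 2 * t" "t / sqrt 2 = sqrt 2 * t / 2"
proof -
  show "sqrt 2 * (sqrt 2 * t) = 2 * t" by (simp flip: mult.assoc)
  then show "t / sqrt 2 = sqrt 2 * t / 2" by (simp add: field_simps)
qed

text \<open>
  Integration by parts in every component, two times for the flat Laplacian.
\<close>

lemma amplitude_jacobi:
  assumes "torus_smooth F"
  shows "amplitude m n (jacobi F) = mode_jacobi (of_int m) (of_int n) (amplitude m n F)"
proof -
  obtain f1 f2 f3 f4 f5 where F: "F = (\<lambda>p. (f1 p, f2 p, f3 p, f4 p, f5 p))"
    and f: "torus_smooth f1" "torus_smooth f2" "torus_smooth f3" "torus_smooth f4" "torus_smooth f5"
    using torus_smooth_components[OF assms] .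
  show ?thesis
    unfolding F jacobi_components[OF f]
    by (simp add: amplitude_def hartley_coef_sum_rules hartley_coef_cmul torus_smooth_intros f hartley_coef_torus_smooth
        hartley_coef_cmul[of _ _ "- 1", simplified])
       (simp add: sqrt2_cancel field_simps power2_eq_square)
qed

lemma amplitude_defect:
  assumes "torus_smooth F"
  shows "amplitude m n (jacobi_defect F) = mode_defect (of_int m) (of_int n) (amplitude m n F)"
proof -
  obtain f1 f2 f3 f4 f5 where F: "F = (\<lambda>p. (f1 p, f2 p, f3 p, f4 p, f5 p))"
    and f: "torus_smooth f1" "torus_smooth f2" "torus_smooth f3" "torus_smooth f4" "torus_smooth f5"
    using torus_smooth_components[OF assms] .
  show ?thesis
    unfolding F defect_components[OF f]
    by (simp add: amplitude_def hartley_coef_sum_rules hartley_coef_cmul torus_smooth_intros f hartley_coef_torus_smooth)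
       (simp add: sqrt2_cancel field_simps)
qed

section \<open>Sections of the pull-back bundle\<close>

definition coords :: "(real \<times> real \<Rightarrow> complex ^ 3) \<Rightarrow> real \<times> real \<Rightarrow> r5" where
  "coords V p = (V p \<bullet> frame (1, 0, 0, 0, 0) p, V p \<bullet> frame (0, 1, 0, 0, 0) p,
     V p \<bullet> frame (0, 0, 1, 0, 0) p, V p \<bullet> frame (0, 0, 0, 1, 0) p, V p \<bullet> frame (0, 0, 0, 0, 1) p)"

lemma coords_frame_section: "coords (frame_section F) = F"
proof
  fix p
  obtain a b c d e where F: "F p = (a, b, c, d, e)" by (rule prod_cases5)
  show "coords (frame_section F) p = F p"
    by (simp add: coords_def frame_section_def frame_inner F del: frame.simps)
qed

lemma torus_smooth_frame: "torus_smooth (frame v)"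
proof -
  have "torus_periodic (gen c p q r s)" for c p q r s
  proof -
    have t: "sqrt 2 * (y + sqrt 2 * pi) = sqrt 2 * y + 2 * pi" for y
      by (simp add: algebra_simps)
    have c: "cis (x + 2 * pi) = cis x" "cis (- x - 2 * pi) = cis (- x)" for x
      using cis_mult[of x "2 * pi"] cis_mult[of "- x" "- 2 * pi"]
      by (auto simp: complex_eq_iff cos_diff sin_diff)
    show ?thesis
      unfolding torus_periodic_def gen_def prod.case t by (simp add: c)
  qed
  then show ?thesis
    by (cases v) (simp add: torus_smooth_def smooth_map_gen)
qed

lemma torus_smooth_frame_section:
  assumes "torus_smooth F"
  shows "torus_smooth (frame_section F)"
proof -
  obtain f1 f2 f3 f4 f5 where F: "F = (\<lambda>p. (f1 p, f2 p, f3 p, f4 p, f5 p))"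
    and f: "torus_smooth f1" "torus_smooth f2" "torus_smooth f3" "torus_smooth f4" "torus_smooth f5"
    using torus_smooth_components[OF assms] .
  have "frame_section F = (\<lambda>q. f1 q *\<^sub>R frame (1, 0, 0, 0, 0) q + f2 q *\<^sub>R frame (0, 1, 0, 0, 0) q
     + f3 q *\<^sub>R frame (0, 0, 1, 0, 0) q + f4 q *\<^sub>R frame (0, 0, 0, 1, 0) q + f5 q *\<^sub>R frame (0, 0, 0, 0, 1) q)"
    unfolding frame_section_def[abs_def] by (subst frame_expand) (simp add: F del: frame.simps)
  then show ?thesis
    by (simp only:) (intro torus_smooth_add torus_smooth_bilinear[OF bounded_bilinear_scaleR] f torus_smooth_frame)
qed

text \<open>
  The components of a smooth section are its inner products with the smooth frame vectors.
\<close>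

lemma pullback_sections_phi:
  "V \<in> pullback_sections phi \<longleftrightarrow> (\<exists>F. torus_smooth F \<and> V = frame_section F)"
proof
  assume "V \<in> pullback_sections phi"
  then have V: "torus_smooth V" and o: "\<And>p. V p \<bullet> phi p = 0"
    unfolding pullback_sections_def torus_smooth_def by blast+
  have "V p = frame_section (coords V) p" for p
  proof -
    obtain v where v: "V p = frame v p" using frame_surj[OF o] .
    have "coords V p = coords (frame_section (\<lambda>_. v)) p"
      by (simp only: coords_def v frame_section_def)
    then show ?thesis by (simp only: coords_frame_section frame_section_def[of "coords V"] v)
  qed
  moreover have "torus_smooth (coords V)"
    unfolding coords_def[abs_def]
    by (intro torus_smooth_Pair torus_smooth_bilinear[OF bounded_bilinear_inner] V torus_smooth_frame)
  ultimately show "\<exists>F. torus_smooth F \<and> V = frame_section F" by blast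
next
  assume "\<exists>F. torus_smooth F \<and> V = frame_section F"
  then show "V \<in> pullback_sections phi"
    using torus_smooth_frame_section by (auto simp: pullback_sections_def torus_smooth_def frame_section_def frame_inner_phi)
qed

section \<open>Eigenvalue equation mode by mode\<close>

definition mode_op :: "real \<Rightarrow> real \<Rightarrow> r5 \<Rightarrow> r5" where
  "mode_op m n v = mode_jacobi m n (mode_jacobi m n v) - mode_defect m n v"

definition mode_eigenspace :: "real \<Rightarrow> real \<Rightarrow> real \<Rightarrow> r5 set" where
  "mode_eigenspace m n \<mu> = {v. mode_op m n v = \<mu> *\<^sub>R v}"

lemma linear_mode_op: "linear (mode_op m n)"
proof -
  have "linear (mode_jacobi m n)" "linear (mode_defect m n)"
    by (rule linearI; auto simp: algebra_simps)+
  from linear_compose_sub[OF linear_compose[OF this(1) this(1)] this(2)]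
  show ?thesis by (simp add: mode_op_def[abs_def] o_def)
qed

lemma subspace_mode_eigenspace: "subspace (mode_eigenspace m n \<mu>)"
  using linear_mode_op[of m n]
  by (auto simp: subspace_def mode_eigenspace_def linear_add linear_cmul linear_0 scaleR_add_right)

lemma torus_smooth_jacobi: "torus_smooth F \<Longrightarrow> torus_smooth (jacobi F)"
  and torus_smooth_defect: "torus_smooth F \<Longrightarrow> torus_smooth (jacobi_defect F)"
proof -
  assume "torus_smooth F"
  then obtain f1 f2 f3 f4 f5 where F: "F = (\<lambda>p. (f1 p, f2 p, f3 p, f4 p, f5 p))"
    and f: "torus_smooth f1" "torus_smooth f2" "torus_smooth f3" "torus_smooth f4" "torus_smooth f5"
    by (rule torus_smooth_components)
  show "torus_smooth (jacobi F)" "torus_smooth (jacobi_defect F)"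
    unfolding F jacobi_components[OF f] defect_components[OF f] by (intro torus_smooth_intros f)+
qed

lemma torus_smooth_scaleR: "torus_smooth F \<Longrightarrow> torus_smooth (\<lambda>p. c *\<^sub>R F p)"
  by (rule torus_smooth_linear[OF bounded_linear_scaleR_right])

lemma amplitude_add:
  assumes "torus_smooth F" "torus_smooth G"
  shows "amplitude m n (\<lambda>p. F p + G p) = amplitude m n F + amplitude m n G"
proof -
  obtain f1 f2 f3 f4 f5 where F: "F = (\<lambda>p. (f1 p, f2 p, f3 p, f4 p, f5 p))"
    and f: "torus_smooth f1" "torus_smooth f2" "torus_smooth f3" "torus_smooth f4" "torus_smooth f5"
    using torus_smooth_components[OF assms(1)] .
  obtain g1 g2 g3 g4 g5 where G: "G = (\<lambda>p. (g1 p, g2 p, g3 p, g4 p, g5 p))"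
    and g: "torus_smooth g1" "torus_smooth g2" "torus_smooth g3" "torus_smooth g4" "torus_smooth g5"
    using torus_smooth_components[OF assms(2)] .
  show ?thesis
    by (simp add: F G amplitude_def hartley_coef_sum_rules f g add_divide_distrib)
qed

lemma amplitude_scaleR: "amplitude m n (\<lambda>p. c *\<^sub>R F p) = c *\<^sub>R amplitude m n F"
  by (simp add: amplitude_def hartley_coef_cmul)

lemma amplitude_zero: "amplitude m n (\<lambda>p. 0) = 0"
  using amplitude_scaleR[of m n 0 "\<lambda>p. 0"] by simp

lemma torus_smooth_zero: "torus_smooth (\<lambda>p. 0 :: r5)"
  using torus_smooth_frame[of "0"] torus_smooth_linear[of "\<lambda>_. 0" "frame 0"] by (simp add: bounded_linear_zero)

lemma amplitude_sum:
  assumes "finite I" "\<And>i. i \<in> I \<Longrightarrow> torus_smooth (F i)"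
  shows "torus_smooth (\<lambda>p. \<Sum>i\<in>I. c i *\<^sub>R F i p) \<and> amplitude m n (\<lambda>p. \<Sum>i\<in>I. c i *\<^sub>R F i p) = (\<Sum>i\<in>I. c i *\<^sub>R amplitude m n (F i))"
  using assms
proof (induction I rule: finite_induct)
  case empty
  then show ?case by (simp add: amplitude_zero torus_smooth_zero)
next
  case (insert i I)
  then show ?case by (simp add: amplitude_add amplitude_scaleR torus_smooth_scaleR torus_smooth_add)
qed

text \<open>
  For each component the reflected indices still run through all pairs of integers.
\<close>

lemma amplitude_eq_zero:
  assumes F: "torus_smooth F" and 0: "\<And>m n. amplitude m n F = 0"
  shows "F p = 0"
proof -
  obtain f1 f2 f3 f4 f5 where e: "F = (\<lambda>p. (f1 p, f2 p, f3 p, f4 p, f5 p))"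
    and f: "torus_smooth f1" "torus_smooth f2" "torus_smooth f3" "torus_smooth f4" "torus_smooth f5"
    using torus_smooth_components[OF F] .
  have u: "f p = 0" if "torus_smooth f" "\<And>m n. hartley_coef m n f = 0" for f
    using that hartley_uniqueness smooth_mapD(3) unfolding torus_smooth_def by blast
  note * = 0[unfolded e amplitude_def, simplified]
  have "hartley_coef m n f1 = 0 \<and> hartley_coef m n f2 = 0 \<and> hartley_coef m n f3 = 0 \<and> hartley_coef m n f4 = 0 \<and> hartley_coef m n f5 = 0" for m n
    using *[of "- m" n] *[of m "- n"] *[of m n] *[of "- m" "- n"] by (simp add: zero_prod_def)
  then show ?thesis by (simp add: e u f zero_prod_def)
qed

text \<open>
  The section \<open>I2 V - \<mu> V\<close> vanishes if and only if all its amplitudes do, and these are the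
  matrices applied to the amplitudes of \<open>V\<close>.
\<close>

lemma eigenspace_phi_iff:
  assumes F: "torus_smooth F"
  shows "frame_section F \<in> eigenspace phi \<mu> \<longleftrightarrow> (\<forall>m n. amplitude m n F \<in> mode_eigenspace (of_int m) (of_int n) \<mu>)"
proof -
  define G where "G p = (jacobi (jacobi F) p + (- 1) *\<^sub>R jacobi_defect F p) + (- \<mu>) *\<^sub>R F p" for p
  have s: "torus_smooth (\<lambda>p. jacobi (jacobi F) p + (- 1) *\<^sub>R jacobi_defect F p)" "torus_smooth G"
    unfolding G_def[abs_def]
    by (intro torus_smooth_add torus_smooth_scaleR torus_smooth_jacobi torus_smooth_defect F)+
  have "amplitude m n G = mode_op (of_int m) (of_int n) (amplitude m n F) - \<mu> *\<^sub>R amplitude m n F" for m n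
    unfolding G_def[abs_def]
    by (simp only: amplitude_add s amplitude_scaleR torus_smooth_scaleR torus_smooth_jacobi torus_smooth_defect F amplitude_jacobi amplitude_defect mode_op_def) simp
  then have "(\<forall>m n. amplitude m n F \<in> mode_eigenspace (of_int m) (of_int n) \<mu>) \<longleftrightarrow> (\<forall>m n. amplitude m n G = 0)"
    by (simp add: mode_eigenspace_def)
  also have "\<dots> \<longleftrightarrow> (\<forall>p. G p = 0)"
  proof
    assume "\<forall>m n. amplitude m n G = 0" then show "\<forall>p. G p = 0" using amplitude_eq_zero[OF s(2)] by blast
  next
    assume "\<forall>p. G p = 0"
    then have "G = (\<lambda>p. 0)" by blast
    then show "\<forall>m n. amplitude m n G = 0" by (simp add: amplitude_zero)
  qed
  also have "\<dots> \<longleftrightarrow> (\<forall>p. I2 phi (frame_section F) p = \<mu> *\<^sub>R frame_section F p)"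
  proof -
    have "I2 phi (frame_section F) p = \<mu> *\<^sub>R frame_section F p \<longleftrightarrow> G p = 0" for p
    proof -
      have "smooth_map F" using F by (simp add: torus_smooth_def)
      then have "I2 phi (frame_section F) p = \<mu> *\<^sub>R frame_section F p \<longleftrightarrow> jacobi (jacobi F) p - jacobi_defect F p = \<mu> *\<^sub>R F p"
        by (simp only: I2_frame_section frame_section_def frame_scaleR[symmetric] frame_eq_iff)
      then show ?thesis by (simp add: G_def)
    qed
    then show ?thesis by simp
  qed
  finally show ?thesis
    using F by (auto simp: eigenspace_def pullback_sections_phi)
qed

section \<open>Dimension of an eigenspace\<close>

text \<open>
  The section with the single amplitude \<open>v\<close> at \<open>(m, n)\<close>, up to the normalisation of the waves;
  the factors \<open>sqrt 2\<close> compensate the divisions in \<open>amplitude\<close>.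
\<close>

definition wave :: "int \<Rightarrow> int \<Rightarrow> r5 \<Rightarrow> real \<times> real \<Rightarrow> r5" where
  "wave m n = (\<lambda>(a, b, c, d, e) p. (a * hartley (- m) n p, (b * sqrt 2) * hartley m (- n) p, c * hartley m n p,
     (d * sqrt 2) * hartley (- m) (- n) p, e * hartley (- m) n p))"

lemma torus_smooth_wave: "torus_smooth (wave m n v)"
  by (cases v) (simp add: wave_def, intro torus_smooth_intros)

lemma amplitude_wave: "amplitude k l (wave m n v) = (if k = m \<and> l = n then (2 * sqrt 2 * pi\<^sup>2) *\<^sub>R v else 0)"
  by (cases v) (auto simp: wave_def amplitude_def hartley_coef_cmul hartley_coef_hartley zero_prod_def)

lemma sum_fun_apply: "(\<Sum>i\<in>I. f i) p = (\<Sum>i\<in>I. f i p)"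
  by (induction I rule: infinite_finite_induct) simp_all

text \<open>
  A family that is linearly independent as a family, so in particular injective, is a basis.
  Stating independence through pointwise sums avoids sums of functions later on.
\<close>

lemma edim_basis:
  fixes S :: "('b \<Rightarrow> 'a::real_vector) set"
  assumes I: "finite I" and B: "\<And>i. i \<in> I \<Longrightarrow> B i \<in> S"
    and indep: "\<And>c. (\<And>p. (\<Sum>i\<in>I. c i *\<^sub>R B i p) = 0) \<Longrightarrow> \<forall>i\<in>I. c i = 0"
    and span: "\<And>V. V \<in> S \<Longrightarrow> \<exists>c. \<forall>p. V p = (\<Sum>i\<in>I. c i *\<^sub>R B i p)"
  shows "edim S = enat (card I)"
proof -
  have inj: "inj_on B I"
  proof (rule inj_onI, rule ccontr)
    fix i j assume ij: "i \<in> I" "j \<in> I" "B i = B j" "i \<noteq> j"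
    have "(\<Sum>k\<in>I. ((if k = i then 1 else 0) - (if k = j then 1 else 0)) *\<^sub>R B k p) = 0" for p
    proof -
      have "(\<Sum>k\<in>I. ((if k = i then 1 else 0) - (if k = j then 1 else 0)) *\<^sub>R B k p)
        = (\<Sum>k\<in>I. (if k = i then B k p else 0) - (if k = j then B k p else 0))"
        by (intro sum.cong) auto
      also have "\<dots> = 0" using ij I by (simp add: sum_subtractf)
      finally show ?thesis .
    qed
    from indep[OF this] ij show False by force
  qed
  have 1: "B ` I \<subseteq> S" using B by blast
  have 2: "S \<subseteq> fun_space.span (B ` I)"
  proof
    fix V assume "V \<in> S"
    then obtain c where c: "\<And>p. V p = (\<Sum>i\<in>I. c i *\<^sub>R B i p)" using span by blast
    have "V = (\<Sum>i\<in>I. (\<lambda>p. c i *\<^sub>R B i p))" by (simp add: fun_eq_iff sum_fun_apply c)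
    then show "V \<in> fun_space.span (B ` I)"
      by (simp only:) (intro fun_space.span_sum fun_space.span_scale fun_space.span_base imageI)
  qed
  have 3: "\<not> fun_space.dependent (B ` I)"
  proof
    assume "fun_space.dependent (B ` I)"
    then obtain u where u: "\<exists>v\<in>B ` I. u v \<noteq> 0" "(\<Sum>v\<in>B ` I. (\<lambda>p. u v *\<^sub>R v p)) = 0"
      using fun_space.dependent_finite[of "B ` I"] I by auto
    have "(\<Sum>i\<in>I. u (B i) *\<^sub>R B i p) = 0" for p
      using arg_cong[OF u(2), of "\<lambda>f. f p"] by (simp add: sum.reindex[OF inj] sum_fun_apply)
    from indep[OF this] u(1) show False by blast
  qed
  have "fun_space.dim S = card I"
    using fun_space.dim_unique[OF 1 2 3] card_image[OF inj] by simp
  moreover have "finite (B ` I)" using I by simp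
  ultimately show ?thesis
    unfolding edim_def using 2 by auto
qed

text \<open>
  Orthonormal bases of the eigenspaces of the matrices with index in \<open>K\<close>, turned into waves, form
  a basis of the eigenspace: amplitudes of a linear combination recover its coefficients, and
  a section in the eigenspace has the same amplitudes as the combination formed with its own
  amplitudes.
\<close>

theorem edim_eigenspace_phi:
  assumes K: "finite K"
    and out: "\<And>m n. (m, n) \<notin> K \<Longrightarrow> mode_eigenspace (of_int m) (of_int n) \<mu> = {0}"
  shows "edim (eigenspace phi \<mu>) = enat (\<Sum>(m, n)\<in>K. dim (mode_eigenspace (of_int m) (of_int n) \<mu>))"
proof -
  let ?E = "\<lambda>k. mode_eigenspace (of_int (fst k)) (of_int (snd k)) \<mu>"
  define A where "A = 2 * sqrt 2 * pi\<^sup>2"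
  have A: "A > 0" by (simp add: A_def)
  have "\<exists>B. B \<subseteq> ?E k \<and> pairwise orthogonal B \<and> (\<forall>x\<in>B. norm x = 1) \<and> finite B \<and> card B = dim (?E k) \<and> span B = ?E k" for k
    using orthonormal_basis_subspace[OF subspace_mode_eigenspace] independent_imp_finite by metis
  then obtain Q where Q: "\<And>k. Q k \<subseteq> ?E k" "\<And>k. pairwise orthogonal (Q k)" "\<And>k x. x \<in> Q k \<Longrightarrow> norm x = 1"
    "\<And>k. finite (Q k)" "\<And>k. card (Q k) = dim (?E k)" "\<And>k. span (Q k) = ?E k"
    by metis
  have ip: "x \<bullet> y = (if x = y then 1 else 0)" if "x \<in> Q k" "y \<in> Q k" for x y k
    using Q(2)[of k] Q(3)[OF that(1)] that by (auto simp: pairwise_def orthogonal_def norm_eq_1)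
  define I where "I = Sigma K Q"
  define W where "W = (\<lambda>(k, x). wave (fst k) (snd k) x)"
  have fI: "finite I" using K Q(4) by (simp add: I_def)
  define \<Phi> where "\<Phi> c = (\<lambda>p. \<Sum>i\<in>I. c i *\<^sub>R W i p)" for c :: "_ \<Rightarrow> real"
  have smooth: "torus_smooth (\<Phi> c)" for c
    using amplitude_sum[OF fI, of W] by (auto simp: \<Phi>_def W_def torus_smooth_wave)
  have amplitude: "amplitude m n (\<Phi> c) = (if (m, n) \<in> K then A *\<^sub>R (\<Sum>x\<in>Q (m, n). c ((m, n), x) *\<^sub>R x) else 0)" for m n c
  proof -
    have "amplitude m n (\<Phi> c) = (\<Sum>i\<in>I. c i *\<^sub>R amplitude m n (W i))"
      using amplitude_sum[OF fI, of W] by (auto simp: \<Phi>_def W_def torus_smooth_wave)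
    also have "\<dots> = (\<Sum>k\<in>K. \<Sum>x\<in>Q k. c (k, x) *\<^sub>R amplitude m n (W (k, x)))"
      unfolding I_def by (subst sum.Sigma) (use K Q(4) in \<open>auto intro!: sum.cong\<close>)
    also have "\<dots> = (\<Sum>k\<in>K. if k = (m, n) then A *\<^sub>R (\<Sum>x\<in>Q k. c (k, x) *\<^sub>R x) else 0)"
    proof (intro sum.cong refl)
      fix k
      show "(\<Sum>x\<in>Q k. c (k, x) *\<^sub>R amplitude m n (W (k, x))) = (if k = (m, n) then A *\<^sub>R (\<Sum>x\<in>Q k. c (k, x) *\<^sub>R x) else 0)"
      proof (cases "k = (m, n)")
        case True
        then have "amplitude m n (W (k, x)) = A *\<^sub>R x" for x by (simp add: W_def amplitude_wave A_def)
        then show ?thesis using True by (simp add: scaleR_sum_right mult.commute)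
      next
        case False
        then have "amplitude m n (W (k, x)) = 0" for x by (auto simp: W_def amplitude_wave prod_eq_iff)
        then show ?thesis using False by simp
      qed
    qed
    finally show ?thesis using K by simp
  qed
  have frame_section_sum: "(\<Sum>i\<in>I. c i *\<^sub>R frame_section (W i) p) = frame_section (\<Phi> c) p" for c p
    by (simp only: frame_section_def \<Phi>_def linear_sum[OF linear_frame] frame_scaleR)
  have "edim (eigenspace phi \<mu>) = enat (card I)"
  proof (rule edim_basis[where B = "\<lambda>i. frame_section (W i)"])
    fix i assume i: "i \<in> I"
    have sub: "amplitude m n (W i) \<in> mode_eigenspace (of_int m) (of_int n) \<mu>" for m n
      using i Q(1)[of "fst i"] subspace_scale[OF subspace_mode_eigenspace] subspace_0[OF subspace_mode_eigenspace]
      by (auto simp: I_def W_def amplitude_wave)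
    show "frame_section (W i) \<in> eigenspace phi \<mu>"
      using sub by (subst eigenspace_phi_iff) (auto simp: W_def torus_smooth_wave split: prod.split)
  next
    fix c assume "\<And>p. (\<Sum>i\<in>I. c i *\<^sub>R frame_section (W i) p) = 0"
    then have "frame_section (\<Phi> c) p = frame 0 p" for p
      using frame_section_sum[of c p] frame_scaleR[of 0 0 p] by simp
    then have "\<Phi> c p = 0" for p
      by (simp only: frame_section_def frame_eq_iff)
    then have "\<Phi> c = (\<lambda>p. 0)" by (rule ext)
    then have z0: "amplitude m n (\<Phi> c) = 0" for m n by (simp add: amplitude_zero)
    have z: "A *\<^sub>R (\<Sum>x\<in>Q (m, n). c ((m, n), x) *\<^sub>R x) = 0" if "(m, n) \<in> K" for m n
      using trans[OF amplitude[of m n c, symmetric] z0] that by (simp only: if_True)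
    show "\<forall>i\<in>I. c i = 0"
    proof
      fix i assume i: "i \<in> I"
      obtain m n y where i': "i = ((m, n), y)" by (metis prod.collapse)
      then have mn: "(m, n) \<in> K" "y \<in> Q (m, n)" using i by (auto simp: I_def)
      have "0 = (\<Sum>x\<in>Q (m, n). c ((m, n), x) *\<^sub>R x) \<bullet> y" using z[OF mn(1)] A by simp
      also have "\<dots> = (\<Sum>x\<in>Q (m, n). if x = y then c ((m, n), x) else 0)"
        by (auto simp: inner_sum_left ip mn intro!: sum.cong)
      also have "\<dots> = c i" using mn Q(4) by (simp add: i')
      finally show "c i = 0" by simp
    qed
  next
    fix V assume V: "V \<in> eigenspace phi \<mu>"
    then obtain F where F: "torus_smooth F" "V = frame_section F"
      by (auto simp: eigenspace_def pullback_sections_phi)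
    have E: "amplitude m n F \<in> mode_eigenspace (of_int m) (of_int n) \<mu>" for m n
      using V eigenspace_phi_iff[OF F(1)] F(2) by simp
    define c where "c i = (amplitude (fst (fst i)) (snd (fst i)) F \<bullet> snd i) / A" for i
    define G where "G p = F p + (- 1) *\<^sub>R \<Phi> c p" for p
    have G: "torus_smooth G"
      unfolding G_def[abs_def] by (intro torus_smooth_add torus_smooth_scaleR F smooth)
    have "amplitude m n G = 0" for m n
    proof -
      have g: "amplitude m n G = amplitude m n F - amplitude m n (\<Phi> c)"
      proof -
        have "amplitude m n (\<lambda>p. F p + (- 1) *\<^sub>R \<Phi> c p) = amplitude m n F + amplitude m n (\<lambda>p. (- 1) *\<^sub>R \<Phi> c p)"
          by (intro amplitude_add F torus_smooth_scaleR smooth)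
        then show ?thesis unfolding G_def[abs_def] amplitude_scaleR by simp
      qed
      show ?thesis
      proof (cases "(m, n) \<in> K")
        case True
        have "A *\<^sub>R (\<Sum>x\<in>Q (m, n). c ((m, n), x) *\<^sub>R x) = (\<Sum>x\<in>Q (m, n). (amplitude m n F \<bullet> x / (x \<bullet> x)) *\<^sub>R x)"
          using A by (auto simp: scaleR_sum_right c_def ip intro!: sum.cong)
        also have "\<dots> = amplitude m n F"
        proof -
          let ?s = "\<Sum>x\<in>Q (m, n). (amplitude m n F \<bullet> x / (x \<bullet> x)) *\<^sub>R x"
          have "amplitude m n F - ?s \<in> span (Q (m, n))"
          proof (intro span_diff span_sum span_scale)
            show "amplitude m n F \<in> span (Q (m, n))" using E[of m n] Q(6)[of "(m, n)"] by simp
          qed (rule span_base)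
          moreover have "orthogonal (amplitude m n F - ?s) x" if x: "x \<in> Q (m, n)" for x
          proof -
            have "?s \<bullet> x = (\<Sum>y\<in>Q (m, n). if y = x then amplitude m n F \<bullet> x else 0)"
              using x by (auto simp: inner_sum_left ip intro!: sum.cong)
            then show ?thesis using x Q(4) by (simp add: orthogonal_def inner_diff_left)
          qed
          ultimately have "orthogonal (amplitude m n F - ?s) (amplitude m n F - ?s)"
            by (rule orthogonal_to_span)
          then show ?thesis by (simp add: orthogonal_self)
        qed
        finally show ?thesis using g amplitude True by simp
      next
        case False
        then show ?thesis using g amplitude out[OF False] E[of m n] by simp
      qed
    qed
    from amplitude_eq_zero[OF G this] have "F p = \<Phi> c p" for p by (simp add: G_def)
    then have "F = \<Phi> c" by (rule ext)
    then have "\<forall>p. V p = (\<Sum>i\<in>I. c i *\<^sub>R frame_section (W i) p)"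
      by (simp add: frame_section_sum F(2))
    then show "\<exists>c. \<forall>p. V p = (\<Sum>i\<in>I. c i *\<^sub>R frame_section (W i) p)" by blast
  qed (rule fI)
  also have "card I = (\<Sum>k\<in>K. dim (?E k))"
    using Q(4,5) K by (simp add: I_def)
  finally show ?thesis by (simp add: case_prod_beta)
qed

section \<open>Positivity of the high modes\<close>

text \<open>
  The Euclidean inner product before the second and fourth amplitude were divided by \<open>sqrt 2\<close>.
  The matrices are symmetric with respect to it.
\<close>

fun weighted_inner :: "r5 \<Rightarrow> r5 \<Rightarrow> real" where
  "weighted_inner (a, b, c, d, e) (a', b', c', d', e') = a * a' + 2 * b * b' + c * c' + 2 * d * d' + e * e'"

lemma weighted_inner_self: "weighted_inner v v \<ge> 0" "weighted_inner v v = 0 \<longleftrightarrow> v = 0"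
proof -
  obtain a b c d e where v: "v = (a, b, c, d, e)" by (rule prod_cases5)
  have w: "weighted_inner v v = a\<^sup>2 + 2 * b\<^sup>2 + c\<^sup>2 + 2 * d\<^sup>2 + e\<^sup>2"
    by (simp add: v power2_eq_square)
  show "weighted_inner v v \<ge> 0" unfolding w by simp
  show "weighted_inner v v = 0 \<longleftrightarrow> v = 0"
    unfolding w by (simp add: v add_nonneg_eq_0_iff zero_prod_def)
qed

lemma weighted_inner_scaleR: "weighted_inner v (t *\<^sub>R w) = t * weighted_inner v w"
  by (cases v; cases w) (simp add: algebra_simps)

lemma weighted_inner_diff: "weighted_inner v (w - u) = weighted_inner v w - weighted_inner v u"
  by (cases v; cases w; cases u) (simp add: algebra_simps)

lemma weighted_inner_mode_jacobi: "weighted_inner (mode_jacobi m n v) w = weighted_inner v (mode_jacobi m n w)"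
proof -
  obtain a b c d e where v: "v = (a, b, c, d, e)" by (rule prod_cases5)
  obtain a' b' c' d' e' where w: "w = (a', b', c', d', e')" by (rule prod_cases5)
  show ?thesis unfolding v w mode_jacobi.simps weighted_inner.simps by algebra
qed

lemma weighted_inner_mode_op: "weighted_inner v (mode_op m n v) = weighted_inner (mode_jacobi m n v) (mode_jacobi m n v) - weighted_inner v (mode_defect m n v)"
  by (simp add: mode_op_def weighted_inner_diff weighted_inner_mode_jacobi)

lemma mode_eigenspace_form: "v \<in> mode_eigenspace m n \<mu> \<Longrightarrow> weighted_inner v (mode_op m n v) = \<mu> * weighted_inner v v"
  by (simp add: mode_eigenspace_def weighted_inner_scaleR)

lemma mode_eigenspace_nonpos_trivial:
  assumes v: "v \<in> mode_eigenspace m n \<mu>" and \<mu>: "\<mu> \<le> 0" and pos: "v \<noteq> 0 \<Longrightarrow> weighted_inner v (mode_op m n v) > 0"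
  shows "v = 0"
proof (rule ccontr)
  assume "v \<noteq> 0"
  then show False
    using pos mode_eigenspace_form[OF v] mult_nonpos_nonneg[OF \<mu> weighted_inner_self(1)[of v]] by simp
qed

lemma mode_eigenspace_neg_trivial:
  assumes v: "v \<in> mode_eigenspace m n \<mu>" and \<mu>: "\<mu> < 0" and pos: "weighted_inner v (mode_op m n v) \<ge> 0"
  shows "v = 0"
  using pos mode_eigenspace_form[OF v] \<mu> weighted_inner_self[of v] by (simp add: zero_le_mult_iff)

text \<open>
  The right-hand side is \<open>\<bar>\<nabla>\<^sub>\<gamma> V\<bar>\<^sup>2\<close> in terms of the amplitudes of \<open>V\<close>.  The connection matrix in direction \<open>\<gamma>\<close> has
  eigenvalues \<open>\<plusminus>i\<close> and \<open>0\<close>, so it shifts the frequency \<open>m\<close> by at most one.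
\<close>

lemma gamma_part_bound:
  fixes m p a b c d e :: real
  assumes "m = 0 \<and> p = 0 \<or> m \<ge> 1 \<and> p = m - 1"
  shows "p\<^sup>2 * (a\<^sup>2 + 2 * b\<^sup>2 + c\<^sup>2 + 2 * d\<^sup>2 + e\<^sup>2)
    \<le> m\<^sup>2 * a\<^sup>2 + (m * c + e)\<^sup>2 + (m * e + c)\<^sup>2 + 2 * (m * b + d)\<^sup>2 + 2 * (m * d + b)\<^sup>2"
  using assms
proof
  assume m: "m \<ge> 1 \<and> p = m - 1"
  have "m\<^sup>2 * a\<^sup>2 + (m * c + e)\<^sup>2 + (m * e + c)\<^sup>2 + 2 * (m * b + d)\<^sup>2 + 2 * (m * d + b)\<^sup>2
      - (m - 1)\<^sup>2 * (a\<^sup>2 + 2 * b\<^sup>2 + c\<^sup>2 + 2 * d\<^sup>2 + e\<^sup>2)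
    = (2 * m - 1) * a\<^sup>2 + 2 * m * (c + e)\<^sup>2 + 4 * m * (b + d)\<^sup>2"
    by algebra
  moreover have "\<dots> \<ge> 0" using m by simp
  ultimately show ?thesis unfolding m[THEN conjunct2] by linarith
qed simp

text \<open>
  The right-hand side is \<open>\<bar>\<nabla>\<^sub>\<theta> V\<bar>\<^sup>2\<close> in terms of the amplitudes of \<open>V\<close>.  Now the frequency is \<open>sqrt 2 * n\<close> and the connection
  matrix has eigenvalues of modulus at most \<open>sqrt 2\<close>, so again \<open>n\<close> is shifted by at most one.
\<close>

lemma theta_part_bound:
  fixes n q a b c d e :: real
  assumes "n = 0 \<and> q = 0 \<or> n \<ge> 1 \<and> q = n - 1"
  shows "2 * q\<^sup>2 * (a\<^sup>2 + 2 * b\<^sup>2 + c\<^sup>2 + 2 * d\<^sup>2 + e\<^sup>2)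
    \<le> 2 * (n * a + d)\<^sup>2 + (2 * n * d + a - e)\<^sup>2 + 2 * (n * e - d)\<^sup>2 + (2 * n * b - c)\<^sup>2 + 2 * (n * c - b)\<^sup>2"
  using assms
proof
  assume n: "n \<ge> 1 \<and> q = n - 1"
  have "2 * (n * a + d)\<^sup>2 + (2 * n * d + a - e)\<^sup>2 + 2 * (n * e - d)\<^sup>2 + (2 * n * b - c)\<^sup>2 + 2 * (n * c - b)\<^sup>2
      - 2 * (n - 1)\<^sup>2 * (a\<^sup>2 + 2 * b\<^sup>2 + c\<^sup>2 + 2 * d\<^sup>2 + e\<^sup>2)
    = 2 * n * (a - e + 2 * d)\<^sup>2 + (2 * n - 1) * (a + e)\<^sup>2
      + (n - 1) * (c\<^sup>2 + 2 * b\<^sup>2) + n * (3 * (c - 4 / 3 * b)\<^sup>2 + 2 / 3 * b\<^sup>2)"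
    by (simp add: power2_eq_square field_simps)
  moreover have "\<dots> \<ge> 0" using n by simp
  ultimately show ?thesis unfolding n[THEN conjunct2] by linarith
qed simp

text \<open>
  \<open>\<langle>V, J V\<rangle> = \<bar>\<nabla>V\<bar>\<^sup>2 - 2 \<bar>V\<bar>\<^sup>2 + \<langle>V, T V\<rangle>\<close> with \<open>T \<ge> 0\<close>.
\<close>

lemma weighted_inner_mode_jacobi_lower:
  assumes m: "m = 0 \<and> p = 0 \<or> m \<ge> 1 \<and> p = m - 1" and n: "n = 0 \<and> q = 0 \<or> n \<ge> 1 \<and> q = n - 1"
  shows "(p\<^sup>2 + 2 * q\<^sup>2 - 2) * weighted_inner v v \<le> weighted_inner v (mode_jacobi m n v)"
proof -
  obtain a b c d e where v: "v = (a, b, c, d, e)" by (rule prod_cases5)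
  have "weighted_inner v (mode_jacobi m n v) =
      (m\<^sup>2 * a\<^sup>2 + (m * c + e)\<^sup>2 + (m * e + c)\<^sup>2 + 2 * (m * b + d)\<^sup>2 + 2 * (m * d + b)\<^sup>2)
    + (2 * (n * a + d)\<^sup>2 + (2 * n * d + a - e)\<^sup>2 + 2 * (n * e - d)\<^sup>2 + (2 * n * b - c)\<^sup>2 + 2 * (n * c - b)\<^sup>2)
    - 2 * weighted_inner v v + a\<^sup>2 + 2 * b\<^sup>2"
    unfolding v mode_jacobi.simps weighted_inner.simps by algebra
  moreover have N: "weighted_inner v v = a\<^sup>2 + 2 * b\<^sup>2 + c\<^sup>2 + 2 * d\<^sup>2 + e\<^sup>2"
    by (simp add: v power2_eq_square)
  moreover have "(p\<^sup>2 + 2 * q\<^sup>2 - 2) * weighted_inner v v = p\<^sup>2 * weighted_inner v v + 2 * q\<^sup>2 * weighted_inner v v - 2 * weighted_inner v v"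
    by algebra
  moreover have "a\<^sup>2 \<ge> 0" "b\<^sup>2 \<ge> 0" by simp_all
  ultimately show ?thesis
    using gamma_part_bound[OF m, of a b c d e, folded N] theta_part_bound[OF n, of a b c d e, folded N]
    by linarith
qed

text \<open>
  The number \<open>17 / 6\<close> is a rational bound for \<open>2 * sqrt 2\<close>; the room between them is the term
  \<open>1 / 51 * b\<^sup>2\<close>.
\<close>

lemma weighted_inner_mode_defect_upper:
  assumes "m \<ge> 0" "n \<ge> 0"
  shows "weighted_inner v (mode_defect m n v) \<le> (4 + 2 * m + 17 / 6 * n) * weighted_inner v v"
proof -
  obtain a b c d e where v: "v = (a, b, c, d, e)" by (rule prod_cases5)
  have "(4 + 2 * m + 17 / 6 * n) * weighted_inner v v - weighted_inner v (mode_defect m n v) =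
      3 * (a\<^sup>2 + 2 * b\<^sup>2 + 2 * d\<^sup>2 + e\<^sup>2) + 2 * m * ((a + c)\<^sup>2 + 2 * b\<^sup>2 + 2 * d\<^sup>2 + e\<^sup>2)
    + n * (17 / 6 * (c + 24 / 17 * b)\<^sup>2 + 1 / 51 * b\<^sup>2 + 17 / 6 * (a\<^sup>2 + 2 * d\<^sup>2 + e\<^sup>2))"
    by (simp add: v power2_eq_square field_simps)
  moreover have "\<dots> \<ge> 0" using assms by simp
  ultimately show ?thesis by linarith
qed

text \<open>
  With \<open>\<kappa> = p\<^sup>2 + 2 q\<^sup>2 - 2 \<ge> 0\<close> the lower bound \<open>\<langle>v, J v\<rangle> \<ge> \<kappa> \<bar>v\<bar>\<^sup>2\<close> gives \<open>\<bar>J v\<bar> \<ge> \<kappa> \<bar>v\<bar>\<close>, so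
  \<open>J\<^sup>2\<close> dominates \<open>N\<close> as soon as \<open>\<kappa>\<^sup>2\<close> exceeds the upper bound of \<open>N\<close>.
\<close>

lemma mode_eigenspace_high:
  assumes m: "m = 0 \<and> p = 0 \<or> m \<ge> 1 \<and> p = m - 1" and n: "n = 0 \<and> q = 0 \<or> n \<ge> 1 \<and> q = n - 1"
    and \<kappa>: "p\<^sup>2 + 2 * q\<^sup>2 - 2 \<ge> 0" "4 + 2 * m + 17 / 6 * n < (p\<^sup>2 + 2 * q\<^sup>2 - 2)\<^sup>2"
    and \<mu>: "\<mu> \<le> 0" and v: "v \<in> mode_eigenspace m n \<mu>"
  shows "v = 0"
proof (rule mode_eigenspace_nonpos_trivial[OF v \<mu>])
  define \<kappa> where "\<kappa> = p\<^sup>2 + 2 * q\<^sup>2 - 2"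
  let ?J = "mode_jacobi m n v"
  assume "v \<noteq> 0"
  then have pos: "weighted_inner v v > 0" using weighted_inner_self[of v] by linarith
    \<comment> \<open>Cauchy-Schwarz in the form \<open>\<bar>J v - \<kappa> v\<bar>\<^sup>2 \<ge> 0\<close>, which avoids dividing by \<open>\<bar>v\<bar>\<close>.\<close>
    have "0 \<le> weighted_inner (?J - \<kappa> *\<^sub>R v) (?J - \<kappa> *\<^sub>R v)" by (rule weighted_inner_self)
    also have "\<dots> = weighted_inner ?J ?J - 2 * \<kappa> * weighted_inner v ?J + \<kappa>\<^sup>2 * weighted_inner v v"
      by (cases v; cases ?J) (simp add: power2_eq_square algebra_simps)
    finally have "weighted_inner ?J ?J \<ge> 2 * (\<kappa> * weighted_inner v ?J) - \<kappa>\<^sup>2 * weighted_inner v v" by simp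
    moreover have "\<kappa> * (\<kappa> * weighted_inner v v) \<le> \<kappa> * weighted_inner v ?J"
      using weighted_inner_mode_jacobi_lower[OF m n, of v] \<kappa>(1) unfolding \<kappa>_def by (rule mult_left_mono)
    ultimately have J: "weighted_inner ?J ?J \<ge> \<kappa>\<^sup>2 * weighted_inner v v"
      by (simp add: power2_eq_square)
    have "(4 + 2 * m + 17 / 6 * n) * weighted_inner v v < \<kappa>\<^sup>2 * weighted_inner v v"
      using \<kappa>(2) pos unfolding \<kappa>_def by (rule mult_strict_right_mono)
    then have "weighted_inner v (mode_defect m n v) < weighted_inner ?J ?J"
      using J weighted_inner_mode_defect_upper[of m n v] m n by linarith
    then show "weighted_inner v (mode_op m n v) > 0" by (simp add: weighted_inner_mode_op)
qed

text \<open>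
  The truncated subtraction yields \<open>p = 0\<close> for \<open>m = 0\<close>, as it should.  The pair \<open>(3, 2)\<close> is the
  tightest case, \<open>47 / 3 < 16\<close>; otherwise \<open>X \<ge> 6\<close>, and \<open>6 X\<close> already suffices.
\<close>

lemma high_mode_numbers:
  fixes m n :: nat
  assumes "m \<ge> 4 \<or> n \<ge> 3 \<or> m = 3 \<and> n = 2"
  defines "p \<equiv> real (m - 1)" and "q \<equiv> real (n - 1)"
  defines "X \<equiv> p\<^sup>2 + 2 * q\<^sup>2 - 2"
  shows "X \<ge> 0 \<and> 4 + 2 * real m + 17 / 6 * real n < X\<^sup>2"
proof -
  have pq: "real m \<le> p + 1" "real n \<le> q + 1" "p \<ge> 0" "q \<ge> 0" by (simp_all add: p_def q_def)
  have sq: "6 * X \<le> X\<^sup>2" if "X \<ge> 6"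
    unfolding power2_eq_square using that by (intro mult_right_mono) auto
  consider "m = 3" "n = 2" | "p \<ge> 3" | "q \<ge> 2" using assms(1) by (fastforce simp: p_def q_def)
  then show ?thesis
  proof cases
    case 1
    then show ?thesis by (simp add: p_def q_def X_def)
  next
    case 2
    have "p\<^sup>2 \<ge> 6 * p - 9" "q\<^sup>2 \<ge> q - 1 / 4"
      using zero_le_power2[of "p - 3"] zero_le_power2[of "q - 1 / 2"] by (simp_all add: power2_eq_square algebra_simps)
    then have "X \<ge> 6 * p + 2 * q - 23 / 2" by (simp add: X_def)
    then show ?thesis using 2 pq sq by (intro conjI) linarith+
  next
    case 3
    have "p\<^sup>2 \<ge> 2 * p - 1" "q\<^sup>2 \<ge> 4 * q - 4"
      using zero_le_power2[of "p - 1"] zero_le_power2[of "q - 2"] by (simp_all add: power2_eq_square algebra_simps)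
    then have "X \<ge> 2 * p + 8 * q - 11" by (simp add: X_def)
    moreover have "X \<ge> 2 * q\<^sup>2 - 2" by (simp add: X_def)
    moreover have "q\<^sup>2 \<ge> 2\<^sup>2" using 3 by (intro power_mono) auto
    ultimately show ?thesis using 3 pq sq by (intro conjI) auto
  qed
qed

section \<open>The low modes\<close>

lemma mode_op_table:
  shows "mode_op 0 0 (a, b, c, d, e) = (0, 0, - 4 * c, 0, 0)"
    "mode_op 0 1 (a, b, c, d, e) = (12 * a + 24 * d - 12 * e, 16 * b - 8 * c, - 16 * b + 8 * c, 12 * a + 24 * d - 12 * e, - 12 * a - 24 * d + 12 * e)"
    "mode_op 0 2 (a, b, c, d, e) = (96 * a + 144 * d - 48 * e, 112 * b - 64 * c, - 128 * b + 92 * c, 72 * a + 144 * d - 72 * e, - 48 * a - 144 * d + 96 * e)"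
    "mode_op 1 0 (a, b, c, d, e) = (a - 2 * e, 7 * b + 8 * d, c + 4 * e, 8 * b + 7 * d, - 2 * a + 4 * c + 5 * e)"
    "mode_op 2 0 (a, b, c, d, e) = (16 * a - 8 * e, 40 * b + 40 * d, 28 * c + 32 * e, 40 * b + 40 * d, - 8 * a + 32 * c + 32 * e)"
    "mode_op 1 1 (a, b, c, d, e) = (17 * a + 8 * b + 32 * d - 14 * e, 4 * a + 27 * b - 12 * c + 16 * d - 8 * e, - 24 * b + 17 * c - 16 * d + 12 * e, 16 * a + 16 * b - 8 * c + 35 * d - 16 * e, - 14 * a - 16 * b + 12 * c - 32 * d + 21 * e)"
    "mode_op 2 1 (a, b, c, d, e) = (44 * a + 16 * b + 56 * d - 20 * e, 8 * a + 72 * b - 24 * c + 56 * d - 16 * e, - 48 * b + 56 * c - 32 * d + 48 * e, 28 * a + 56 * b - 16 * c + 80 * d - 28 * e, - 20 * a - 32 * b + 48 * c - 56 * d + 60 * e)"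
    "mode_op 1 2 (a, b, c, d, e) = (113 * a + 16 * b + 160 * d - 50 * e, 8 * a + 135 * b - 72 * c + 40 * d - 16 * e, - 144 * b + 113 * c - 32 * d + 36 * e, 80 * a + 40 * b - 16 * c + 167 * d - 80 * e, - 50 * a - 32 * b + 36 * c - 160 * d + 117 * e)"
    "mode_op 2 2 (a, b, c, d, e) = (176 * a + 32 * b + 208 * d - 56 * e, 16 * a + 216 * b - 96 * c + 104 * d - 32 * e, - 192 * b + 188 * c - 64 * d + 96 * e, 104 * a + 104 * b - 32 * c + 248 * d - 104 * e, - 56 * a - 64 * b + 96 * c - 208 * d + 192 * e)"
    "mode_op 3 0 (a, b, c, d, e) = (81 * a - 18 * e, 135 * b + 120 * d, 113 * c + 108 * e, 120 * b + 135 * d, - 18 * a + 108 * c + 117 * e)"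
    "mode_op 3 1 (a, b, c, d, e) = (129 * a + 24 * b + 96 * d - 30 * e, 12 * a + 187 * b - 44 * c + 144 * d - 24 * e, - 88 * b + 161 * c - 48 * d + 132 * e, 48 * a + 144 * b - 24 * c + 195 * d - 48 * e, - 30 * a - 48 * b + 132 * c - 96 * d + 165 * e)"
  by (simp_all add: mode_op_def zero_prod_def)

text \<open>
  The explicit positive definite matrices are treated by writing their quadratic form as a sum of
  squares; where there is room, \<open>weighted_inner v v\<close> is split off first.
\<close>

lemma mode_eigenspace_3_0: "v \<in> mode_eigenspace 3 0 \<mu> \<Longrightarrow> \<mu> \<le> 0 \<Longrightarrow> v = 0"
proof (erule mode_eigenspace_nonpos_trivial)
  assume "v \<noteq> 0"
  obtain a b c d e where v: "v = (a, b, c, d, e)" by (rule prod_cases5)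
  have "weighted_inner v (mode_op 3 0 v) = weighted_inner v v + (6 * (3 * a - e)\<^sup>2 + 240 * (b + d)\<^sup>2 + 108 * (c + e)\<^sup>2
      + 26 * a\<^sup>2 + 28 * b\<^sup>2 + 4 * c\<^sup>2 + 28 * d\<^sup>2 + 2 * e\<^sup>2)"
    unfolding v mode_op_table weighted_inner.simps by algebra
  moreover have "weighted_inner v v > 0" using weighted_inner_self[of v] \<open>v \<noteq> 0\<close> by linarith
  ultimately show "weighted_inner v (mode_op 3 0 v) > 0" by (simp add: add_pos_nonneg)
qed


lemma mode_eigenspace_3_1: "v \<in> mode_eigenspace 3 1 \<mu> \<Longrightarrow> \<mu> \<le> 0 \<Longrightarrow> v = 0"
proof (erule mode_eigenspace_nonpos_trivial)
  assume "v \<noteq> 0"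
  obtain a b c d e where v: "v = (a, b, c, d, e)" by (rule prod_cases5)
  have "weighted_inner v (mode_op 3 1 v) = weighted_inner v v + (6 * (2 * a + 6 * b - c + 8 * d - 2 * e)\<^sup>2
      + 4 * (2 * a - 6 * b + 2 * c - e)\<^sup>2 + 128 * (c + e)\<^sup>2 + 4 * (a - c)\<^sup>2 + 2 * (a + e)\<^sup>2
      + 4 * (b - c)\<^sup>2 + 82 * a\<^sup>2 + 8 * b\<^sup>2 + 2 * c\<^sup>2 + 4 * d\<^sup>2 + 6 * e\<^sup>2)"
    unfolding v mode_op_table weighted_inner.simps by algebra
  moreover have "weighted_inner v v > 0" using weighted_inner_self[of v] \<open>v \<noteq> 0\<close> by linarith
  ultimately show "weighted_inner v (mode_op 3 1 v) > 0" by (simp add: add_pos_nonneg)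
qed

lemma mode_eigenspace_2_2: "v \<in> mode_eigenspace 2 2 \<mu> \<Longrightarrow> \<mu> \<le> 0 \<Longrightarrow> v = 0"
proof (erule mode_eigenspace_nonpos_trivial)
  assume "v \<noteq> 0"
  obtain a b c d e where v: "v = (a, b, c, d, e)" by (rule prod_cases5)
  have "weighted_inner v (mode_op 2 2 v) = weighted_inner v v + (8 * (4 * a + b + 6 * d - 2 * e)\<^sup>2
      + 6 * (8 * b - 4 * c + 3 * d - e)\<^sup>2 + 3 * (6 * d - 5 * e)\<^sup>2 + (9 * c + 8 * e)\<^sup>2
      + 16 * (a + d)\<^sup>2 + 8 * (a + e)\<^sup>2 + 16 * (b + d)\<^sup>2 + 8 * (c + d)\<^sup>2 + 4 * (d - e)\<^sup>2
      + 23 * a\<^sup>2 + 22 * b\<^sup>2 + 2 * c\<^sup>2 + 2 * e\<^sup>2)"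
    unfolding v mode_op_table weighted_inner.simps by algebra
  moreover have "weighted_inner v v > 0" using weighted_inner_self[of v] \<open>v \<noteq> 0\<close> by linarith
  ultimately show "weighted_inner v (mode_op 2 2 v) > 0" by (simp add: add_pos_nonneg)
qed

lemma weighted_squares_nonpos:
  fixes k1 k2 k3 k4 k5 x1 x2 x3 x4 x5 :: real
  assumes "k1 > 0" "k2 > 0" "k3 > 0" "k4 > 0" "k5 > 0"
    and "k1 * x1\<^sup>2 + k2 * x2\<^sup>2 + k3 * x3\<^sup>2 + k4 * x4\<^sup>2 + k5 * x5\<^sup>2 \<le> 0"
  shows "x1 = 0 \<and> x2 = 0 \<and> x3 = 0 \<and> x4 = 0 \<and> x5 = 0"
proof -
  have "k1 * x1\<^sup>2 \<ge> 0" "k2 * x2\<^sup>2 \<ge> 0" "k3 * x3\<^sup>2 \<ge> 0" "k4 * x4\<^sup>2 \<ge> 0" "k5 * x5\<^sup>2 \<ge> 0"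
    using assms by simp_all
  then have "k1 * x1\<^sup>2 = 0 \<and> k2 * x2\<^sup>2 = 0 \<and> k3 * x3\<^sup>2 = 0 \<and> k4 * x4\<^sup>2 = 0 \<and> k5 * x5\<^sup>2 = 0"
    using assms(6) by linarith
  then show ?thesis using assms by simp
qed

text \<open>
  The smallest eigenvalue of this matrix is about \<open>1.4\<close> and the largest about \<open>350\<close>.  This leaves
  little room for round coefficients, and the squares are completed exactly.
\<close>

lemma mode_eigenspace_1_2: "v \<in> mode_eigenspace 1 2 \<mu> \<Longrightarrow> \<mu> \<le> 0 \<Longrightarrow> v = 0"
proof (erule mode_eigenspace_nonpos_trivial)
  assume "v \<noteq> 0"
  obtain a b c d e where v: "v = (a, b, c, d, e)" by (rule prod_cases5)
  have s: "weighted_inner v (mode_op 1 2 v) = 1 / 117 * (117 * e - 50 * a - 32 * b + 36 * c - 160 * d)\<^sup>2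
      + 13478 / 117 * (d + 5360 / 6739 * a + 2120 / 6739 * b + 1008 / 6739 * c)\<^sup>2
      + 669491 / 6739 * (c + 11320 / 669491 * a - 940592 / 669491 * b)\<^sup>2
      + 35988042 / 669491 * (b - 2693464 / 5998007 * a)\<^sup>2 + 47320155 / 5998007 * a\<^sup>2" (is "_ = ?s")
    unfolding v mode_op_table weighted_inner.simps by algebra
  show "weighted_inner v (mode_op 1 2 v) > 0"
  proof (rule ccontr)
    assume "\<not> weighted_inner v (mode_op 1 2 v) > 0"
    then have "?s \<le> 0" unfolding s by (rule leI)
    from weighted_squares_nonpos[OF _ _ _ _ _ this]
    have e: "117 * e - 50 * a - 32 * b + 36 * c - 160 * d = 0"
      and d: "d + 5360 / 6739 * a + 2120 / 6739 * b + 1008 / 6739 * c = 0"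
      and c: "c + 11320 / 669491 * a - 940592 / 669491 * b = 0"
      and b: "b - 2693464 / 5998007 * a = 0" and a: "a = 0"
      by simp_all
    from b a have b: "b = 0" by simp
    from c a b have c: "c = 0" by simp
    from d a b c have d: "d = 0" by simp
    from e a b c d have "e = 0" by simp
    with a b c d show False using \<open>v \<noteq> 0\<close> by (simp add: v zero_prod_def)
  qed
qed

lemma dim_line:
  fixes w :: "'a::euclidean_space"
  assumes "w \<noteq> 0" "\<And>v. v \<in> S \<longleftrightarrow> (\<exists>t. v = t *\<^sub>R w)"
  shows "dim S = 1"
proof -
  have "S = span {w}" using assms(2) by (auto simp: span_singleton)
  then show ?thesis using assms(1) by simp
qed

lemma dim_range_inj:
  fixes f :: "'a::euclidean_space \<Rightarrow> 'b::euclidean_space"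
  assumes "linear f" "inj f"
  shows "dim (range f) = DIM('a)"
  using dim_image_eq[of f UNIV] assms by simp

lemma dim_trivial:
  fixes S :: "'a::euclidean_space set"
  shows "(\<And>v. v \<in> S \<Longrightarrow> v = 0) \<Longrightarrow> dim S = 0"
  by auto

lemma dim_mode_0_0: "dim (mode_eigenspace 0 0 \<mu>) = (if \<mu> = 0 then 4 else 0) + (if \<mu> = - 4 then 1 else 0)"
proof -
  have mem: "(a, b, c, d, e) \<in> mode_eigenspace 0 0 \<mu> \<longleftrightarrow> \<mu> * a = 0 \<and> \<mu> * b = 0 \<and> (\<mu> + 4) * c = 0 \<and> \<mu> * d = 0 \<and> \<mu> * e = 0"
    for a b c d e
  proof -
    have "- 4 * c = \<mu> * c \<longleftrightarrow> (\<mu> + 4) * c = 0" by (rule iffI; algebra)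
    then show ?thesis by (auto simp: mode_eigenspace_def mode_op_table)
  qed
  consider "\<mu> = 0" | "\<mu> = - 4" | "\<mu> \<noteq> 0" "\<mu> \<noteq> - 4" by blast
  then show ?thesis
  proof cases
    case 1
    let ?f = "\<lambda>(x, y, z, u). (x, y, 0, z, u) :: r5"
    have "mode_eigenspace 0 0 \<mu> = range ?f"
      using mem 1 by (auto simp: image_iff)
    moreover have "linear ?f" by (rule linearI) auto
    moreover have "inj ?f" by (auto simp: inj_on_def)
    ultimately show ?thesis using dim_range_inj[of ?f] 1 by simp
  next
    case 2
    have "dim (mode_eigenspace 0 0 \<mu>) = 1"
    proof (rule dim_line)
      fix v :: r5
      show "v \<in> mode_eigenspace 0 0 \<mu> \<longleftrightarrow> (\<exists>t. v = t *\<^sub>R (0, 0, 1, 0, 0))"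
        by (cases v rule: prod_cases5) (simp only: mem, simp add: 2)
    qed (simp add: zero_prod_def)
    then show ?thesis using 2 by simp
  next
    case 3
    have "v = 0" if "v \<in> mode_eigenspace 0 0 \<mu>" for v
      using that 3 by (cases v rule: prod_cases5) (simp add: mem zero_prod_def)
    then have "dim (mode_eigenspace 0 0 \<mu>) = 0" by (rule dim_trivial)
    then show ?thesis using 3 by simp
  qed
qed

lemma dim_mode_0_1:
  assumes "\<mu> \<le> 0"
  shows "dim (mode_eigenspace 0 1 \<mu>) = (if \<mu> = 0 then 3 else 0)"
proof (cases "\<mu> = 0")
  case True
  let ?f = "\<lambda>(x, y, z). (x, y, 2 * y, z, x + 2 * z) :: r5"
  have "(a, b, c, d, e) \<in> mode_eigenspace 0 1 \<mu> \<longleftrightarrow> c = 2 * b \<and> e = a + 2 * d" for a b c d e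
    unfolding mode_eigenspace_def mem_Collect_eq mode_op_table by (simp add: True zero_prod_def) linarith
  then have "mode_eigenspace 0 1 \<mu> = range ?f" by (auto simp: image_iff)
  moreover have "linear ?f" by (rule linearI) (auto simp: algebra_simps)
  moreover have "inj ?f" by (auto simp: inj_on_def)
  ultimately show ?thesis using dim_range_inj[of ?f] True by simp
next
  case False
  have "v = 0" if v: "v \<in> mode_eigenspace 0 1 \<mu>" for v
  proof (rule mode_eigenspace_neg_trivial[OF v])
    obtain a b c d e where e: "v = (a, b, c, d, e)" by (rule prod_cases5)
    have "weighted_inner v (mode_op 0 1 v) = 8 * (c - 2 * b)\<^sup>2 + 12 * (e - a - 2 * d)\<^sup>2"
      unfolding e mode_op_table weighted_inner.simps by algebra
    then show "weighted_inner v (mode_op 0 1 v) \<ge> 0" by simp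
  qed (use False assms in simp)
  then have "dim (mode_eigenspace 0 1 \<mu>) = 0" by (rule dim_trivial)
  then show ?thesis using False by simp
qed

lemma dim_mode_0_2:
  assumes "\<mu> \<le> 0"
  shows "dim (mode_eigenspace 0 2 \<mu>) = (if \<mu> = 0 then 1 else 0)"
proof (cases "\<mu> = 0")
  case True
  have "dim (mode_eigenspace 0 2 \<mu>) = 1"
  proof (rule dim_line)
    fix v :: r5
    obtain a b c d e where v: "v = (a, b, c, d, e)" by (rule prod_cases5)
    have "v \<in> mode_eigenspace 0 2 \<mu> \<longleftrightarrow> b = 0 \<and> c = 0 \<and> d = - a \<and> e = - a"
      unfolding v mode_eigenspace_def mem_Collect_eq mode_op_table by (simp add: True zero_prod_def) linarith
    then show "v \<in> mode_eigenspace 0 2 \<mu> \<longleftrightarrow> (\<exists>t. v = t *\<^sub>R (1, 0, 0, - 1, - 1))"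
      by (auto simp: v)
  qed (simp add: zero_prod_def)
  then show ?thesis using True by simp
next
  case False
  have "v = 0" if v: "v \<in> mode_eigenspace 0 2 \<mu>" for v
  proof (rule mode_eigenspace_neg_trivial[OF v])
    obtain a b c d e where e: "v = (a, b, c, d, e)" by (rule prod_cases5)
    have "weighted_inner v (mode_op 0 2 v) = 72 * (a + 2 * d - e)\<^sup>2 + 24 * (a + e)\<^sup>2 + 16 / 5 * (5 * c - 8 * b)\<^sup>2 + 96 / 5 * b\<^sup>2 + 12 * c\<^sup>2"
      unfolding e mode_op_table weighted_inner.simps by (simp add: power2_eq_square field_simps)
    then show "weighted_inner v (mode_op 0 2 v) \<ge> 0" by simp
  qed (use False assms in simp)
  then have "dim (mode_eigenspace 0 2 \<mu>) = 0" by (rule dim_trivial)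
  then show ?thesis using False by simp
qed


lemma dim_mode_2_1:
  assumes "\<mu> \<le> 0"
  shows "dim (mode_eigenspace 2 1 \<mu>) = (if \<mu> = 0 then 1 else 0)"
proof (cases "\<mu> = 0")
  case True
  have "dim (mode_eigenspace 2 1 \<mu>) = 1"
  proof (rule dim_line)
    fix v :: r5
    obtain a b c d e where v: "v = (a, b, c, d, e)" by (rule prod_cases5)
    have "v \<in> mode_eigenspace 2 1 \<mu> \<longleftrightarrow> a = 0 \<and> b = - d \<and> c = - 2 * d \<and> e = 2 * d"
      unfolding v mode_eigenspace_def mem_Collect_eq mode_op_table by (simp add: True zero_prod_def) linarith
    then show "v \<in> mode_eigenspace 2 1 \<mu> \<longleftrightarrow> (\<exists>t. v = t *\<^sub>R (0, - 1, - 2, 1, 2))"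
      by (auto simp: v)
  qed (simp add: zero_prod_def)
  then show ?thesis using True by simp
next
  case False
  have "v = 0" if v: "v \<in> mode_eigenspace 2 1 \<mu>" for v
  proof (rule mode_eigenspace_neg_trivial[OF v])
    obtain a b c d e where e: "v = (a, b, c, d, e)" by (rule prod_cases5)
    have "weighted_inner v (mode_op 2 1 v) = 16 / 9 * (a + 9 * b - 3 * c + 7 * d - 2 * e)\<^sup>2 + 8 / 45 * (2 * a + 15 * c + 2 * d + 14 * e)\<^sup>2
        + 4 / 9135 * (241 * a + 406 * d - 203 * e)\<^sup>2 + 3264 / 203 * a\<^sup>2"
      unfolding e mode_op_table weighted_inner.simps by (simp add: power2_eq_square field_simps)
    then show "weighted_inner v (mode_op 2 1 v) \<ge> 0" by simp
  qed (use False assms in simp)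
  then have "dim (mode_eigenspace 2 1 \<mu>) = 0" by (rule dim_trivial)
  then show ?thesis using False by simp
qed

text \<open>
  The matrix splits into a block on the components \<open>2, 4\<close> with eigenvalues \<open>-1\<close> and \<open>15\<close>, and a block
  on \<open>1, 3, 5\<close> with eigenvalue \<open>1\<close> and the roots \<open>3 \<plusminus> 2 \<surd>6\<close> of \<open>(5 - \<mu>) (1 - \<mu>) = 20\<close>.
\<close>

lemma dim_mode_1_0:
  assumes "\<mu> \<le> 0"
  shows "dim (mode_eigenspace 1 0 \<mu>) = (if \<mu> = - 1 then 1 else 0) + (if \<mu> = 3 - 2 * sqrt 6 then 1 else 0)"
proof -
  have r: "3 - 2 * sqrt 6 \<noteq> - 1"
  proof
    assume "3 - 2 * sqrt 6 = - 1"
    then have "sqrt 6 = 2" by simp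
    then have "sqrt 6 * sqrt 6 = 2 * 2" by simp
    then show False by simp
  qed
  have mem: "(a, b, c, d, e) \<in> mode_eigenspace 1 0 \<mu> \<longleftrightarrow>
      d = - b \<and> (\<mu> + 1) * b = 0 \<and> (1 - \<mu>) * a = 2 * e \<and> c = - 2 * a \<and> ((5 - \<mu>) * (1 - \<mu>) - 20) * e = 0" for a b c d e
  proof
    assume "(a, b, c, d, e) \<in> mode_eigenspace 1 0 \<mu>"
    then have eqs: "a - 2 * e = \<mu> * a" "7 * b + 8 * d = \<mu> * b" "c + 4 * e = \<mu> * c" "8 * b + 7 * d = \<mu> * d"
      "- 2 * a + 4 * c + 5 * e = \<mu> * e"
      by (simp_all add: mode_eigenspace_def mode_op_table)
    have "(15 - \<mu>) * (b + d) = 0" using eqs(2,4) by algebra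
    then have d: "d = - b" using assms by simp
    have "(1 - \<mu>) * (c + 2 * a) = 0" using eqs(1,3) by algebra
    then have c: "c = - 2 * a" using assms by simp
    show "d = - b \<and> (\<mu> + 1) * b = 0 \<and> (1 - \<mu>) * a = 2 * e \<and> c = - 2 * a \<and> ((5 - \<mu>) * (1 - \<mu>) - 20) * e = 0"
    proof (intro conjI d c)
      show "(\<mu> + 1) * b = 0" using eqs(2) d by algebra
      show "(1 - \<mu>) * a = 2 * e" using eqs(1) by algebra
      show "((5 - \<mu>) * (1 - \<mu>) - 20) * e = 0" using eqs(1,5) c by algebra
    qed
  next
    assume h: "d = - b \<and> (\<mu> + 1) * b = 0 \<and> (1 - \<mu>) * a = 2 * e \<and> c = - 2 * a \<and> ((5 - \<mu>) * (1 - \<mu>) - 20) * e = 0"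
    have "(1 - \<mu>) * (- 2 * a + 4 * c + 5 * e - \<mu> * e) = 0" using h by algebra
    then have "- 2 * a + 4 * c + 5 * e = \<mu> * e" using assms by simp
    moreover have "a - 2 * e = \<mu> * a" "7 * b + 8 * d = \<mu> * b" "c + 4 * e = \<mu> * c" "8 * b + 7 * d = \<mu> * d"
      using h by algebra+
    ultimately show "(a, b, c, d, e) \<in> mode_eigenspace 1 0 \<mu>"
      by (simp add: mode_eigenspace_def mode_op_table)
  qed
  have quad: "(5 - \<mu>) * (1 - \<mu>) - 20 = 0 \<longleftrightarrow> \<mu> = 3 - 2 * sqrt 6"
  proof -
    have "(5 - \<mu>) * (1 - \<mu>) - 20 = (\<mu> - 3 - 2 * sqrt 6) * (\<mu> - (3 - 2 * sqrt 6))" by (simp add: algebra_simps)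
    moreover have "\<mu> - 3 - 2 * sqrt 6 < 0" using assms real_sqrt_ge_zero[of 6] by linarith
    ultimately show ?thesis by simp
  qed
  consider "\<mu> = - 1" | "\<mu> = 3 - 2 * sqrt 6" | "\<mu> \<noteq> - 1" "\<mu> \<noteq> 3 - 2 * sqrt 6" by blast
  then show ?thesis
  proof cases
    case 1
    have "dim (mode_eigenspace 1 0 \<mu>) = 1"
    proof (rule dim_line)
      fix v :: r5
      obtain a b c d e where v: "v = (a, b, c, d, e)" by (rule prod_cases5)
      show "v \<in> mode_eigenspace 1 0 \<mu> \<longleftrightarrow> (\<exists>t. v = t *\<^sub>R (0, 1, 0, - 1, 0))"
        unfolding v mem using 1 by auto
    qed (simp add: zero_prod_def)
    then show ?thesis using 1 r by simp
  next
    case 2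
    have "dim (mode_eigenspace 1 0 \<mu>) = 1"
    proof (rule dim_line)
      fix v :: r5
      obtain a b c d e where v: "v = (a, b, c, d, e)" by (rule prod_cases5)
      have q: "(5 - \<mu>) * (1 - \<mu>) - 20 = 0" using 2 quad by blast
      have b: "\<mu> + 1 \<noteq> 0" using 2 r by linarith
      have p: "1 - \<mu> \<noteq> 0" using assms by simp
      show "v \<in> mode_eigenspace 1 0 \<mu> \<longleftrightarrow> (\<exists>t. v = t *\<^sub>R (2, 0, - 4, 0, 1 - \<mu>))"
      proof
        assume "v \<in> mode_eigenspace 1 0 \<mu>"
        then have "v = (a / 2) *\<^sub>R (2, 0, - 4, 0, 1 - \<mu>)"
          unfolding v mem using b by (auto simp: mult.commute)
        then show "\<exists>t. v = t *\<^sub>R (2, 0, - 4, 0, 1 - \<mu>)" by blast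
      next
        assume "\<exists>t. v = t *\<^sub>R (2, 0, - 4, 0, 1 - \<mu>)"
        then show "v \<in> mode_eigenspace 1 0 \<mu>"
          unfolding v mem using q by auto
      qed
    qed (simp add: zero_prod_def)
    then show ?thesis using 2 r by simp
  next
    case 3
    have "v = 0" if "v \<in> mode_eigenspace 1 0 \<mu>" for v
    proof -
      obtain a b c d e where v: "v = (a, b, c, d, e)" by (rule prod_cases5)
      have "\<mu> + 1 \<noteq> 0" "1 - \<mu> \<noteq> 0" "(5 - \<mu>) * (1 - \<mu>) - 20 \<noteq> 0" using 3 assms quad by auto
      then show ?thesis using that unfolding v mem by (auto simp: zero_prod_def)
    qed
    then have "dim (mode_eigenspace 1 0 \<mu>) = 0" by (rule dim_trivial)
    then show ?thesis using 3 by simp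
  qed
qed

lemma unique_nonneg_root:
  fixes f :: "real \<Rightarrow> real"
  assumes mono: "\<And>s t. 0 \<le> s \<Longrightarrow> s < t \<Longrightarrow> f s < f t" and cont: "continuous_on {0..b} f"
    and "f 0 < 0" "f b > 0" "b > 0"
  obtains z where "z > 0" "\<And>t. t \<ge> 0 \<Longrightarrow> f t = 0 \<longleftrightarrow> t = z"
proof -
  obtain z where z: "0 \<le> z" "z \<le> b" "f z = 0"
    using IVT'[of f 0 0 b] assms by auto
  show ?thesis
  proof (rule that)
    show "z > 0" using z \<open>f 0 < 0\<close> by (cases "z = 0") auto
    show "f t = 0 \<longleftrightarrow> t = z" if "t \<ge> 0" for t
      using mono[of t z] mono[of z t] z that by (cases t z rule: linorder_cases) auto
  qed
qed

text \<open>
  As before there is a block on the components \<open>2, 4\<close>, with eigenvalues \<open>0\<close> and \<open>80\<close>.  The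
  characteristic polynomial of the block on \<open>1, 3, 5\<close> at \<open>- t\<close> is, up to sign, the cubic \<open>f\<close>, which is
  increasing for \<open>t \<ge> 0\<close> and changes sign once.
\<close>

lemma dim_mode_2_0:
  obtains \<beta> where "\<beta> < 0"
    "\<And>\<mu>. \<mu> \<le> 0 \<Longrightarrow> dim (mode_eigenspace 2 0 \<mu>) = (if \<mu> = 0 then 1 else 0) + (if \<mu> = \<beta> then 1 else 0)"
proof -
  define f :: "real \<Rightarrow> real" where "f t = t ^ 3 + 76 * t\<^sup>2 + 768 * t - 3840" for t
  obtain z where z: "z > 0" "\<And>t. t \<ge> 0 \<Longrightarrow> f t = 0 \<longleftrightarrow> t = z"
  proof (rule unique_nonneg_root[of f 4])
    show "f s < f t" if "0 \<le> s" "s < t" for s t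
      using that power_strict_mono[of s t 3] power_strict_mono[of s t 2] by (simp add: f_def)
  qed (auto simp: f_def intro!: continuous_intros)
  have mem: "(a, b, c, d, e) \<in> mode_eigenspace 2 0 (- t) \<longleftrightarrow>
      d = - b \<and> t * b = 0 \<and> (16 + t) * a = 8 * e \<and> (28 + t) * c = - 32 * e \<and> f t * e = 0"
    if t: "t \<ge> 0" for a b c d e t
  proof
    assume h: "(a, b, c, d, e) \<in> mode_eigenspace 2 0 (- t)"
    have eqs: "16 * a - 8 * e = - t * a" "40 * b + 40 * d = - t * b" "28 * c + 32 * e = - t * c"
      "40 * b + 40 * d = - t * d" "- 8 * a + 32 * c + 32 * e = - t * e"
      using h[unfolded mode_eigenspace_def mem_Collect_eq mode_op_table scaleR_Pair prod.inject real_scaleR_def] by blast+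
    have "(80 + t) * (b + d) = 0" using eqs(2,4) by algebra
    then have d: "d = - b" using t by simp
    show "d = - b \<and> t * b = 0 \<and> (16 + t) * a = 8 * e \<and> (28 + t) * c = - 32 * e \<and> f t * e = 0"
    proof (intro conjI d)
      show "t * b = 0" using eqs(2) d by algebra
      show "(16 + t) * a = 8 * e" "(28 + t) * c = - 32 * e" using eqs(1,3) by algebra+
      show "f t * e = 0" using eqs(1,3,5) unfolding f_def by algebra
    qed
  next
    assume h: "d = - b \<and> t * b = 0 \<and> (16 + t) * a = 8 * e \<and> (28 + t) * c = - 32 * e \<and> f t * e = 0"
    have "(16 + t) * (28 + t) * (- 8 * a + 32 * c + 32 * e + t * e) = 0"
      using h unfolding f_def by algebra
    then have "- 8 * a + 32 * c + 32 * e + t * e = 0" using t by simp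
    moreover have "16 * a - 8 * e = - t * a" "40 * b + 40 * d = - t * b" "28 * c + 32 * e = - t * c"
      "40 * b + 40 * d = - t * d"
      using h by algebra+
    ultimately show "(a, b, c, d, e) \<in> mode_eigenspace 2 0 (- t)"
      by (simp add: mode_eigenspace_def mode_op_table)
  qed
  show ?thesis
  proof (rule that)
    show "- z < 0" using z by simp
    fix \<mu> :: real assume "\<mu> \<le> 0"
    then obtain t where t: "\<mu> = - t" "t \<ge> 0" by (metis minus_minus neg_0_le_iff_le)
    consider "t = 0" | "t = z" | "t \<noteq> 0" "t \<noteq> z" by blast
    then show "dim (mode_eigenspace 2 0 \<mu>) = (if \<mu> = 0 then 1 else 0) + (if \<mu> = - z then 1 else 0)"
    proof cases
      case 1
      have "dim (mode_eigenspace 2 0 (- t)) = 1"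
      proof (rule dim_line)
        fix v :: r5
        obtain a b c d e where v: "v = (a, b, c, d, e)" by (rule prod_cases5)
        show "v \<in> mode_eigenspace 2 0 (- t) \<longleftrightarrow> (\<exists>t. v = t *\<^sub>R (0, 1, 0, - 1, 0))"
          unfolding v mem[OF t(2)] using 1 by (auto simp: f_def)
      qed (simp add: zero_prod_def)
      then show ?thesis using 1 t z by simp
    next
      case 2
      have "dim (mode_eigenspace 2 0 (- t)) = 1"
      proof (rule dim_line)
        fix v :: r5
        obtain a b c d e where v: "v = (a, b, c, d, e)" by (rule prod_cases5)
        let ?w = "(8 / (16 + t), 0, - 32 / (28 + t), 0, 1) :: r5"
        have nz: "16 + t \<noteq> 0" "28 + t \<noteq> 0" "t \<noteq> 0" "f t = 0" using t z 2 by auto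
        show "v \<in> mode_eigenspace 2 0 (- t) \<longleftrightarrow> (\<exists>s. v = s *\<^sub>R ?w)"
        proof
          assume "v \<in> mode_eigenspace 2 0 (- t)"
          then have "v = e *\<^sub>R ?w"
            unfolding v mem[OF t(2)] using nz by (auto simp: field_simps)
          then show "\<exists>s. v = s *\<^sub>R ?w" by blast
        next
          assume "\<exists>s. v = s *\<^sub>R ?w"
          then show "v \<in> mode_eigenspace 2 0 (- t)"
            unfolding v mem[OF t(2)] using nz by auto
        qed
      qed (simp add: zero_prod_def)
      then show ?thesis using 2 t z by simp
    next
      case 3
      have "v = 0" if "v \<in> mode_eigenspace 2 0 (- t)" for v
      proof -
        obtain a b c d e where v: "v = (a, b, c, d, e)" by (rule prod_cases5)
        have "16 + t \<noteq> 0" "28 + t \<noteq> 0" "f t \<noteq> 0" using 3 t z by auto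
        then show ?thesis using that 3 unfolding v mem[OF t(2)] by (auto simp: zero_prod_def)
      qed
      then have "dim (mode_eigenspace 2 0 (- t)) = 0" by (rule dim_trivial)
      then show ?thesis using 3 t by simp
    qed
  qed
qed


text \<open>
  The matrix is positive definite on the hyperplane where the first component vanishes, so
  eigenvectors for \<open>\<mu> \<le> 0\<close> are determined by their first component.  The characteristic polynomial
  at \<open>- t\<close> is, up to sign, the quintic \<open>f\<close>, increasing for \<open>t \<ge> 0\<close> with a single zero; there the first
  column \<open>w t\<close> of the adjugate of \<open>mode_op 1 1 + t\<close> is an eigenvector.
\<close>

lemma dim_mode_1_1:
  obtains \<alpha> where "\<alpha> < 0" "\<And>\<mu>. \<mu> \<le> 0 \<Longrightarrow> dim (mode_eigenspace 1 1 \<mu>) = (if \<mu> = \<alpha> then 1 else 0)"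
proof -
  define f :: "real \<Rightarrow> real" where "f t = t ^ 5 + 117 * t ^ 4 + 3162 * t ^ 3 + 19578 * t\<^sup>2 + 1317 * t - 59247" for t
  obtain z where z: "z > 0" "\<And>t. t \<ge> 0 \<Longrightarrow> f t = 0 \<longleftrightarrow> t = z"
  proof (rule unique_nonneg_root[of f 2])
    show "f s < f t" if "0 \<le> s" "s < t" for s t
      using that power_strict_mono[of s t 5] power_strict_mono[of s t 4] power_strict_mono[of s t 3]
        power_strict_mono[of s t 2] by (simp add: f_def)
  qed (auto simp: f_def intro!: continuous_intros)
  \<comment> \<open>The first column of the adjugate, whose first entry is a principal minor.\<close>
  define w :: "real \<Rightarrow> r5" where
    "w t = (t ^ 4 + 100 * t ^ 3 + 2202 * t\<^sup>2 + 13020 * t + 15717, - 4 * t ^ 3 + 76 * t\<^sup>2 - 828 * t - 4812,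
      - 520 * t\<^sup>2 - 7728 * t - 18504, - 16 * t ^ 3 - 752 * t\<^sup>2 - 5808 * t - 4176,
      14 * t ^ 3 + 530 * t\<^sup>2 + 3090 * t + 11022)" for t
  have w1: "fst (w t) > 0" if "t \<ge> 0" for t
    using that by (simp add: w_def add_nonneg_pos)
  have w: "mode_op 1 1 (w t) = (- t) *\<^sub>R w t + (f t, 0, 0, 0, 0)" for t
    unfolding w_def mode_op_table f_def by (simp, intro conjI; algebra)
  have sym: "weighted_inner v (mode_op 1 1 u) = weighted_inner (mode_op 1 1 v) u" for u v
  proof -
    obtain a b c d e where v: "v = (a, b, c, d, e)" by (rule prod_cases5)
    obtain a' b' c' d' e' where u: "u = (a', b', c', d', e')" by (rule prod_cases5)
    show ?thesis unfolding v u mode_op_table weighted_inner.simps by algebra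
  qed
  \<comment> \<open>Pairing an eigenvector with \<open>w t\<close> and using symmetry.\<close>
  have root: "f t * fst v = 0" if "v \<in> mode_eigenspace 1 1 (- t)" for v t
  proof -
    have "weighted_inner v (mode_op 1 1 (w t)) = - t * weighted_inner v (w t) + f t * fst v"
      unfolding w by (cases v; cases "w t") (simp add: algebra_simps)
    moreover have "weighted_inner (mode_op 1 1 v) (w t) = - t * weighted_inner v (w t)"
      using that by (cases v; cases "w t") (simp add: mode_eigenspace_def algebra_simps)
    ultimately show ?thesis using sym[of v "w t"] by simp
  qed
  have pivot: "v = 0" if v: "v \<in> mode_eigenspace 1 1 \<mu>" and "\<mu> \<le> 0" "fst v = 0" for v \<mu>
    using v \<open>\<mu> \<le> 0\<close>
  proof (rule mode_eigenspace_nonpos_trivial)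
    assume "v \<noteq> 0"
    obtain b c d e where e: "v = (0, b, c, d, e)" using \<open>fst v = 0\<close> by (cases v rule: prod_cases5) simp
    have s: "weighted_inner v (mode_op 1 1 v) = (4 * c - 6 * b - 4 * d + 3 * e)\<^sup>2 + 4 * (2 * b + d)\<^sup>2
        + 10 * (2 * d - e)\<^sup>2 + 2 * (b + e)\<^sup>2 + c\<^sup>2 + 10 * d\<^sup>2" (is "_ = ?s")
      unfolding e mode_op_table weighted_inner.simps by algebra
    have "?s \<noteq> 0"
    proof
      assume "?s = 0"
      then have "d = 0" "c = 0" "2 * b + d = 0" "2 * d - e = 0"
        by (simp_all add: add_nonneg_eq_0_iff)
      then show False using \<open>v \<noteq> 0\<close> by (simp add: e zero_prod_def)
    qed
    moreover have "?s \<ge> 0" by simp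
    ultimately show "weighted_inner v (mode_op 1 1 v) > 0" unfolding s by linarith
  qed
  show ?thesis
  proof (rule that)
    show "- z < 0" using z by simp
    fix \<mu> :: real assume "\<mu> \<le> 0"
    then obtain t where t: "\<mu> = - t" "t \<ge> 0" by (metis minus_minus neg_0_le_iff_le)
    show "dim (mode_eigenspace 1 1 \<mu>) = (if \<mu> = - z then 1 else 0)"
    proof (cases "t = z")
      case True
      have "dim (mode_eigenspace 1 1 (- t)) = 1"
      proof (rule dim_line)
        show "w t \<noteq> 0" using w1[OF t(2)] by auto
        fix v :: r5
        have wt: "w t \<in> mode_eigenspace 1 1 (- t)"
          using w[of t] z t True by (simp add: mode_eigenspace_def zero_prod_def)
        show "v \<in> mode_eigenspace 1 1 (- t) \<longleftrightarrow> (\<exists>s. v = s *\<^sub>R w t)"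
        proof
          assume v: "v \<in> mode_eigenspace 1 1 (- t)"
          have "v - (fst v / fst (w t)) *\<^sub>R w t = 0"
          proof (rule pivot)
            show "v - (fst v / fst (w t)) *\<^sub>R w t \<in> mode_eigenspace 1 1 (- t)"
              by (intro subspace_diff subspace_scale subspace_mode_eigenspace v wt)
          qed (use t w1[OF t(2)] in simp_all)
          then show "\<exists>s. v = s *\<^sub>R w t" by auto
        next
          assume "\<exists>s. v = s *\<^sub>R w t"
          then show "v \<in> mode_eigenspace 1 1 (- t)" using subspace_scale[OF subspace_mode_eigenspace wt] by auto
        qed
      qed
      then show ?thesis using True t by simp
    next
      case False
      have "v = 0" if v: "v \<in> mode_eigenspace 1 1 (- t)" for v
      proof (rule pivot[OF v])
        show "fst v = 0" using root[OF v] z t False by simp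
      qed (use t in simp)
      then have "dim (mode_eigenspace 1 1 (- t)) = 0" by (rule dim_trivial)
      then show ?thesis using False t by simp
    qed
  qed
qed

section \<open>Adding up the modes\<close>

text \<open>
  The reflections of the torus act on the amplitudes by sign changes: those of the components
  \<open>1, 4, 5\<close> for \<open>m\<close> and those of \<open>2, 4\<close> for \<open>n\<close>.
\<close>

lemma dim_mode_eigenspace_uminus:
  "dim (mode_eigenspace (- m) n \<mu>) = dim (mode_eigenspace m n \<mu>)" "dim (mode_eigenspace m (- n) \<mu>) = dim (mode_eigenspace m n \<mu>)"
proof -
  have flip: "dim {v. g v \<in> mode_eigenspace m n \<mu>} = dim (mode_eigenspace m n \<mu>)"
    if "linear g" "\<And>v. g (g v) = v" for g
  proof -
    have "{v. g v \<in> mode_eigenspace m n \<mu>} = g ` mode_eigenspace m n \<mu>"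
    proof (intro set_eqI iffI)
      fix v assume "v \<in> {v. g v \<in> mode_eigenspace m n \<mu>}"
      then have "g (g v) \<in> g ` mode_eigenspace m n \<mu>" by blast
      then show "v \<in> g ` mode_eigenspace m n \<mu>" by (simp only: that(2))
    qed (auto simp: that(2))
    moreover have "inj_on g A" for A by (rule inj_on_inverseI) (rule that(2))
    ultimately show ?thesis by (simp add: dim_image_eq[OF that(1)])
  qed
  let ?g = "\<lambda>(a, b, c, d, e). (- a, b, c, - d, - e) :: r5"
  have lin: "linear ?g" by (rule linearI) auto
  have inv: "?g (?g v) = v" for v by (cases v) auto
  have "mode_jacobi (- m) n (?g v) = ?g (mode_jacobi m n v)" "mode_defect (- m) n (?g v) = ?g (mode_defect m n v)" for v
    by (cases v; simp)+
  then have "mode_op (- m) n (?g v) = ?g (mode_op m n v)" for v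
    by (simp only: mode_op_def linear_diff[OF lin])
  then have "mode_op (- m) n v = ?g (mode_op m n (?g v))" for v
    by (metis inv)
  then have "v \<in> mode_eigenspace (- m) n \<mu> \<longleftrightarrow> ?g v \<in> mode_eigenspace m n \<mu>" for v
    unfolding mode_eigenspace_def mem_Collect_eq by (metis inv linear_cmul[OF lin])
  then have "mode_eigenspace (- m) n \<mu> = {v. ?g v \<in> mode_eigenspace m n \<mu>}" by blast
  then show "dim (mode_eigenspace (- m) n \<mu>) = dim (mode_eigenspace m n \<mu>)"
    by (simp only: flip[OF lin inv])
  let ?h = "\<lambda>(a, b, c, d, e). (a, - b, c, - d, e) :: r5"
  have lin: "linear ?h" by (rule linearI) auto
  have inv: "?h (?h v) = v" for v by (cases v) auto
  have "mode_jacobi m (- n) (?h v) = ?h (mode_jacobi m n v)" "mode_defect m (- n) (?h v) = ?h (mode_defect m n v)" for v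
    by (cases v; simp)+
  then have "mode_op m (- n) (?h v) = ?h (mode_op m n v)" for v
    by (simp only: mode_op_def linear_diff[OF lin])
  then have "mode_op m (- n) v = ?h (mode_op m n (?h v))" for v
    by (metis inv)
  then have "v \<in> mode_eigenspace m (- n) \<mu> \<longleftrightarrow> ?h v \<in> mode_eigenspace m n \<mu>" for v
    unfolding mode_eigenspace_def mem_Collect_eq by (metis inv linear_cmul[OF lin])
  then have "mode_eigenspace m (- n) \<mu> = {v. ?h v \<in> mode_eigenspace m n \<mu>}" by blast
  then show "dim (mode_eigenspace m (- n) \<mu>) = dim (mode_eigenspace m n \<mu>)"
    by (simp only: flip[OF lin inv])
qed

lemma dim_mode_eigenspace_abs: "dim (mode_eigenspace (of_int m) (of_int n) \<mu>) = dim (mode_eigenspace (real (nat \<bar>m\<bar>)) (real (nat \<bar>n\<bar>)) \<mu>)"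
  using dim_mode_eigenspace_uminus(1)[of "of_int m" "of_int n" \<mu>] dim_mode_eigenspace_uminus(2)[of "\<bar>of_int m\<bar>" "of_int n" \<mu>]
  by (auto simp: abs_if)

definition low_modes :: "(int \<times> int) set" where
  "low_modes = {- 2..2} \<times> {- 2..2}"

text \<open>
  The estimate for high modes covers everything except \<open>(3, 0)\<close> and \<open>(3, 1)\<close>.
\<close>

lemma mode_eigenspace_outside_low_modes:
  assumes mn: "(m, n) \<notin> low_modes" and \<mu>: "\<mu> \<le> 0"
  shows "mode_eigenspace (of_int m) (of_int n) \<mu> = {0}"
proof -
  define M N where "M = nat \<bar>m\<bar>" and "N = nat \<bar>n\<bar>"
  have "M \<ge> 3 \<or> N \<ge> 3" using mn by (auto simp: low_modes_def M_def N_def)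
  then consider "M \<ge> 4 \<or> N \<ge> 3 \<or> M = 3 \<and> N = 2" | "M = 3" "N = 0" | "M = 3" "N = 1"
    by linarith
  then have "v = 0" if "v \<in> mode_eigenspace (real M) (real N) \<mu>" for v
  proof cases
    case 1
    have s: "real k = 0 \<and> real (k - 1) = 0 \<or> real k \<ge> 1 \<and> real (k - 1) = real k - 1" for k
      by (cases k) auto
    show ?thesis
      using mode_eigenspace_high[OF s[of M] s[of N] _ _ \<mu> that] high_mode_numbers[OF 1] by blast
  next
    case 2
    then show ?thesis using that mode_eigenspace_3_0[OF _ \<mu>] by simp
  next
    case 3
    then show ?thesis using that mode_eigenspace_3_1[OF _ \<mu>] by simp
  qed
  then have "dim (mode_eigenspace (real M) (real N) \<mu>) = 0" by (rule dim_trivial)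
  then have "mode_eigenspace (of_int m) (of_int n) \<mu> \<subseteq> {0}"
    unfolding M_def N_def dim_mode_eigenspace_abs[symmetric] by simp
  then show ?thesis using subspace_0[OF subspace_mode_eigenspace] by blast
qed

text \<open>
  The factors count the sign choices.
\<close>

lemma edim_eigenspace_phi_nonpos:
  assumes "\<mu> \<le> 0"
  shows "edim (eigenspace phi \<mu>) = enat (dim (mode_eigenspace 0 0 \<mu>) + 2 * dim (mode_eigenspace 1 0 \<mu>) + 2 * dim (mode_eigenspace 2 0 \<mu>)
     + 2 * dim (mode_eigenspace 0 1 \<mu>) + 2 * dim (mode_eigenspace 0 2 \<mu>) + 4 * dim (mode_eigenspace 1 1 \<mu>) + 4 * dim (mode_eigenspace 2 1 \<mu>))"
proof -
  have "dim (mode_eigenspace 1 2 \<mu>) = 0" "dim (mode_eigenspace 2 2 \<mu>) = 0"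
    using mode_eigenspace_1_2 mode_eigenspace_2_2 assms by (blast intro: dim_trivial)+
  moreover have "{- 2..2} = {- 2, - 1, 0, 1, 2 :: int}" by auto
  ultimately have "(\<Sum>(m, n)\<in>low_modes. dim (mode_eigenspace (of_int m) (of_int n) \<mu>)) =
     dim (mode_eigenspace 0 0 \<mu>) + 2 * dim (mode_eigenspace 1 0 \<mu>) + 2 * dim (mode_eigenspace 2 0 \<mu>)
     + 2 * dim (mode_eigenspace 0 1 \<mu>) + 2 * dim (mode_eigenspace 0 2 \<mu>) + 4 * dim (mode_eigenspace 1 1 \<mu>) + 4 * dim (mode_eigenspace 2 1 \<mu>)"
    unfolding low_modes_def sum.cartesian_product[symmetric]
    by (simp add: dim_mode_eigenspace_uminus del: dim_eq_0)
  then show ?thesis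
    using edim_eigenspace_phi[OF _ mode_eigenspace_outside_low_modes[OF _ assms], of low_modes]
    by (simp add: low_modes_def del: dim_eq_0)
qed

theorem theorem1p11:
  shows "Index phi = 11 \<and> Nullity phi = 18"
proof -
  obtain \<beta> where \<beta>: "\<beta> < 0"
    "\<And>\<mu>. \<mu> \<le> 0 \<Longrightarrow> dim (mode_eigenspace 2 0 \<mu>) = (if \<mu> = 0 then 1 else 0) + (if \<mu> = \<beta> then 1 else 0)"
    by (rule dim_mode_2_0) (rule that)
  obtain \<alpha> where \<alpha>: "\<alpha> < 0" "\<And>\<mu>. \<mu> \<le> 0 \<Longrightarrow> dim (mode_eigenspace 1 1 \<mu>) = (if \<mu> = \<alpha> then 1 else 0)"
    by (rule dim_mode_1_1) (rule that)
  define \<rho> where "\<rho> = 3 - 2 * sqrt 6"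
  have "sqrt 6 > 3 / 2" by (rule real_less_rsqrt) (simp add: power2_eq_square)
  then have \<rho>: "\<rho> < 0" by (simp add: \<rho>_def)
  have zero: "edim (eigenspace phi 0) = enat 18"
    using \<alpha> \<beta> \<rho>
    by (simp add: edim_eigenspace_phi_nonpos dim_mode_0_0 dim_mode_1_0 dim_mode_0_1 dim_mode_0_2 dim_mode_2_1
        \<rho>_def[symmetric] del: dim_eq_0)
  \<comment> \<open>A sum of indicators, so that coinciding eigenvalues would simply add up.\<close>
  define mult :: "real \<Rightarrow> nat" where "mult \<mu> = (if \<mu> = - 4 then 1 else 0) + 2 * (if \<mu> = - 1 then 1 else 0)
    + 2 * (if \<mu> = \<rho> then 1 else 0) + 2 * (if \<mu> = \<beta> then 1 else 0) + 4 * (if \<mu> = \<alpha> then 1 else 0)" for \<mu>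
  have neg: "edim (eigenspace phi \<mu>) = enat (mult \<mu>)" if "\<mu> < 0" for \<mu>
    using that \<alpha>(2)[of \<mu>] \<beta>(2)[of \<mu>]
    by (simp add: edim_eigenspace_phi_nonpos dim_mode_0_0 dim_mode_1_0 dim_mode_0_1 dim_mode_0_2 dim_mode_2_1
        \<rho>_def mult_def del: dim_eq_0)
  define Z where "Z = {- 4, - 1, \<rho>, \<beta>, \<alpha>}"
  have Z: "finite Z" "- 4 \<in> Z" "- 1 \<in> Z" "\<rho> \<in> Z" "\<beta> \<in> Z" "\<alpha> \<in> Z" "Z \<subseteq> {..<0}"
    using \<alpha> \<beta> \<rho> by (auto simp: Z_def)
  have "Index phi = (\<Sum>\<^sub>\<infinity>\<mu>\<in>Z. enat (mult \<mu>))"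
    unfolding Index_def
  proof (rule infsum_cong_neutral)
    fix \<mu> assume "\<mu> \<in> {..<0} - Z"
    then show "edim (eigenspace phi \<mu>) = 0"
      by (auto simp: neg mult_def Z_def zero_enat_def)
  qed (use Z neg in auto)
  also have "\<dots> = (\<Sum>\<mu>\<in>Z. enat (mult \<mu>))" by (rule infsum_finite[OF Z(1)])
  also have "\<dots> = enat (\<Sum>\<mu>\<in>Z. mult \<mu>)" by (simp flip: of_nat_eq_enat)
  also have "(\<Sum>\<mu>\<in>Z. mult \<mu>) = 11"
    unfolding mult_def sum.distrib sum_distrib_left[symmetric] using Z by simp
  finally have "Index phi = 11" by (simp add: numeral_eq_enat)
  moreover have "Nullity phi = 18"
    using zero by (simp add: Nullity_def eigenspace_def numeral_eq_enat)
  ultimately show ?thesis by blast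
qed

end
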